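(* Let $k\geq 8$ be an integer. Then the only mixed cospectral mate of $P_{4k+1}$ (other than mixed graphs switching equivalent to $P_{4k+1}$ itself) is the disjoint union $P_{2k}\cup C^{1}_{2k+1}$; that is, every mixed graph $Y$ with $\mathrm{Spec}_H(Y)=\mathrm{Spec}_H(P_{4k+1})$ is switching equivalent to a mixed graph isomorphic to $P_{4k+1}$ or to $P_{2k}\cup C^{1}_{2k+1}$.
   Context: A mixed graph has undirected edges and directed edges (ordered pairs $(x,y)$). For vertices $v_1,\dots,v_n$, its Hermitian adjacency matrix $H(X)$ has $(j,k)$ entry $1$ if $v_jv_k$ is an undirected edge, $i$ if $(v_j,v_k)$ is a directed edge, $-i$ if $(v_k,v_j)$ is a directed edge, $0$ otherwise; $\mathrm{Spec}_H(X)$ is its multiset of eigenvalues, and $Y$ is a cospectral mate of $X$ if $\mathrm{Spec}_H(Y)=\mathrm{Spec}_H(X)$. Mixed graphs $X,Y$ on the same vertex set are switching equivalent if $H(X)=D^{-1}H(Y)D$ for a diagonal $D$ with diagonal entries in $\{\pm1,\pm i\}$. $P_n$ is the path on $n$ vertices with all edges undirected; $C^1_m$ is the mixed cycle of order $m$ with exactly one directed edge and all other edges undirected; $\cup$ denotes disjoint union. *)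

theory Defs
  imports
    Complex_Main
    "HOL-Library.Multiset"
    "HOL-Computational_Algebra.Polynomial"
    "Jordan_Normal_Form.Matrix"
    "Jordan_Normal_Form.Char_Poly"
begin

record 'a mgraph =
  verts :: "'a set"
  uedges :: "'a set set"
  arcs :: "('a \<times> 'a) set"

text \<open>Finite and loopless, and any two vertices are joined in at most one of the three ways
  (undirected edge, arc in one direction, arc in the other).\<close>

definition mixed_graph :: "'a mgraph \<Rightarrow> bool" where
  "mixed_graph X \<longleftrightarrow>
     finite (verts X) \<and>
     (\<forall>e\<in>uedges X. \<exists>x\<in>verts X. \<exists>y\<in>verts X. x \<noteq> y \<and> e = {x, y}) \<and>
     (\<forall>(x, y)\<in>arcs X. x \<in> verts X \<and> y \<in> verts X \<and> x \<noteq> y \<and>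
        (y, x) \<notin> arcs X \<and> {x, y} \<notin> uedges X)"

definition herm_entry :: "'a mgraph \<Rightarrow> 'a \<Rightarrow> 'a \<Rightarrow> complex" where
  "herm_entry X u v =
     (if {u, v} \<in> uedges X then 1
      else if (u, v) \<in> arcs X then \<i>
      else if (v, u) \<in> arcs X then - \<i>
      else 0)"

text \<open>The enumeration \<open>v\<^sub>1, \<dots>, v\<^sub>n\<close> of the vertices depends on the vertex set only, so
  mixed graphs on the same vertex set use the same one.\<close>

definition vert_list :: "'a set \<Rightarrow> 'a list" where
  "vert_list V = (SOME vs. distinct vs \<and> set vs = V)"

definition herm_mat :: "'a mgraph \<Rightarrow> complex mat" where
  "herm_mat X = mat (card (verts X)) (card (verts X))
     (\<lambda>(j, k). herm_entry X (vert_list (verts X) ! j) (vert_list (verts X) ! k))"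

definition spec_H :: "'a mgraph \<Rightarrow> complex multiset" where
  "spec_H X = proots (char_poly (herm_mat X))"

definition cospectral_mate :: "'a mgraph \<Rightarrow> 'b mgraph \<Rightarrow> bool" where
  "cospectral_mate Y X \<longleftrightarrow> mixed_graph Y \<and> spec_H Y = spec_H X"

text \<open>\<open>similar_mat_wit A B E D\<close> says that \<open>E\<close> is the inverse of \<open>D\<close> and that \<open>A = E * B * D\<close>.\<close>

definition switching_equivalent :: "'a mgraph \<Rightarrow> 'a mgraph \<Rightarrow> bool" where
  "switching_equivalent X Y \<longleftrightarrow>
     verts X = verts Y \<and>
     (\<exists>D E. diagonal_mat D \<and> (\<forall>j<dim_row D. D $$ (j, j) \<in> {1, -1, \<i>, -\<i>}) \<and>
        similar_mat_wit (herm_mat X) (herm_mat Y) E D)"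

definition mg_isomorphic :: "'a mgraph \<Rightarrow> 'b mgraph \<Rightarrow> bool" where
  "mg_isomorphic X Y \<longleftrightarrow>
     (\<exists>f. bij_betw f (verts X) (verts Y) \<and>
        (\<forall>x\<in>verts X. \<forall>y\<in>verts X.
           ({x, y} \<in> uedges X \<longleftrightarrow> {f x, f y} \<in> uedges Y) \<and>
           ((x, y) \<in> arcs X \<longleftrightarrow> (f x, f y) \<in> arcs Y)))"

definition switching_isomorphic :: "'a mgraph \<Rightarrow> 'b mgraph \<Rightarrow> bool" where
  "switching_isomorphic Y X \<longleftrightarrow>
     (\<exists>Z. mixed_graph Z \<and> switching_equivalent Y Z \<and> mg_isomorphic Z X)"

definition mpath :: "nat \<Rightarrow> nat mgraph" where
  "mpath n = \<lparr>verts = {..<n}, uedges = {{i, Suc i} | i. Suc i < n}, arcs = {}\<rparr>"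

text \<open>The mixed cycle \<open>C\<^sup>1\<^sub>m\<close>, meaningful for \<open>m \<ge> 3\<close>: the undirected path
  \<open>0, \<dots>, m - 1\<close> closed by the single arc from \<open>m - 1\<close> to \<open>0\<close>.\<close>

definition mcycle1 :: "nat \<Rightarrow> nat mgraph" where
  "mcycle1 m = \<lparr>verts = {..<m}, uedges = {{i, Suc i} | i. Suc i < m}, arcs = {(m - 1, 0)}\<rparr>"

definition disj_union :: "'a mgraph \<Rightarrow> 'b mgraph \<Rightarrow> ('a + 'b) mgraph" where
  "disj_union X Y =
     \<lparr>verts = verts X <+> verts Y,
      uedges = (\<lambda>e. Inl ` e) ` uedges X \<union> (\<lambda>e. Inr ` e) ` uedges Y,
      arcs = map_prod Inl Inl ` arcs X \<union> map_prod Inr Inr ` arcs Y\<rparr>"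

end

theory Submission
  imports
    Defs
    "HOL-Library.Function_Algebras"
    "HOL-Number_Theory.Number_Theory"
    "HOL-Computational_Algebra.Fundamental_Theorem_Algebra"
    "Jordan_Normal_Form.Char_Poly"
begin

text \<open>All eigenvalues of \<open>Y\<close> lie in \<open>(-2, 2)\<close>, so \<open>2 + H\<close> and \<open>2 - H\<close> are positive definite and the
  vertices of the bipartite double cover of a component become norm-2 vectors with Gaussian integer inner
  products. If a component of the cover has at least nine vertices, then a vertex with three neighbours forces
  two of them to be congruent modulo 2 up to a unit (the lattice is of type \<open>D\<close>, not of exceptional type),
  and then \<open>4\<close> divides \<open>det (2 - H) = 4 k + 2\<close>. The component that carries the largest eigenvalue is that big,
  since by Galois conjugation it carries at least five eigenvalues of the path. Hence it has maximal
  degree two; comparing the eigenvector recurrence with the largest eigenvalue shows that it is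
  either a path and all of \<open>Y\<close>, or a cycle of length \<open>2 k + 1\<close> with holonomy \<open>\<plusminus>\<i>\<close>. In the latter case what remains has the
  spectrum of the path on \<open>2 k\<close> vertices, and the same argument applies to it.\<close>

subsection \<open>Gaussian lattices generated by vectors of norm 2\<close>

text \<open>The double cover serves two ends. Its Gram matrix, 2 plus the adjacency of the cover,
  handles 2 + H and 2 - H at once; and vectors on one sheet are orthogonal, so three neighbours of a
  vertex always form a claw, even when they are adjacent in \<open>Y\<close>. The number nine is one
  more than the rank 8 of the largest exceptional lattice, of type E8 over the Gaussian integers.
  The classification of root lattices is replaced by a direct argument: in a longest family of
  norm-1 vectors whose pairwise sums lie in the lattice, all generators have integral coordinates,
  because half-integral ones would either lengthen the family or confine the lattice to dimension 6,
  7 or 8. The spectrum of the cover is symmetric, so five eigenvalues of the component become ten.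
  They are supplied by odd numbers below 2 k + 1 and coprime to it; there are five of these as soon
  as 2 k + 1 is at least 17, whereas 15 has only 1, 7, 11 and 13. This is where k \<ge> 8 enters.
  The determinant yields its information in the form that no two columns are congruent modulo 2 up
  to a unit, since that form is inherited by what remains after a cycle is removed.\<close>

definition gint :: "complex set" where
  "gint = {z. Re z \<in> \<int> \<and> Im z \<in> \<int>}"

definition gunit :: "complex set" where
  "gunit = {1, -1, \<i>, -\<i>}"

lemma gint_add [intro]: "x \<in> gint \<Longrightarrow> y \<in> gint \<Longrightarrow> x + y \<in> gint"
  and gint_diff [intro]: "x \<in> gint \<Longrightarrow> y \<in> gint \<Longrightarrow> x - y \<in> gint"
  and gint_mult [intro]: "x \<in> gint \<Longrightarrow> y \<in> gint \<Longrightarrow> x * y \<in> gint"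
  and gint_minus [intro]: "x \<in> gint \<Longrightarrow> - x \<in> gint"
  and gint_cnj [intro]: "x \<in> gint \<Longrightarrow> cnj x \<in> gint"
  by (auto simp: gint_def)

lemma gint_simps [simp, intro]: "0 \<in> gint" "1 \<in> gint" "\<i> \<in> gint" "of_int k \<in> gint" "of_nat l \<in> gint"
  "numeral n \<in> gint"
  by (auto simp: gint_def)

lemma gint_minus_iff [simp]: "- x \<in> gint \<longleftrightarrow> x \<in> gint"
  by (auto simp: gint_def minus_in_Ints_iff)

lemma gint_sum: "(\<And>x. x \<in> A \<Longrightarrow> f x \<in> gint) \<Longrightarrow> sum f A \<in> gint"
  by (induction A rule: infinite_finite_induct) auto

lemma gint_prod: "(\<And>x. x \<in> A \<Longrightarrow> f x \<in> gint) \<Longrightarrow> prod f A \<in> gint"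
  by (induction A rule: infinite_finite_induct) auto

lemma gunit_gint [intro]: "u \<in> gunit \<Longrightarrow> u \<in> gint"
  by (auto simp: gunit_def)

lemma gunit_norm: "u \<in> gunit \<Longrightarrow> cmod u = 1"
  by (auto simp: gunit_def)

lemma gunit_cnj [intro]: "u \<in> gunit \<Longrightarrow> cnj u \<in> gunit"
  by (auto simp: gunit_def)

lemma gunit_mult [intro]: "u \<in> gunit \<Longrightarrow> v \<in> gunit \<Longrightarrow> u * v \<in> gunit"
  by (auto simp: gunit_def)

lemma gunit_minus [intro]: "u \<in> gunit \<Longrightarrow> - u \<in> gunit"
  by (auto simp: gunit_def)

lemma gunit_mult_cnj: "u \<in> gunit \<Longrightarrow> u * cnj u = 1" "u \<in> gunit \<Longrightarrow> cnj u * u = 1"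
  by (auto simp: gunit_def)

lemma gunit_nonzero: "u \<in> gunit \<Longrightarrow> u \<noteq> 0"
  by (auto simp: gunit_def)

lemma gint_norm_square: "z \<in> gint \<Longrightarrow> \<exists>k::nat. (cmod z)\<^sup>2 = of_nat k"
proof -
  assume "z \<in> gint"
  then obtain a b where ab: "Re z = of_int a" "Im z = of_int b"
    by (auto simp: gint_def elim!: Ints_cases)
  then have "(cmod z)\<^sup>2 = of_int (a^2 + b^2)" by (simp add: cmod_power2)
  also have "\<dots> = of_nat (nat (a^2 + b^2))" by simp
  finally show ?thesis by blast
qed

lemma gint_norm_1: "z \<in> gint \<Longrightarrow> (cmod z)\<^sup>2 = 1 \<Longrightarrow> z \<in> gunit"
proof -
  assume "z \<in> gint" and z: "(cmod z)\<^sup>2 = 1"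
  then obtain a b where ab: "Re z = of_int a" "Im z = of_int b"
    by (auto simp: gint_def elim!: Ints_cases)
  then have "real_of_int (a^2 + b^2) = 1" using z by (simp add: cmod_power2)
  then have e: "a^2 + b^2 = 1" by linarith
  have "a^2 \<le> 1" "b^2 \<le> 1" using e by (simp_all add: zero_le_power2 flip: e)
  then have "\<bar>a\<bar> \<le> 1" "\<bar>b\<bar> \<le> 1" by (simp_all add: abs_square_le_1)
  then have "a \<in> {-1,0,1}" "b \<in> {-1,0,1}" by auto
  then show ?thesis using e ab by (auto simp: gunit_def complex_eq_iff)
qed

lemma gint_norm_lt_1: "z \<in> gint \<Longrightarrow> (cmod z)\<^sup>2 < 1 \<Longrightarrow> z = 0"
  using gint_norm_square[of z] by auto

section \<open>Hermitian forms with Gaussian integer Gram matrix\<close>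

definition smul :: "complex \<Rightarrow> ('b \<Rightarrow> complex) \<Rightarrow> 'b \<Rightarrow> complex" where
  "smul c x = (\<lambda>u. c * x u)"

definition unit_fun :: "'b \<Rightarrow> 'b \<Rightarrow> complex" where
  "unit_fun u = (\<lambda>v. if v = u then 1 else 0)"

lemma sum_fun_apply: "(\<Sum>i\<in>A. f i) u = (\<Sum>i\<in>A. f i u)" for f :: "'i \<Rightarrow> 'b \<Rightarrow> complex"
  by (induction A rule: infinite_finite_induct) auto

text \<open>Vectors are coefficient functions on the generators \<open>I\<close>, and values outside
  \<open>I\<close> never enter the form. Definiteness makes the generators independent, so that
  \<open>card I\<close> is the dimension.\<close>

locale gram =
  fixes I :: "'b set" and G :: "'b \<Rightarrow> 'b \<Rightarrow> complex"
  assumes fin: "finite I"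
    and diag: "u \<in> I \<Longrightarrow> G u u = 2"
    and herm: "u \<in> I \<Longrightarrow> v \<in> I \<Longrightarrow> G v u = cnj (G u v)"
    and entry: "u \<in> I \<Longrightarrow> v \<in> I \<Longrightarrow> u \<noteq> v \<Longrightarrow> G u v \<in> insert 0 gunit"
    and pd: "\<exists>u\<in>I. x u \<noteq> 0 \<Longrightarrow> 0 < Re (\<Sum>u\<in>I. \<Sum>v\<in>I. cnj (x u) * G u v * x v)"
begin

definition B :: "('b \<Rightarrow> complex) \<Rightarrow> ('b \<Rightarrow> complex) \<Rightarrow> complex" where
  "B x y = (\<Sum>u\<in>I. \<Sum>v\<in>I. cnj (x u) * G u v * y v)"

definition N :: "('b \<Rightarrow> complex) \<Rightarrow> real" where
  "N x = Re (B x x)"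

text \<open>A predicate on arbitrary functions, because the norm-1 vectors used as coordinates have
  fractional coefficients and lie outside the lattice in general.\<close>

definition lat :: "('b \<Rightarrow> complex) \<Rightarrow> bool" where
  "lat x \<longleftrightarrow> (\<forall>u\<in>I. x u \<in> gint)"

lemma B_add_left: "B (x + y) z = B x z + B y z"
  and B_add_right: "B z (x + y) = B z x + B z y"
  and B_diff_left: "B (x - y) z = B x z - B y z"
  and B_diff_right: "B z (x - y) = B z x - B z y"
  and B_smul_left: "B (smul c x) z = cnj c * B x z"
  and B_smul_right: "B z (smul c x) = c * B z x"
  by (simp_all add: B_def smul_def algebra_simps sum.distrib sum_subtractf sum_distrib_left)

lemma B_zero: "B 0 z = 0" "B z 0 = 0"
  by (simp_all add: B_def)

lemma B_sum_left: "B (sum f A) z = (\<Sum>i\<in>A. B (f i) z)"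
proof (induction A rule: infinite_finite_induct)
  case (insert x F)
  have "sum f (insert x F) = f x + sum f F" by (rule sum.insert) fact+
  then show ?case using insert by (simp only: B_add_left) simp
next
  case (infinite A)
  have "sum f A = 0" by (rule sum.infinite) fact
  then show ?case using infinite by (simp only: B_zero) simp
qed (simp_all only: sum.empty B_zero)

lemma B_sum_right: "B z (sum f A) = (\<Sum>i\<in>A. B z (f i))"
proof (induction A rule: infinite_finite_induct)
  case (insert x F)
  have "sum f (insert x F) = f x + sum f F" by (rule sum.insert) fact+
  then show ?case using insert by (simp only: B_add_right) simp
next
  case (infinite A)
  have "sum f A = 0" by (rule sum.infinite) fact
  then show ?case using infinite by (simp only: B_zero) simp
qed (simp_all only: sum.empty B_zero)

lemmas B_simps = B_add_left B_add_right B_diff_left B_diff_right B_smul_left B_smul_right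
  B_zero B_sum_left B_sum_right

lemma B_sym: "B y x = cnj (B x y)"
proof -
  have "cnj (B x y) = (\<Sum>u\<in>I. \<Sum>v\<in>I. x u * cnj (G u v) * cnj (y v))"
    by (simp add: B_def)
  also have "\<dots> = (\<Sum>u\<in>I. \<Sum>v\<in>I. x u * G v u * cnj (y v))"
    by (intro sum.cong refl) (metis herm)
  also have "\<dots> = (\<Sum>v\<in>I. \<Sum>u\<in>I. x u * G v u * cnj (y v))" by (rule sum.swap)
  also have "\<dots> = B y x" by (simp add: B_def mult_ac)
  finally show ?thesis by simp
qed

lemma B_self: "B x x = of_real (N x)"
  using B_sym[of x x] by (simp add: N_def complex_eq_iff)

lemma N_nonneg: "0 \<le> N x"
proof (cases "\<exists>u\<in>I. x u \<noteq> 0")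
  case True
  then show ?thesis using pd[of x] by (simp add: N_def B_def)
next
  case False
  then show ?thesis by (simp add: N_def B_def)
qed

lemma N_zero: "N x = 0 \<Longrightarrow> u \<in> I \<Longrightarrow> x u = 0"
  using pd[of x] by (auto simp: N_def B_def)

lemma N_zero_B: assumes "N x = 0" shows "B x y = 0" "B y x = 0"
proof -
  show "B x y = 0" using N_zero[OF assms] by (simp add: B_def)
  then show "B y x = 0" using B_sym[of y x] by simp
qed

lemma B_unit_fun: "u \<in> I \<Longrightarrow> v \<in> I \<Longrightarrow> B (unit_fun u) (unit_fun v) = G u v"
proof -
  assume uv: "u \<in> I" "v \<in> I"
  have "B (unit_fun u) (unit_fun v) = (\<Sum>a\<in>I. if a = u then (\<Sum>b\<in>I. if b = v then G a b else 0) else 0)"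
    unfolding B_def unit_fun_def by (intro sum.cong refl) (auto intro!: sum.cong)
  then show ?thesis using uv fin by simp
qed

lemma N_unit_fun: "u \<in> I \<Longrightarrow> N (unit_fun u) = 2"
  by (simp add: N_def B_unit_fun diag)

lemma N_smul: "N (smul c x) = (cmod c)\<^sup>2 * N x"
proof -
  have "B (smul c x) (smul c x) = of_real ((cmod c)\<^sup>2 * N x)"
    by (simp only: B_simps B_self[of x] of_real_mult complex_norm_square) (simp add: mult_ac)
  then show ?thesis by (simp add: N_def)
qed

lemma N_diff: "N (x - y) = N x + N y - 2 * Re (B x y)"
  and N_add: "N (x + y) = N x + N y + 2 * Re (B x y)"
  by (simp_all add: N_def B_simps B_sym[of y x])

lemma lat_add: "lat x \<Longrightarrow> lat y \<Longrightarrow> lat (x + y)"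
  and lat_diff: "lat x \<Longrightarrow> lat y \<Longrightarrow> lat (x - y)"
  and lat_smul: "c \<in> gint \<Longrightarrow> lat x \<Longrightarrow> lat (smul c x)"
  by (auto simp: lat_def smul_def)

lemma lat_sum: "(\<And>i. i \<in> A \<Longrightarrow> lat (f i)) \<Longrightarrow> lat (sum f A)"
  by (induction A rule: infinite_finite_induct) (auto simp: lat_def)

lemma lat_unit_fun [simp, intro]: "lat (unit_fun u)"
  by (auto simp: lat_def unit_fun_def)

lemma G_gint: "u \<in> I \<Longrightarrow> v \<in> I \<Longrightarrow> G u v \<in> gint"
  using entry[of u v] diag[of u] by (cases "u = v") auto

lemma B_gint: "lat x \<Longrightarrow> lat y \<Longrightarrow> B x y \<in> gint"
  unfolding B_def lat_def by (intro gint_sum gint_mult gint_cnj G_gint) auto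

lemma cauchy_schwarz: "(cmod (B x y))\<^sup>2 \<le> N x * N y"
proof (cases "N y = 0")
  case True
  then show ?thesis by (simp add: N_zero_B)
next
  case False
  then have pos: "N y > 0" using N_nonneg[of y] by simp
  define z where "z = smul (of_real (N y)) x - smul (B y x) y"
  have "B z z = of_real (N y * (N x * N y - (cmod (B x y))\<^sup>2))"
    unfolding z_def by (simp only: B_simps B_self[of x] B_self[of y] B_sym[of y x] of_real_mult of_real_diff complex_norm_square complex_cnj_complex_of_real complex_cnj_cnj) (simp add: algebra_simps)
  then have "N z = N y * (N x * N y - (cmod (B x y))\<^sup>2)" by (simp add: N_def)
  with N_nonneg[of z] pos show ?thesis by (simp add: zero_le_mult_iff)
qed

section \<open>Orthonormal families, residuals and spans\<close>

definition onb :: "(nat \<Rightarrow> 'b \<Rightarrow> complex) \<Rightarrow> nat \<Rightarrow> bool" where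
  "onb e r \<longleftrightarrow> (\<forall>i<r. \<forall>j<r. B (e i) (e j) = (if i = j then 1 else 0))"

definition res :: "(nat \<Rightarrow> 'b \<Rightarrow> complex) \<Rightarrow> nat \<Rightarrow> ('b \<Rightarrow> complex) \<Rightarrow> 'b \<Rightarrow> complex" where
  "res e r x = x - (\<Sum>i<r. smul (B (e i) x) (e i))"

lemma onbD: "onb e r \<Longrightarrow> i < r \<Longrightarrow> j < r \<Longrightarrow> B (e i) (e j) = (if i = j then 1 else 0)"
  by (simp add: onb_def)

lemma B_res:
  assumes "onb e r" "i < r"
  shows "B (e i) (res e r x) = 0" "B (res e r x) (e i) = 0"
proof -
  have "B (e i) (res e r x) = B (e i) x - (\<Sum>j<r. B (e j) x * (if i = j then 1 else 0))"
    using assms by (simp add: res_def B_simps onbD)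
  also have "(\<Sum>j<r. B (e j) x * (if i = j then 1 else 0)) = (\<Sum>j<r. if i = j then B (e j) x else 0)"
    by (intro sum.cong) auto
  finally show "B (e i) (res e r x) = 0" using assms(2) by simp
  then show "B (res e r x) (e i) = 0" using B_sym[of "res e r x" "e i"] by simp
qed

lemma B_expand:
  assumes "onb e r"
  shows "B x y = (\<Sum>i<r. cnj (B (e i) x) * B (e i) y) + B (res e r x) (res e r y)"
proof -
  have x: "x = (\<Sum>i<r. smul (B (e i) x) (e i)) + res e r x" by (simp add: res_def)
  have "B x y = (\<Sum>i<r. cnj (B (e i) x) * B (e i) y) + B (res e r x) y"
    by (subst x) (simp add: B_simps)
  also have "B (res e r x) y = B (res e r x) ((\<Sum>i<r. smul (B (e i) y) (e i)) + res e r y)"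
    by (simp add: res_def)
  also have "\<dots> = B (res e r x) (res e r y)"
    unfolding B_add_right B_sum_right B_smul_right using B_res[OF assms] by simp
  finally show ?thesis .
qed

lemma N_expand:
  assumes "onb e r"
  shows "N x = (\<Sum>i<r. (cmod (B (e i) x))\<^sup>2) + N (res e r x)"
proof -
  have "B x x = of_real ((\<Sum>i<r. (cmod (B (e i) x))\<^sup>2) + N (res e r x))"
    by (subst B_expand[OF assms]) (simp only: B_self of_real_add of_real_sum complex_norm_square mult.commute)
  then show ?thesis by (simp add: N_def)
qed

definition inspan :: "(nat \<Rightarrow> 'b \<Rightarrow> complex) \<Rightarrow> nat \<Rightarrow> ('b \<Rightarrow> complex) \<Rightarrow> bool" where
  "inspan e r x \<longleftrightarrow> N (res e r x) = 0"

lemma inspan_N: "onb e r \<Longrightarrow> inspan e r x \<longleftrightarrow> N x = (\<Sum>i<r. (cmod (B (e i) x))\<^sup>2)"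
  using N_expand[of e r x] by (auto simp: inspan_def)

lemma bessel: "onb e r \<Longrightarrow> (\<Sum>i<r. (cmod (B (e i) x))\<^sup>2) \<le> N x"
  using N_expand[of e r x] N_nonneg[of "res e r x"] by simp

lemma inspanI:
  assumes on: "onb e r" and x: "\<And>u. u \<in> I \<Longrightarrow> x u = (\<Sum>i<r. c i * e i u)"
  shows "inspan e r x"
proof -
  have Bx: "B z x = (\<Sum>i<r. c i * B z (e i))" for z
  proof -
    have "B z x = B z (\<Sum>i<r. smul (c i) (e i))"
      unfolding B_def using x by (intro sum.cong refl) (simp add: sum_fun_apply smul_def)
    then show ?thesis by (simp add: B_simps)
  qed
  have "B (e j) x = c j" if "j < r" for j
  proof -
    have "B (e j) x = (\<Sum>i<r. if j = i then c i else 0)"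
      unfolding Bx using onbD[OF on that] by (intro sum.cong) auto
    then show ?thesis using that by simp
  qed
  then have "res e r x u = 0" if "u \<in> I" for u
    using x[OF that] by (simp add: res_def sum_fun_apply smul_def)
  then show ?thesis by (simp add: inspan_def N_def B_def)
qed

text \<open>The trace of the projection onto the span of the \<open>e i\<close>, computed twice:
  each generator contributes 1 because it is fixed, and each \<open>e i\<close> contributes
  \<open>B (e i) (e i) = 1\<close>.\<close>

lemma inspan_dim:
  assumes on: "onb e r" and sp: "\<And>u. u \<in> I \<Longrightarrow> inspan e r (unit_fun u)"
  shows "card I = r"
proof -
  have 1: "(\<Sum>i<r. B (e i) (unit_fun u) * e i u) = 1" if "u \<in> I" for u
  proof -
    have "res e r (unit_fun u) u = 0" using N_zero sp[OF that] that by (auto simp: inspan_def)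
    then show ?thesis by (simp add: res_def sum_fun_apply smul_def unit_fun_def)
  qed
  have 2: "(\<Sum>u\<in>I. B x (unit_fun u) * x u) = B x x" for x
  proof -
    have "B x (unit_fun u) = (\<Sum>a\<in>I. cnj (x a) * G a u)" if "u \<in> I" for u
    proof -
      have "(\<Sum>b\<in>I. cnj (x a) * G a b * unit_fun u b) = (\<Sum>b\<in>I. if b = u then cnj (x a) * G a b else 0)" for a
        by (intro sum.cong) (auto simp: unit_fun_def)
      then show ?thesis using that fin by (simp add: B_def)
    qed
    then have "(\<Sum>u\<in>I. B x (unit_fun u) * x u) = (\<Sum>u\<in>I. \<Sum>a\<in>I. cnj (x a) * G a u * x u)"
      by (simp add: sum_distrib_right)
    also have "\<dots> = B x x" unfolding B_def by (rule sum.swap)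
    finally show ?thesis .
  qed
  have "of_nat (card I) = (\<Sum>u\<in>I. \<Sum>i<r. B (e i) (unit_fun u) * e i u)" using 1 by simp
  also have "\<dots> = (\<Sum>i<r. \<Sum>u\<in>I. B (e i) (unit_fun u) * e i u)" by (rule sum.swap)
  also have "\<dots> = of_nat r" using on by (simp add: 2 onbD)
  finally show ?thesis using of_nat_eq_iff by blast
qed

text \<open>Vectors of norm 1, not necessarily in the lattice, spanning a copy of the root lattice of type \<open>D\<close>
  inside it. A maximal one plays the role of the standard coordinates.\<close>

definition frame :: "(nat \<Rightarrow> 'b \<Rightarrow> complex) \<Rightarrow> nat \<Rightarrow> bool" where
  "frame e r \<longleftrightarrow> onb e r \<and> (\<forall>i<r. \<forall>j<r. lat (e i + e j))"

lemma frame_onb: "frame e r \<Longrightarrow> onb e r"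
  by (simp add: frame_def)

lemma frame_add: "frame e r \<Longrightarrow> i < r \<Longrightarrow> j < r \<Longrightarrow> lat (e i + e j)"
  by (simp add: frame_def)

lemma frame_twice: "frame e r \<Longrightarrow> i < r \<Longrightarrow> lat (smul 2 (e i))"
  using frame_add[of e r i i] by (simp add: lat_def smul_def)

lemma frame_diff: "frame e r \<Longrightarrow> i < r \<Longrightarrow> j < r \<Longrightarrow> lat (e i - e j)"
  using lat_diff[OF frame_add[of e r i j] frame_twice[of e r j]] by (simp add: lat_def smul_def)

text \<open>One link \<open>e i + f\<close> suffices: \<open>e j + f\<close> differs from it by the
  lattice vector \<open>e j - e i\<close>, and \<open>f + f\<close> is twice the link minus
  \<open>2 e i\<close>.\<close>

lemma frame_extend:
  assumes fr: "frame e r" and f: "N f = 1" "\<And>i. i < r \<Longrightarrow> B (e i) f = 0" and i: "i < r" "lat (e i + f)"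
  shows "frame (e(r := f)) (Suc r)"
proof -
  have "B f (e i) = 0" if "i < r" for i
    using B_sym[of f "e i"] f(2)[OF that] by simp
  then have "onb (e(r := f)) (Suc r)"
    using frame_onb[OF fr] f B_self[of f]
    by (auto simp: onb_def less_Suc_eq)
  moreover have ej: "lat (e j + f)" if "j < r" for j
    using lat_add[OF i(2) frame_diff[OF fr that i(1)]] by (simp add: lat_def algebra_simps)
  moreover have "lat (f + e j)" if "j < r" for j
    using ej[OF that] by (simp add: lat_def add.commute)
  moreover have "lat (f + f)"
    using lat_diff[OF lat_smul[of 2, OF _ i(2)] frame_twice[OF fr i(1)]] by (simp add: lat_def smul_def algebra_simps)
  ultimately show ?thesis
    using frame_add[OF fr] by (auto simp: frame_def less_Suc_eq)
qed

text \<open>Modulo the lattice all frame vectors agree, and twice a frame vector vanishes. Hence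
  only the parity of the number of summands matters, which the next two lemmas exploit.\<close>

lemma frame_sum_mod:
  assumes fr: "frame e r" "0 < r" and A: "A \<subseteq> {..<r}"
  shows "lat (sum e A - smul (of_nat (card A)) (e 0))"
proof -
  have "lat (\<Sum>i\<in>A. e i - e 0)"
    by (rule lat_sum) (use A fr frame_diff in auto)
  then show ?thesis by (simp add: lat_def sum_fun_apply sum_subtractf smul_def)
qed

lemma frame_sum_even:
  assumes fr: "frame e r" "0 < r" and A: "A \<subseteq> {..<r}" "even (card A)"
  shows "lat (sum e A)"
proof -
  obtain l where l: "card A = 2 * l" using A(2) by blast
  have "lat (smul (of_nat l) (smul 2 (e 0)))"
    by (rule lat_smul[OF gint_simps(5) frame_twice[OF fr]])
  with lat_add[OF frame_sum_mod[OF fr A(1)] this] show ?thesis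
    by (simp add: lat_def smul_def l mult_ac)
qed

lemma frame_sum_odd:
  assumes fr: "frame e r" "0 < r" and A: "A \<subseteq> {..<r}" "odd (card A)" and f: "lat (sum e A + f)"
  shows "lat (e 0 + f)"
proof -
  obtain l where l: "card A = 2 * l + 1" using A(2) by (blast elim: oddE)
  have 1: "lat (smul (of_nat l) (smul 2 (e 0)))"
    by (rule lat_smul[OF gint_simps(5) frame_twice[OF fr]])
  from lat_diff[OF lat_diff[OF f frame_sum_mod[OF fr A(1)]] 1] show ?thesis
    by (simp add: lat_def smul_def l algebra_simps)
qed

lemma B_unit_expand: "(\<Sum>u\<in>I. B x (unit_fun u) * y u) = B x y"
proof -
  have "B x (unit_fun u) = (\<Sum>a\<in>I. cnj (x a) * G a u)" if "u \<in> I" for u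
  proof -
    have "(\<Sum>b\<in>I. cnj (x a) * G a b * unit_fun u b) = (\<Sum>b\<in>I. if b = u then cnj (x a) * G a b else 0)" for a
      by (intro sum.cong) (auto simp: unit_fun_def)
    then show ?thesis using that fin by (simp add: B_def)
  qed
  then have "(\<Sum>u\<in>I. B x (unit_fun u) * y u) = (\<Sum>u\<in>I. \<Sum>a\<in>I. cnj (x a) * G a u * y u)"
    by (simp add: sum_distrib_right)
  also have "\<dots> = B x y" unfolding B_def by (rule sum.swap)
  finally show ?thesis .
qed

lemma frame_hits:
  assumes fr: "frame e r" "i < r"
  shows "\<exists>u\<in>I. B (e i) (unit_fun u) \<noteq> 0"
proof (rule ccontr)
  assume "\<not> ?thesis"
  then have "B (e i) (e i) = 0" using B_unit_expand[of "e i" "e i"] by simp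
  then show False using onbD[OF frame_onb[OF fr(1)] fr(2) fr(2)] by simp
qed

lemma frame_twice_coeff:
  assumes fr: "frame e r" "i < r" and x: "lat x"
  shows "2 * B (e i) x \<in> gint"
  using B_gint[OF frame_twice[OF fr] x] by (simp add: B_simps)

lemma frame_coeff_diff:
  assumes fr: "frame e r" "i < r" "j < r" and x: "lat x"
  shows "B (e i) x - B (e j) x \<in> gint"
  using B_gint[OF frame_diff[OF fr] x] by (simp add: B_simps)

text \<open>Any bound would do: it ensures that a longest frame exists. Twice a coordinate is a
  Gaussian integer, so each frame vector takes at least 1/4 of the total norm
  \<open>2 * card I\<close> of the generators.\<close>

lemma frame_bound:
  assumes fr: "frame e r"
  shows "r \<le> 8 * card I"
proof -
  have 1: "1 \<le> (\<Sum>u\<in>I. 4 * (cmod (B (e i) (unit_fun u)))\<^sup>2)" if i: "i < r" for i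
  proof -
    obtain u where u: "u \<in> I" "B (e i) (unit_fun u) \<noteq> 0" using frame_hits[OF fr i] by blast
    have "2 * B (e i) (unit_fun u) \<in> gint" by (rule frame_twice_coeff[OF fr i]) simp
    from gint_norm_square[OF this] obtain k :: nat where "(cmod (2 * B (e i) (unit_fun u)))\<^sup>2 = k" by blast
    then have k: "4 * (cmod (B (e i) (unit_fun u)))\<^sup>2 = k" by (simp add: norm_mult power_mult_distrib)
    with u(2) have "1 \<le> 4 * (cmod (B (e i) (unit_fun u)))\<^sup>2" by (cases k) auto
    also have "\<dots> \<le> (\<Sum>u\<in>I. 4 * (cmod (B (e i) (unit_fun u)))\<^sup>2)"
      using u(1) fin by (intro member_le_sum) auto
    finally show ?thesis .
  qed
  have "real r = (\<Sum>i<r. 1)" by simp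
  also have "\<dots> \<le> (\<Sum>i<r. \<Sum>u\<in>I. 4 * (cmod (B (e i) (unit_fun u)))\<^sup>2)"
    using 1 by (intro sum_mono) auto
  also have "\<dots> = (\<Sum>u\<in>I. 4 * (\<Sum>i<r. (cmod (B (e i) (unit_fun u)))\<^sup>2))"
    by (subst sum.swap) (simp add: sum_distrib_left)
  also have "\<dots> \<le> (\<Sum>u\<in>I. 4 * 2)"
    using order_trans[OF bessel[OF frame_onb[OF fr]] eq_refl[OF N_unit_fun]] by (intro sum_mono mult_left_mono) auto
  also have "\<dots> = real (8 * card I)" by simp
  finally show ?thesis by linarith
qed

text \<open>The coordinates of \<open>w\<close> are all half-integral and congruent modulo 1, and \<open>1/2\<close> and \<open>(1 + \<i>)/2\<close> are the
  only two non-trivial cosets up to units; the second bound excludes the latter, the first one excludes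
  larger representatives of the former.\<close>

lemma half_coset:
  assumes fr: "frame e r" and w: "lat w" and i0: "i0 < r" "B (e i0) w \<notin> gint"
    and S: "4 * (\<Sum>i<r. (cmod (B (e i) w))\<^sup>2) < real r + 4" "4 * (\<Sum>i<r. (cmod (B (e i) w))\<^sup>2) < 2 * real r"
  obtains \<epsilon> where "\<epsilon> \<in> gunit" "\<And>i. i < r \<Longrightarrow> B (e i) (smul \<epsilon> w) = 1/2 \<or> B (e i) (smul \<epsilon> w) = -1/2"
proof -
  define a where "a i = \<lfloor>2 * Re (B (e i) w)\<rfloor>" for i
  define b where "b i = \<lfloor>2 * Im (B (e i) w)\<rfloor>" for i
  have re: "Re (B (e i) w) = a i / 2" and im: "Im (B (e i) w) = b i / 2" if "i < r" for i
    using frame_twice_coeff[OF fr that w] by (auto simp: gint_def a_def b_def elim!: Ints_cases)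
  have par: "even (a i - a j)" "even (b i - b j)" if ij: "i < r" "j < r" for i j
  proof -
    obtain k l where "(a i - a j) / 2 = real_of_int k" "(b i - b j) / 2 = real_of_int l"
      using frame_coeff_diff[OF fr ij w] re[OF ij(1)] re[OF ij(2)] im[OF ij(1)] im[OF ij(2)]
      by (auto simp: gint_def diff_divide_distrib elim!: Ints_cases)
    then have "real_of_int (a i - a j) = real_of_int (2 * k)" "real_of_int (b i - b j) = real_of_int (2 * l)"
      by simp_all
    then have "a i - a j = 2 * k" "b i - b j = 2 * l" by (simp_all only: of_int_eq_iff)
    then show "even (a i - a j)" "even (b i - b j)" by auto
  qed
  define n where "n i = (a i)\<^sup>2 + (b i)\<^sup>2" for i
  have "4 * (\<Sum>i<r. (cmod (B (e i) w))\<^sup>2) = (\<Sum>i<r. real_of_int (n i))"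
    unfolding sum_distrib_left by (intro sum.cong) (auto simp: cmod_power2 re im n_def power_divide)
  then have "4 * (\<Sum>i<r. (cmod (B (e i) w))\<^sup>2) = real_of_int (\<Sum>i<r. n i)" by simp
  then have n: "(\<Sum>i<r. n i) < int r + 4" "(\<Sum>i<r. n i) < 2 * int r"
    using S by linarith+
  have odd: "odd (a i0) \<or> odd (b i0)"
  proof (rule ccontr)
    assume "\<not> ?thesis"
    then obtain k l where "a i0 = 2 * k" "b i0 = 2 * l" by (auto elim!: evenE)
    then have "B (e i0) w \<in> gint" using re[OF i0(1)] im[OF i0(1)] by (auto simp: gint_def)
    then show False using i0 by simp
  qed
  have notboth: "\<not> (odd (a i0) \<and> odd (b i0))"
  proof
    assume o: "odd (a i0) \<and> odd (b i0)"
    have "2 \<le> n i" if "i < r" for i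
    proof -
      have "odd (a i)" "odd (b i)" using par[OF that i0(1)] o by auto
      then have "a i \<noteq> 0" "b i \<noteq> 0" by auto
      then have "0 < (a i)\<^sup>2" "0 < (b i)\<^sup>2" by auto
      then show ?thesis unfolding n_def by linarith
    qed
    then have "(\<Sum>i<r. 2) \<le> (\<Sum>i<r. n i)" by (intro sum_mono) auto
    then show False using n by simp
  qed
  have key: "n i = 1" if i: "i < r" for i
  proof (rule ccontr)
    assume ni: "n i \<noteq> 1"
    have ge1: "1 \<le> n j" if "j < r" for j
    proof -
      have "odd (a j) \<or> odd (b j)" using par[OF that i0(1)] odd by auto
      then have "a j \<noteq> 0 \<or> b j \<noteq> 0" by auto
      then have "0 < n j" unfolding n_def by (simp add: sum_power2_gt_zero_iff)
      then show ?thesis by linarith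
    qed
    have four: "4 \<le> x\<^sup>2" if "even x" "x \<noteq> 0" for x :: int
    proof -
      have "2 \<le> \<bar>x\<bar>" using that by presburger
      then have "2\<^sup>2 \<le> \<bar>x\<bar>\<^sup>2" by (rule power_mono) simp
      then show ?thesis by simp
    qed
    have nine: "x\<^sup>2 = 1 \<or> 9 \<le> x\<^sup>2" if "odd x" for x :: int
    proof -
      have "\<bar>x\<bar> = 1 \<or> 3 \<le> \<bar>x\<bar>" using that by presburger
      then show ?thesis
      proof
        assume "\<bar>x\<bar> = 1"
        then have "\<bar>x\<bar>\<^sup>2 = 1" by (simp only: one_power2)
        then show ?thesis by simp
      next
        assume "3 \<le> \<bar>x\<bar>"
        then have "3\<^sup>2 \<le> \<bar>x\<bar>\<^sup>2" by (rule power_mono) simp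
        then show ?thesis by simp
      qed
    qed
    \<comment> \<open>An odd square plus an even square is 1 or at least 5. One summand 5 and
      \<open>r - 1\<close> further summands of at least 1 already reach the excluded value
      \<open>r + 4\<close>.\<close>
    have "5 \<le> n i"
    proof -
      consider "odd (a i)" "even (b i)" | "even (a i)" "odd (b i)"
        using par[OF i i0(1)] odd notboth by auto
      then show ?thesis
      proof cases
        case 1
        then show ?thesis using nine[OF 1(1)] four[OF 1(2)] ni zero_le_power2[of "b i"]
          unfolding n_def by (cases "b i = 0") (simp, linarith)
      next
        case 2
        then show ?thesis using nine[OF 2(2)] four[OF 2(1)] ni zero_le_power2[of "a i"]
          unfolding n_def by (cases "a i = 0") (simp, linarith)
      qed
    qed
    moreover have "(\<Sum>j\<in>{..<r} - {i}. 1) \<le> (\<Sum>j\<in>{..<r} - {i}. n j)"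
      using ge1 by (intro sum_mono) auto
    moreover have "(\<Sum>j<r. n j) = n i + (\<Sum>j\<in>{..<r} - {i}. n j)"
      using i by (intro sum.remove) auto
    moreover have "(\<Sum>j\<in>{..<r} - {i}. 1::int) = int r - 1" using i by simp
    ultimately show False using n by linarith
  qed
  have ab: "(a i = 1 \<or> a i = -1) \<and> b i = 0 \<or> a i = 0 \<and> (b i = 1 \<or> b i = -1)" if "i < r" for i
  proof -
    have *: "(a i)\<^sup>2 + (b i)\<^sup>2 = 1" using key[OF that] by (simp add: n_def)
    have "(a i)\<^sup>2 \<le> 1" "(b i)\<^sup>2 \<le> 1"
      using * zero_le_power2[of "a i"] zero_le_power2[of "b i"] by linarith+
    then have "\<bar>a i\<bar> \<le> 1" "\<bar>b i\<bar> \<le> 1" by (simp_all only: abs_square_le_1)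
    then have "a i = -1 \<or> a i = 0 \<or> a i = 1" "b i = -1 \<or> b i = 0 \<or> b i = 1" by arith+
    then show ?thesis using * by auto
  qed
  show thesis
  proof (cases "odd (a i0)")
    case True
    have "B (e i) (smul 1 w) = 1/2 \<or> B (e i) (smul 1 w) = -1/2" if "i < r" for i
    proof -
      have "odd (a i)" using par(1)[OF that i0(1)] True by simp
      then have "(a i = 1 \<or> a i = -1) \<and> b i = 0" using ab[OF that] by auto
      then show ?thesis using re[OF that] im[OF that]
        by (auto simp: B_smul_right complex_eq_iff)
    qed
    then show thesis by (rule that[rotated]) (simp_all add: gunit_def)
  next
    case False
    have "B (e i) (smul \<i> w) = 1/2 \<or> B (e i) (smul \<i> w) = -1/2" if "i < r" for i
    proof -
      have "even (a i)" using par(1)[OF that i0(1)] False by simp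
      then have "a i = 0 \<and> (b i = 1 \<or> b i = -1)" using ab[OF that] by auto
      then show ?thesis using re[OF that] im[OF that]
        by (auto simp: B_smul_right complex_eq_iff)
    qed
    then show thesis by (rule that[rotated]) (simp_all add: gunit_def)
  qed
qed

text \<open>Signs are free because \<open>2 e j\<close> lies in the lattice: sums with unequal signs
  differ from sums with equal signs by such vectors.\<close>

lemma frame_flip:
  assumes fr: "frame e r" and s: "\<And>i. i < r \<Longrightarrow> s i = 1 \<or> s i = -1"
  shows "frame (\<lambda>i. smul (s i) (e i)) r"
proof -
  have "onb (\<lambda>i. smul (s i) (e i)) r"
    unfolding onb_def
  proof (intro allI impI)
    fix i j assume ij: "i < r" "j < r"
    show "B (smul (s i) (e i)) (smul (s j) (e j)) = (if i = j then 1 else 0)"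
      using s[OF ij(1)] onbD[OF frame_onb[OF fr] ij] by (auto simp: B_smul_left B_smul_right)
  qed
  moreover have "lat (smul (s i) (e i) + smul (s j) (e j))" if ij: "i < r" "j < r" for i j
  proof -
    have 1: "lat (smul (s i) (e i + e j))" using s[OF ij(1)] frame_add[OF fr ij] by (intro lat_smul) auto
    have "(s j - s i) / 2 \<in> gint" using s[OF ij(1)] s[OF ij(2)] by (elim disjE) simp_all
    then have 2: "lat (smul ((s j - s i) / 2) (smul 2 (e j)))"
      by (rule lat_smul[OF _ frame_twice[OF fr ij(2)]])
    have "smul (s i) (e i) + smul (s j) (e j) = smul (s i) (e i + e j) + smul ((s j - s i) / 2) (smul 2 (e j))"
      by (simp add: fun_eq_iff smul_def field_simps)
    with lat_add[OF 1 2] show ?thesis by simp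
  qed
  ultimately show ?thesis by (simp add: frame_def)
qed

lemma frame_normalise:
  assumes fr: "frame e r" and w: "\<And>i. i < r \<Longrightarrow> B (e i) w = 1/2 \<or> B (e i) w = -1/2"
  obtains e' where "frame e' r" "\<And>i. i < r \<Longrightarrow> B (e' i) w = 1/2"
proof -
  define s where "s i = 2 * B (e i) w" for i
  have s: "s i = 1 \<or> s i = -1" if "i < r" for i using w[OF that] by (elim disjE) (simp_all only: s_def, simp_all)
  show thesis
  proof (rule that[OF frame_flip[OF fr s]])
    fix i assume "i < r"
    from w[OF this] show "B (smul (s i) (e i)) w = 1/2" by (elim disjE) (simp_all only: s_def B_smul_left, simp_all)
  qed
qed

text \<open>If \<open>w\<close> is neither orthogonal to the frame nor in its span, its integral
  coordinates have square sum 1, so exactly one is non-zero and it is a unit. The rest of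
  \<open>w\<close> has norm 1 as well and, up to a unit, would extend the frame.\<close>

lemma integral_coset:
  assumes fr: "frame e r" and mx: "\<And>e'. \<not> frame e' (Suc r)" and w: "lat w" "N w = 2"
    and c: "\<And>i. i < r \<Longrightarrow> B (e i) w \<in> gint"
  shows "(\<forall>i<r. B (e i) w = 0) \<or> inspan e r w"
proof (rule ccontr)
  assume neg: "\<not> ?thesis"
  then obtain j where j: "j < r" "B (e j) w \<noteq> 0" by blast
  define c where "c i = B (e i) w" for i
  have on: "onb e r" by (rule frame_onb[OF fr])
  have sq: "(\<Sum>i<r. (cmod (c i))\<^sup>2) = (cmod (c j))\<^sup>2 + (\<Sum>i\<in>{..<r} - {j}. (cmod (c i))\<^sup>2)"
    using j by (intro sum.remove) auto
  have lt: "(\<Sum>i<r. (cmod (c i))\<^sup>2) < 2"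
    using bessel[OF on, of w] neg inspan_N[OF on, of w] w(2) by (simp add: c_def)
  have ci: "\<And>i. i < r \<Longrightarrow> c i \<in> gint" using assms(5) by (simp add: c_def)
  obtain k :: nat where k: "(cmod (c j))\<^sup>2 = k" using gint_norm_square[OF ci[OF j(1)]] by blast
  have "0 < k" using k j(2) by (cases k) (auto simp: c_def)
  then have k1: "1 \<le> (cmod (c j))\<^sup>2" using k by simp
  have others: "c i = 0" if "i < r" "i \<noteq> j" for i
  proof (rule gint_norm_lt_1[OF ci[OF that(1)]])
    have "(cmod (c i))\<^sup>2 \<le> (\<Sum>i\<in>{..<r} - {j}. (cmod (c i))\<^sup>2)"
      using that by (intro member_le_sum) auto
    then show "(cmod (c i))\<^sup>2 < 1" using sq lt k1 by linarith
  qed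
  have rest: "(\<Sum>i\<in>{..<r} - {j}. (cmod (c i))\<^sup>2) = 0" using others by (intro sum.neutral) auto
  have "(cmod (c j))\<^sup>2 < 2" using lt sq rest by linarith
  then have "k = 1" using k k1 by linarith
  then have one: "(cmod (c j))\<^sup>2 = 1" using k by simp
  have cu: "c j \<in> gunit" by (rule gint_norm_1[OF ci[OF j(1)] one])
  define f where "f = smul (cnj (c j)) (res e r w)"
  have rs: "res e r w = w - smul (c j) (e j)"
  proof -
    have "(\<Sum>i<r. c i * e i u) = c j * e j u" for u
    proof -
      have "(\<Sum>i<r. c i * e i u) = (\<Sum>i<r. if i = j then c j * e j u else 0)"
        using others by (intro sum.cong) auto
      then show ?thesis using j(1) by simp
    qed
    then show ?thesis by (auto simp: res_def fun_eq_iff sum_fun_apply smul_def simp flip: c_def)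
  qed
  have "N (res e r w) = 1" using N_expand[OF on, of w] w(2) sq rest one by (simp flip: c_def)
  then have "N f = 1" using gunit_norm[OF cu] by (simp add: f_def N_smul)
  moreover have "B (e i) f = 0" if "i < r" for i by (simp add: f_def B_simps B_res[OF on that])
  moreover have "e j + f = smul (cnj (c j)) w"
  proof
    fix u
    have "cnj (c j) * (c j * e j u) = e j u" using gunit_mult_cnj[OF cu] by (simp flip: mult.assoc)
    then show "(e j + f) u = smul (cnj (c j)) w u" by (simp add: f_def rs smul_def algebra_simps)
  qed
  then have "lat (e j + f)" using lat_smul[OF gunit_gint[OF gunit_cnj[OF cu]] w(1)] by simp
  ultimately have "frame (e(r := f)) (Suc r)" using frame_extend[OF fr] j(1) by blast
  then show False using mx by blast
qed

section \<open>Half-integral coordinates with respect to frames of length five to eight\<close>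

lemma inspan_smul:
  assumes on: "onb e r" and c: "c \<in> gunit"
  shows "inspan e r (smul c x) \<longleftrightarrow> inspan e r x"
  using gunit_norm[OF c] by (simp add: inspan_N[OF on] N_smul B_smul_right norm_mult)

lemma onb_extend:
  assumes on: "onb e r" and g: "\<And>i. i < r \<Longrightarrow> B (e i) g = 0" "N g > 0"
  shows "onb (e(r := smul (of_real (1 / sqrt (N g))) g)) (Suc r)"
proof -
  have g': "B g (e i) = 0" if "i < r" for i
    using B_sym[of g "e i"] g(1)[OF that] by simp
  have "of_real (1 / sqrt (N g)) * (of_real (1 / sqrt (N g)) * B g g) = (1 :: complex)"
    unfolding B_self using g(2) by (simp flip: of_real_mult)
  then show ?thesis
    using on g(1) g' by (simp add: onb_def less_Suc_eq B_smul_left B_smul_right)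
qed

text \<open>Tests membership in the span of the frame and one further direction \<open>g\<close>
  without square roots; the applications have \<open>N g\<close> equal to 3/4 or 1/2.\<close>

lemma inspan_extend:
  assumes on: "onb e r" and g: "\<And>i. i < r \<Longrightarrow> B (e i) g = 0" "N g > 0"
  shows "inspan (e(r := smul (of_real (1 / sqrt (N g))) g)) (Suc r) x \<longleftrightarrow>
    N x = (\<Sum>i<r. (cmod (B (e i) x))\<^sup>2) + (cmod (B g x))\<^sup>2 / N g"
proof -
  define g' where "g' = smul (of_real (1 / sqrt (N g))) g"
  have "onb (e(r := g')) (Suc r)" unfolding g'_def by (rule onb_extend[OF on g])
  moreover have "(cmod (B g' x))\<^sup>2 = (cmod (B g x))\<^sup>2 / N g"
    using g(2) by (simp add: g'_def B_smul_left norm_mult norm_divide power_mult_distrib power_divide)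
  ultimately show ?thesis unfolding g'_def[symmetric] by (simp add: inspan_N)
qed

lemma half_norm: "z = 1/2 \<or> z = -1/2 \<Longrightarrow> (cmod z)\<^sup>2 = 1/4"
  by (elim disjE; hypsubst; simp add: norm_divide power_divide)

text \<open>Here \<open>w\<close> is half the sum of the frame plus its residual. The residual norm
  \<open>2 - r / 4\<close> is 3/4, 1/2, 1/4, 0 for lengths 5, 6, 7, 8. For lengths 5 and 6 the
  residual spans the additional dimension of types E6 and E7.\<close>

lemma half_res:
  assumes fr: "frame e r" and w: "N w = 2" "\<And>i. i < r \<Longrightarrow> B (e i) w = 1/2"
  shows "N (res e r w) = 2 - real r / 4" "B (res e r w) w = N (res e r w)"
    "B (res e r w) x = B (res e r w) (res e r x)"
    "B w x = (\<Sum>i<r. B (e i) x) / 2 + B (res e r w) x"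
    "2 * w u = (\<Sum>i<r. e i u) + 2 * res e r w u"
proof -
  have on: "onb e r" by (rule frame_onb[OF fr])
  have "(\<Sum>i<r. (cmod (B (e i) w))\<^sup>2) = (\<Sum>i<r. 1/4)"
    by (intro sum.cong) (simp_all add: w(2) norm_divide power_divide)
  then show "N (res e r w) = 2 - real r / 4" using N_expand[OF on, of w] w(1) by simp
  have z: "(\<Sum>i<r. cnj (B (e i) (res e r w)) * c i) = 0" for c
    using B_res[OF on] by simp
  have rr: "res e r (res e r w) = res e r w"
    using B_res[OF on] by (simp add: res_def[of e r "res e r w"] fun_eq_iff sum_fun_apply smul_def)
  show res: "B (res e r w) x = B (res e r w) (res e r x)" for x
    using B_expand[OF on, of "res e r w" x] by (simp add: z rr)
  show "B (res e r w) w = N (res e r w)" by (simp add: res[of w] B_self)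
  show "B w x = (\<Sum>i<r. B (e i) x) / 2 + B (res e r w) x"
    using B_expand[OF on, of w x] w(2) by (simp add: res[of x] sum_divide_distrib)
  have "(\<Sum>i<r. B (e i) w * e i u) = (\<Sum>i<r. e i u / 2)"
    by (intro sum.cong) (simp_all add: w(2))
  also have "\<dots> = (\<Sum>i<r. e i u) / 2" by (simp add: sum_divide_distrib)
  finally have "2 * (\<Sum>i<r. B (e i) w * e i u) = (\<Sum>i<r. e i u)" by (simp add: mult.commute)
  then show "2 * w u = (\<Sum>i<r. e i u) + 2 * res e r w u"
    by (simp add: res_def sum_fun_apply smul_def)
qed

text \<open>With square sum at most 2 the bounds of \<open>half_coset\<close> become 8 < r + 4 and 8
  < 2 r, which is where \<open>5 \<le> r\<close> comes from.\<close>

lemma half_coset_N2: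
  assumes fr: "frame e r" "5 \<le> r" and w: "lat w" "N w = 2" and i0: "i0 < r" "B (e i0) w \<notin> gint"
  obtains \<epsilon> where "\<epsilon> \<in> gunit" "\<And>i. i < r \<Longrightarrow> B (e i) (smul \<epsilon> w) = 1/2 \<or> B (e i) (smul \<epsilon> w) = -1/2"
proof -
  have b: "(\<Sum>i<r. (cmod (B (e i) w))\<^sup>2) \<le> 2" using bessel[OF frame_onb[OF fr(1)], of w] w(2) by simp
  show thesis
    by (rule half_coset[OF fr(1) w(1) i0]) (use b fr(2) that in auto)
qed

text \<open>\<open>A\<close> records the minus signs. Subtracting the frame vectors in
  \<open>A\<close> from \<open>w - x\<close> cancels all frame coordinates; if \<open>card A\<close>
  is even and \<open>w\<close>, \<open>x\<close> are in the lattice, the outcome is a lattice vector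
  orthogonal to the frame.\<close>

lemma half_diff:
  assumes fr: "frame e r" and w: "\<And>i. i < r \<Longrightarrow> B (e i) w = 1/2"
    and x: "\<And>i. i < r \<Longrightarrow> B (e i) x = 1/2 \<or> B (e i) x = -1/2"
  defines "A \<equiv> {i. i < r \<and> B (e i) x = -1/2}"
  shows "w - x - sum e A = res e r w - res e r x" "(\<Sum>i<r. B (e i) x) = of_nat r / 2 - of_nat (card A)"
proof -
  have eq: "B (e i) x = 1/2 - (if i \<in> A then 1 else 0)" if "i < r" for i
    using x[OF that] that by (auto simp: A_def)
  have AA: "{..<r} \<inter> A = A" by (auto simp: A_def)
  show "w - x - sum e A = res e r w - res e r x"
  proof
    fix u
    have "(\<Sum>i<r. B (e i) x * e i u) = (\<Sum>i<r. B (e i) w * e i u - (if i \<in> A then e i u else 0))"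
      by (intro sum.cong) (simp_all add: eq w algebra_simps)
    also have "\<dots> = (\<Sum>i<r. B (e i) w * e i u) - (\<Sum>i\<in>A. e i u)"
      by (simp add: sum_subtractf AA flip: sum.inter_restrict)
    finally show "(w - x - sum e A) u = (res e r w - res e r x) u"
      by (simp add: res_def sum_fun_apply smul_def)
  qed
  have "(\<Sum>i<r. B (e i) x) = (\<Sum>i<r. 1/2 - (if i \<in> A then 1 else 0))"
    using eq by (intro sum.cong) auto
  also have "\<dots> = of_nat r / 2 - of_nat (card A)"
    by (simp add: sum_subtractf AA flip: sum.inter_restrict)
  finally show "(\<Sum>i<r. B (e i) x) = of_nat r / 2 - of_nat (card A)" .
qed

text \<open>With \<open>g\<close> the residual of \<open>w\<close>, the vector \<open>2 g\<close>
  has norm 3 and inner product 2 with \<open>a\<close>, so \<open>2 g - a\<close> has norm 3 + 2 - 4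
  = 1. Adding the five \<open>e i\<close> to it gives the lattice vector \<open>2 w - a\<close>;
  since five is odd, this links it to the frame.\<close>

lemma five_extend:
  assumes fr: "frame e 5" and w: "lat w" "N w = 2" "\<And>i. i < 5 \<Longrightarrow> B (e i) w = 1/2"
    and a: "lat a" "N a = 2" "\<And>i. i < 5 \<Longrightarrow> B (e i) a = 0" "B (res e 5 w) a = 1"
  shows "\<exists>e'. frame e' 6"
proof -
  define g where "g = res e 5 w"
  define f where "f = smul 2 g - a"
  note on = frame_onb[OF fr]
  have "N f = 1" using half_res(1)[OF fr w(2,3)] a(2,4)
    by (simp add: f_def g_def N_diff N_smul B_smul_left)
  moreover have "B (e i) f = 0" if "i < 5" for i
    using B_res(1)[OF on that] a(3)[OF that] by (simp add: f_def g_def B_diff_right B_smul_right)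
  moreover have "sum e {..<5} + f = smul 2 w - a"
    using half_res(5)[OF fr w(2,3)] by (auto simp: f_def g_def fun_eq_iff smul_def sum_fun_apply algebra_simps)
  then have "lat (e 0 + f)"
    using frame_sum_odd[OF fr, of "{..<5}" f] lat_diff[OF lat_smul[OF _ w(1), of 2] a(1)] by simp
  ultimately have "frame (e(5 := f)) (Suc 5)" by (intro frame_extend[OF fr, of f 0]) auto
  then show ?thesis by auto
qed

text \<open>Type E6: a lattice vector of norm 2 that is not orthogonal to the frame and the residual
  of \<open>w\<close> must lie in their six-dimensional span, or else the frame could be lengthened.
  The conclusion is the criterion of \<open>inspan_extend\<close>.\<close>

lemma five_step:
  assumes fr: "frame e 5" and w: "lat w" "N w = 2" "\<And>i. i < 5 \<Longrightarrow> B (e i) w = 1/2"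
    and mx: "\<And>e'. \<not> frame e' 6"
    and x: "lat x" "N x = 2" "(\<exists>i<5. B (e i) x \<noteq> 0) \<or> B (res e 5 w) x \<noteq> 0"
  shows "N x = (\<Sum>i<5. (cmod (B (e i) x))\<^sup>2) + (cmod (B (res e 5 w) x))\<^sup>2 / (3/4)"
proof (rule ccontr)
  assume neg: "\<not> ?thesis"
  define g where "g = res e 5 w"
  note on = frame_onb[OF fr]
  have Ng: "N g = 3/4" using half_res(1)[OF fr w(2,3)] by (simp add: g_def)
  have mx': "\<And>e'. \<not> frame e' (Suc 5)" using mx by simp
  show False
  proof (cases "\<forall>i<5. B (e i) x \<in> gint")
    case True
    with integral_coset[OF fr mx' x(1,2)] have "(\<forall>i<5. B (e i) x = 0) \<or> inspan e 5 x" by blast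
    then have z: "\<forall>i<5. B (e i) x = 0"
    proof
      assume "inspan e 5 x"
      then have 1: "N x = (\<Sum>i<5. (cmod (B (e i) x))\<^sup>2)" by (simp add: inspan_N[OF on])
      then have "N (res e 5 x) = 0" using N_expand[OF on, of x] by simp
      then have "B (res e 5 w) x = 0" using half_res(3)[OF fr w(2,3), of x] N_zero_B by simp
      then show ?thesis using neg 1 by simp
    qed auto
    define t where "t = B g x"
    have t: "t = B w x" using half_res(4)[OF fr w(2,3), of x] z by (simp add: t_def g_def)
    have ti: "t \<in> gint" unfolding t by (rule B_gint[OF w(1) x(1)])
    have "t \<noteq> 0" using x(3) z by (auto simp: t_def g_def)
    moreover have "(cmod t)\<^sup>2 \<le> 3/2" using cauchy_schwarz[of g x] Ng x(2) by (simp add: t_def)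
    moreover obtain k :: nat where k: "(cmod t)\<^sup>2 = k" using gint_norm_square[OF ti] by blast
    ultimately have "k = 1" by (cases k) auto
    then have tu: "t \<in> gunit" using k ti gint_norm_1 by simp
    have "N (smul (cnj t) x) = 2" using gunit_norm[OF tu] x(2) by (simp add: N_smul)
    moreover have "B (res e 5 w) (smul (cnj t) x) = 1"
      using gunit_mult_cnj[OF tu] by (simp add: B_smul_right t_def g_def)
    ultimately have "\<exists>e'. frame e' 6"
      using z lat_smul[OF gint_cnj[OF ti] x(1)] by (intro five_extend[OF fr w]) (auto simp: B_smul_right)
    then show False using mx by blast
  next
    case False
    then obtain i0 where i0: "i0 < 5" "B (e i0) x \<notin> gint" by blast
    obtain \<epsilon> where ep: "\<epsilon> \<in> gunit"
      "\<And>i. i < 5 \<Longrightarrow> B (e i) (smul \<epsilon> x) = 1/2 \<or> B (e i) (smul \<epsilon> x) = -1/2"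
      using half_coset_N2[OF fr _ x(1,2) i0] by auto
    \<comment> \<open>Negation exchanges plus and minus signs. Their total is five, so one of
      \<epsilon> and -\<epsilon> leaves an even number of minus signs.\<close>
    have "\<exists>\<delta>\<in>gunit. (\<forall>i<5. B (e i) (smul \<delta> x) = 1/2 \<or> B (e i) (smul \<delta> x) = -1/2) \<and>
      even (card {i. i < 5 \<and> B (e i) (smul \<delta> x) = -1/2})"
    proof (cases "even (card {i. i < 5 \<and> B (e i) (smul \<epsilon> x) = -1/2})")
      case True
      then show ?thesis using ep by blast
    next
      case False
      define A where "A = {i. i < (5::nat) \<and> B (e i) (smul \<epsilon> x) = -1/2}"
      have "{i. i < 5 \<and> B (e i) (smul (-\<epsilon>) x) = -1/2} = {..<5} - A"
        using ep(2) by (force simp: A_def B_smul_right)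
      moreover have "card ({..<5::nat} - A) = 5 - card A"
        by (subst card_Diff_subset) (auto simp: A_def)
      moreover have "card A \<le> card {..<5::nat}" by (intro card_mono) (auto simp: A_def)
      ultimately have "even (card {i. i < 5 \<and> B (e i) (smul (-\<epsilon>) x) = -1/2})"
        using False unfolding A_def[symmetric] by simp
      moreover have "B (e i) (smul (-\<epsilon>) x) = 1/2 \<or> B (e i) (smul (-\<epsilon>) x) = -1/2" if "i < 5" for i
        using ep(2)[OF that] by (auto simp: B_smul_right)
      ultimately show ?thesis using gunit_minus[OF ep(1)] by blast
    qed
    then obtain \<delta> where de: "\<delta> \<in> gunit"
      "\<And>i. i < 5 \<Longrightarrow> B (e i) (smul \<delta> x) = 1/2 \<or> B (e i) (smul \<delta> x) = -1/2"
      "even (card {i. i < 5 \<and> B (e i) (smul \<delta> x) = -1/2})" by blast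
    define y where "y = smul \<delta> x"
    define A where "A = {i. i < (5::nat) \<and> B (e i) y = -1/2}"
    have y: "lat y" "N y = 2" using lat_smul[OF gunit_gint[OF de(1)] x(1)] x(2) gunit_norm[OF de(1)]
      by (simp_all add: y_def N_smul)
    have yh: "\<And>i. i < 5 \<Longrightarrow> B (e i) y = 1/2 \<or> B (e i) y = -1/2" using de(2) by (simp add: y_def)
    have ysum: "(\<Sum>i<5. (cmod (B (e i) y))\<^sup>2) = 5/4"
    proof -
      have "(\<Sum>i<5. (cmod (B (e i) y))\<^sup>2) = (\<Sum>i<(5::nat). 1/4)"
        by (intro sum.cong half_norm yh) auto
      then show ?thesis by simp
    qed
    have Ny: "N (res e 5 y) = 3/4" using N_expand[OF on, of y] ysum y(2) by simp
    obtain l where l: "card A = 2 * l" using de(3) by (auto simp: A_def y_def)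
    define t where "t = B g y"
    define a where "a = w - y - sum e A"
    have a: "a = g - res e 5 y" unfolding a_def A_def g_def
      by (rule half_diff(1)[OF fr w(3) yh])
    have la: "lat a" unfolding a_def
      by (intro lat_diff w(1) y(1) frame_sum_even[OF fr]) (use l in \<open>auto simp: A_def\<close>)
    have Bea: "B (e i) a = 0" if "i < 5" for i
      using B_res(1)[OF on that] by (simp add: a g_def B_diff_right)
    have t: "t = B g (res e 5 y)" using half_res(3)[OF fr w(2,3)] by (simp add: t_def g_def)
    have Bga: "B g a = 3/4 - t"
      using half_res(2)[OF fr w(2,3)] half_res(3)[OF fr w(2,3), of w]
      unfolding g_def[symmetric] by (simp add: a B_diff_right t Ng B_self)
    have "B w y = (5/2 - of_nat (card A)) / 2 + t"
      using half_res(4)[OF fr w(2,3), of y] half_diff(2)[OF fr w(3) yh] by (simp add: t_def g_def A_def)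
    \<comment> \<open>The right-hand side is a Gaussian integer, while Cauchy-Schwarz confines
      \<open>t = 3/4 - B g a\<close> to the disc of radius 3/4. Only the values 0 and 1 of
      \<open>B g a\<close> survive.\<close>
    then have q: "B g a = 2 - of_nat l - B w y" by (simp add: Bga l field_simps)
    have "B g a \<in> gint" unfolding q using B_gint[OF w(1) y(1)] by (intro gint_diff) auto
    then obtain p s where ps: "Re (B g a) = of_int p" "Im (B g a) = of_int s"
      by (auto simp: gint_def elim!: Ints_cases)
    have "(cmod t)\<^sup>2 \<le> 9/16" using cauchy_schwarz[of g "res e 5 y"] Ng Ny by (simp add: t)
    moreover have tt: "t = 3/4 - B g a" using Bga by simp
    ultimately have le: "(3/4 - real_of_int p)\<^sup>2 + (real_of_int s)\<^sup>2 \<le> 9/16"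
      using ps by (simp add: cmod_power2)
    have "(real_of_int s)\<^sup>2 < 1"
      using le zero_le_power2[of "3/4 - real_of_int p"] by linarith
    then have "s = 0" by (simp add: abs_square_less_1)
    have "(3/4 :: real)\<^sup>2 = 9/16" by (simp add: power2_eq_square)
    then have "(3/4 - real_of_int p)\<^sup>2 \<le> (3/4)\<^sup>2"
      using le zero_le_power2[of "real_of_int s"] by linarith
    then have "\<bar>3/4 - real_of_int p\<bar> \<le> \<bar>3/4\<bar>" by (simp only: abs_le_square_iff)
    then have "p = 0 \<or> p = 1" by linarith
    then show False
    proof
      \<comment> \<open>Now \<open>t\<close> attains the Cauchy-Schwarz bound, so the residual of
        \<open>y\<close> is used up by the direction \<open>g\<close> and \<open>y\<close> lies in
        the span.\<close>
      assume "p = 0"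
      then have "B g a = 0" using ps \<open>s = 0\<close> by (simp add: complex_eq_iff)
      then have t34: "t = 3/4" using Bga by simp
      have "(cmod t)\<^sup>2 / (3/4) = 3/4" unfolding t34 by (simp add: power2_eq_square norm_divide)
      then have "N y = (\<Sum>i<5. (cmod (B (e i) y))\<^sup>2) + (cmod (B g y))\<^sup>2 / (3/4)"
        using ysum y(2) by (simp flip: t_def)
      then show False using neg gunit_norm[OF de(1)]
        by (simp add: y_def N_smul B_smul_right norm_mult g_def)
    next
      \<comment> \<open>Now \<open>t = -1/4\<close> gives \<open>a\<close> the norm 3/4 + 3/4 + 1/2
        = 2, and \<open>five_extend\<close> applies.\<close>
      assume "p = 1"
      then have 1: "B g a = 1" using ps \<open>s = 0\<close> by (simp add: complex_eq_iff)
      have "Re t = -1/4" unfolding tt 1 by simp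
      then have "N a = 2" using Ng Ny by (simp add: a N_diff flip: t)
      then have "\<exists>e'. frame e' 6" using five_extend[OF fr w la _ Bea] 1 by (simp add: g_def)
      then show False using mx by blast
    qed
  qed
qed

text \<open>The analogue for type E7. Six being even, negation keeps the parity of the number of
  minus signs, so both parities occur: the even one leads into the span, the odd one to a seventh
  frame vector.\<close>

lemma six_step:
  assumes fr: "frame e 6" and w: "lat w" "N w = 2" "\<And>i. i < 6 \<Longrightarrow> B (e i) w = 1/2"
    and mx: "\<And>e'. \<not> frame e' 7"
    and x: "lat x" "N x = 2" "(\<exists>i<6. B (e i) x \<noteq> 0) \<or> B (res e 6 w) x \<noteq> 0"
  shows "N x = (\<Sum>i<6. (cmod (B (e i) x))\<^sup>2) + (cmod (B (res e 6 w) x))\<^sup>2 / (1/2)"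
proof (rule ccontr)
  assume neg: "\<not> ?thesis"
  define g where "g = res e 6 w"
  note on = frame_onb[OF fr]
  have Ng: "N g = 1/2" using half_res(1)[OF fr w(2,3)] by (simp add: g_def)
  have mx': "\<And>e'. \<not> frame e' (Suc 6)" using mx by simp
  show False
  proof (cases "\<forall>i<6. B (e i) x \<in> gint")
    case True
    with integral_coset[OF fr mx' x(1,2)] have "(\<forall>i<6. B (e i) x = 0) \<or> inspan e 6 x" by blast
    then have z: "\<forall>i<6. B (e i) x = 0"
    proof
      assume "inspan e 6 x"
      then have 1: "N x = (\<Sum>i<6. (cmod (B (e i) x))\<^sup>2)" by (simp add: inspan_N[OF on])
      then have "N (res e 6 x) = 0" using N_expand[OF on, of x] by simp
      then have "B (res e 6 w) x = 0" using half_res(3)[OF fr w(2,3), of x] N_zero_B by simp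
      then show ?thesis using neg 1 by simp
    qed auto
    define t where "t = B g x"
    have t: "t = B w x" using half_res(4)[OF fr w(2,3), of x] z by (simp add: t_def g_def)
    have ti: "t \<in> gint" unfolding t by (rule B_gint[OF w(1) x(1)])
    have "t \<noteq> 0" using x(3) z by (auto simp: t_def g_def)
    moreover have "(cmod t)\<^sup>2 \<le> 1" using cauchy_schwarz[of g x] Ng x(2) by (simp add: t_def)
    moreover obtain k :: nat where k: "(cmod t)\<^sup>2 = k" using gint_norm_square[OF ti] by blast
    ultimately have "k = 1" by (cases k) auto
    then have "(cmod t)\<^sup>2 = 1" using k by simp
    then show False using neg z x(2) by (simp flip: g_def t_def)
  next
    case False
    then obtain i0 where i0: "i0 < 6" "B (e i0) x \<notin> gint" by blast
    obtain \<delta> where de: "\<delta> \<in> gunit"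
      "\<And>i. i < 6 \<Longrightarrow> B (e i) (smul \<delta> x) = 1/2 \<or> B (e i) (smul \<delta> x) = -1/2"
      using half_coset_N2[OF fr _ x(1,2) i0] by auto
    define y where "y = smul \<delta> x"
    define A where "A = {i. i < (6::nat) \<and> B (e i) y = -1/2}"
    have y: "lat y" "N y = 2" using lat_smul[OF gunit_gint[OF de(1)] x(1)] x(2) gunit_norm[OF de(1)]
      by (simp_all add: y_def N_smul)
    have yh: "\<And>i. i < 6 \<Longrightarrow> B (e i) y = 1/2 \<or> B (e i) y = -1/2" using de(2) by (simp add: y_def)
    have ysum: "(\<Sum>i<6. (cmod (B (e i) y))\<^sup>2) = 3/2"
    proof -
      have "(\<Sum>i<6. (cmod (B (e i) y))\<^sup>2) = (\<Sum>i<(6::nat). 1/4)"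
        by (intro sum.cong half_norm yh) auto
      then show ?thesis by simp
    qed
    have Ny: "N (res e 6 y) = 1/2" using N_expand[OF on, of y] ysum y(2) by simp
    define t where "t = B g y"
    have t: "t = B g (res e 6 y)" using half_res(3)[OF fr w(2,3)] by (simp add: t_def g_def)
    have t4: "(cmod t)\<^sup>2 \<le> 1/4" using cauchy_schwarz[of g "res e 6 y"] Ng Ny by (simp add: t)
    have Bwy: "B w y = 3/2 - of_nat (card A) / 2 + t"
      using half_res(4)[OF fr w(2,3), of y] half_diff(2)[OF fr w(3) yh] by (simp add: t_def g_def A_def diff_divide_distrib)
    have Bi: "B w y \<in> gint" by (rule B_gint[OF w(1) y(1)])
    show False
    proof (cases "even (card A)")
      case True
      then obtain l where l: "card A = 2 * l" by blast
      \<comment> \<open>So the real part of \<open>t\<close> is half an odd integer and has modulus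
        at least 1/2, which is the most that Cauchy-Schwarz allows.\<close>
      have "t + 1/2 = B w y - 1 + of_nat l" by (simp add: Bwy l)
      also have "\<dots> \<in> gint" using Bi by auto
      finally obtain p where p: "Re t + 1/2 = of_int p" by (auto simp: gint_def elim!: Ints_cases)
      have "odd (2 * p - 1)" by simp
      then have "(2 * p - 1) \<noteq> 0" by presburger
      then have "1 \<le> \<bar>2 * p - 1\<bar>" by linarith
      then have "1 \<le> \<bar>2 * real_of_int p - 1\<bar>" by linarith
      then have "1/2 \<le> \<bar>Re t\<bar>" using p by linarith
      then have "(1/2)\<^sup>2 \<le> \<bar>Re t\<bar>\<^sup>2" by (intro power_mono) auto
      also have "\<bar>Re t\<bar>\<^sup>2 \<le> (cmod t)\<^sup>2" by (simp add: cmod_power2)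
      finally have "(cmod t)\<^sup>2 = 1/4" using t4 by (simp add: power2_eq_square)
      then have "N y = (\<Sum>i<6. (cmod (B (e i) y))\<^sup>2) + (cmod (B g y))\<^sup>2 / (1/2)"
        using ysum y(2) by (simp flip: t_def)
      then show False using neg gunit_norm[OF de(1)]
        by (simp add: y_def N_smul B_smul_right norm_mult g_def)
    next
      case False
      then obtain l where l: "card A = 2 * l + 1" by (blast elim: oddE)
      \<comment> \<open>Now \<open>t\<close> is integral and too short to be non-zero. The residuals
        of \<open>w\<close> and \<open>y\<close> are orthogonal of norm 1/2 each, and their
        difference is the new norm-1 vector.\<close>
      have "t = B w y - 1 + of_nat l" by (simp add: Bwy l field_simps)
      also have "\<dots> \<in> gint" using Bi by auto
      finally have "t = 0" using t4 by (intro gint_norm_lt_1) auto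
      define f where "f = w - y - sum e A"
      have f: "f = g - res e 6 y" unfolding f_def A_def g_def
        by (rule half_diff(1)[OF fr w(3) yh])
      have "N f = 1" using \<open>t = 0\<close> Ng Ny by (simp add: f N_diff flip: t)
      moreover have "B (e i) f = 0" if "i < 6" for i
        using B_res(1)[OF on that] by (simp add: f g_def B_diff_right)
      moreover have "sum e A + f = w - y" by (simp add: f_def)
      then have "lat (e 0 + f)" using frame_sum_odd[OF fr, of A f] False lat_diff[OF w(1) y(1)]
        by (auto simp: A_def)
      ultimately have "frame (e(6 := f)) (Suc 6)" by (intro frame_extend[OF fr, of f 0]) auto
      then show False using mx' by blast
    qed
  qed
qed

text \<open>Twice the residual has norm 1 and completes the seven \<open>e i\<close> to
  \<open>2 w\<close>. Hence a frame of length seven with half-integral coordinates is never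
  maximal.\<close>

lemma seven_extend:
  assumes fr: "frame e 7" and w: "lat w" "N w = 2" "\<And>i. i < 7 \<Longrightarrow> B (e i) w = 1/2"
  shows "\<exists>e'. frame e' 8"
proof -
  define g where "g = res e 7 w"
  define f where "f = smul 2 g"
  note on = frame_onb[OF fr]
  have "N f = 1" using half_res(1)[OF fr w(2,3)]
    by (simp add: f_def g_def N_smul)
  moreover have "B (e i) f = 0" if "i < 7" for i
    using B_res(1)[OF on that] by (simp add: f_def g_def B_smul_right)
  moreover have "sum e {..<7} + f = smul 2 w"
    using half_res(5)[OF fr w(2,3)] by (auto simp: f_def g_def fun_eq_iff smul_def sum_fun_apply)
  then have "lat (e 0 + f)"
    using frame_sum_odd[OF fr, of "{..<7}" f] lat_smul[OF _ w(1), of 2] by simp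
  ultimately have "frame (e(7 := f)) (Suc 7)" by (intro frame_extend[OF fr, of f 0]) auto
  then show ?thesis by auto
qed

end

section \<open>Connected Gram matrices and the rank bound of the exceptional types\<close>

locale conn_gram = gram +
  assumes conn: "A \<subseteq> I \<Longrightarrow> A \<noteq> {} \<Longrightarrow> A \<noteq> I \<Longrightarrow> \<exists>u\<in>A. \<exists>v\<in>I-A. G u v \<noteq> 0"
begin

text \<open>By \<open>step\<close> every generator is in the span or orthogonal to it. Generators of
  the two kinds have inner product zero, so connectedness admits only one kind.\<close>

lemma conn_span:
  assumes on: "onb e r" and u: "u \<in> I" "inspan e r (unit_fun u)"
    and step: "\<And>v. v \<in> I \<Longrightarrow> \<exists>i<r. B (e i) (unit_fun v) \<noteq> 0 \<Longrightarrow> inspan e r (unit_fun v)"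
    and v: "v \<in> I"
  shows "inspan e r (unit_fun v)"
proof (rule ccontr)
  assume nv: "\<not> ?thesis"
  define A where "A = {u \<in> I. inspan e r (unit_fun u)}"
  have "A \<subseteq> I" "A \<noteq> {}" "A \<noteq> I" using u v nv by (auto simp: A_def)
  from conn[OF this] obtain a b where ab: "a \<in> A" "b \<in> I - A" "G a b \<noteq> 0" by blast
  have "\<forall>i<r. B (e i) (unit_fun b) = 0" using step ab(2) by (auto simp: A_def)
  moreover have "N (res e r (unit_fun a)) = 0" using ab(1) by (auto simp: A_def inspan_def)
  ultimately have "B (unit_fun a) (unit_fun b) = 0"
    using B_expand[OF on, of "unit_fun a" "unit_fun b"] N_zero_B by simp
  then show False using ab by (auto simp: A_def B_unit_fun)
qed

text \<open>A half-integral coordinate would put all generators into a space of dimension 6, 7 or 8: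
  the frame and one more direction for lengths 5 and 6, the frame alone for length 8. Length 7
  contradicts maximality, and beyond 8 Bessel's inequality fails.\<close>

lemma maximal_frame_integral:
  assumes card: "9 \<le> card I" and fr: "frame e r" "5 \<le> r" and mx: "\<And>e'. \<not> frame e' (Suc r)"
    and u: "u \<in> I" and i: "i < r"
  shows "B (e i) (unit_fun u) \<in> gint"
proof (rule ccontr)
  assume ni: "B (e i) (unit_fun u) \<notin> gint"
  obtain \<epsilon> where ep: "\<epsilon> \<in> gunit"
    "\<And>i. i < r \<Longrightarrow> B (e i) (smul \<epsilon> (unit_fun u)) = 1/2 \<or> B (e i) (smul \<epsilon> (unit_fun u)) = -1/2"
    using half_coset_N2[OF fr _ _ i ni] N_unit_fun[OF u] by auto
  \<comment> \<open>A unit factor makes all coordinates \<plusminus>1/2; the remaining signs are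
    absorbed into the frame.\<close>
  define w where "w = smul \<epsilon> (unit_fun u)"
  obtain f where f: "frame f r" "\<And>i. i < r \<Longrightarrow> B (f i) w = 1/2"
    using frame_normalise[OF fr(1), of w] ep(2) by (auto simp: w_def)
  have w: "lat w" "N w = 2" using lat_smul[OF gunit_gint[OF ep(1)] lat_unit_fun] gunit_norm[OF ep(1)] N_unit_fun[OF u]
    by (auto simp: w_def N_smul)
  note on = frame_onb[OF f(1)]
  have sum: "(\<Sum>i<r. (cmod (B (f i) w))\<^sup>2) = real r / 4"
  proof -
    have "(\<Sum>i<r. (cmod (B (f i) w))\<^sup>2) = (\<Sum>i<r. 1/4)"
      by (intro sum.cong half_norm) (auto simp: f(2))
    then show ?thesis by simp
  qed
  have "r \<le> 8" using bessel[OF on, of w] w(2) sum by linarith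
  then consider "r = 5" | "r = 6" | "r = 7" | "r = 8" using fr(2) by linarith
  then show False
  proof cases
    case 1
    define g where "g = res f r w"
    define h where "h = f(r := smul (of_real (1 / sqrt (N g))) g)"
    have g: "\<And>i. i < r \<Longrightarrow> B (f i) g = 0" using B_res[OF on] by (simp add: g_def)
    have Ng: "N g = 3/4" using half_res(1)[OF f(1) w(2) f(2)] 1 by (simp add: g_def)
    then have Ngp: "0 < N g" by simp
    have onh: "onb h (Suc r)" unfolding h_def by (rule onb_extend[OF on g Ngp])
    have ins: "inspan h (Suc r) x \<longleftrightarrow> N x = (\<Sum>i<r. (cmod (B (f i) x))\<^sup>2) + (cmod (B g x))\<^sup>2 / N g" for x
      unfolding h_def by (rule inspan_extend[OF on g Ngp])
    have Bgw: "B g w = of_real (N g)" unfolding g_def by (rule half_res(2)[OF f(1) w(2) f(2)])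
    have "inspan h (Suc r) w"
      unfolding ins sum Bgw Ng using w(2) 1 by (simp add: power2_eq_square)
    then have iu: "inspan h (Suc r) (unit_fun u)" unfolding w_def inspan_smul[OF onh ep(1)] .
    have "inspan h (Suc r) (unit_fun v)" if v: "v \<in> I" "\<exists>i<Suc r. B (h i) (unit_fun v) \<noteq> 0" for v
    proof -
      have "(\<exists>i<r. B (f i) (unit_fun v) \<noteq> 0) \<or> B g (unit_fun v) \<noteq> 0"
        using v(2) by (auto simp: h_def less_Suc_eq B_smul_left)
      then show ?thesis
        unfolding ins Ng using five_step[of f w "unit_fun v"] f w mx N_unit_fun[OF v(1)] 1
        by (simp add: g_def eval_nat_numeral)
    qed
    from inspan_dim[OF onh conn_span[OF onh u iu this]] show False using card 1 by simp
  next
    case 2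
    define g where "g = res f r w"
    define h where "h = f(r := smul (of_real (1 / sqrt (N g))) g)"
    have g: "\<And>i. i < r \<Longrightarrow> B (f i) g = 0" using B_res[OF on] by (simp add: g_def)
    have Ng: "N g = 1/2" using half_res(1)[OF f(1) w(2) f(2)] 2 by (simp add: g_def)
    then have Ngp: "0 < N g" by simp
    have onh: "onb h (Suc r)" unfolding h_def by (rule onb_extend[OF on g Ngp])
    have ins: "inspan h (Suc r) x \<longleftrightarrow> N x = (\<Sum>i<r. (cmod (B (f i) x))\<^sup>2) + (cmod (B g x))\<^sup>2 / N g" for x
      unfolding h_def by (rule inspan_extend[OF on g Ngp])
    have Bgw: "B g w = of_real (N g)" unfolding g_def by (rule half_res(2)[OF f(1) w(2) f(2)])
    have "inspan h (Suc r) w"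
      unfolding ins sum Bgw Ng using w(2) 2 by (simp add: power2_eq_square)
    then have iu: "inspan h (Suc r) (unit_fun u)" unfolding w_def inspan_smul[OF onh ep(1)] .
    have "inspan h (Suc r) (unit_fun v)" if v: "v \<in> I" "\<exists>i<Suc r. B (h i) (unit_fun v) \<noteq> 0" for v
    proof -
      have "(\<exists>i<r. B (f i) (unit_fun v) \<noteq> 0) \<or> B g (unit_fun v) \<noteq> 0"
        using v(2) by (auto simp: h_def less_Suc_eq B_smul_left)
      then show ?thesis
        unfolding ins Ng using six_step[of f w "unit_fun v"] f w mx N_unit_fun[OF v(1)] 2
        by (simp add: g_def eval_nat_numeral)
    qed
    from inspan_dim[OF onh conn_span[OF onh u iu this]] show False using card 2 by simp
  next
    case 3
    then show False using seven_extend[of f w] f w mx by simp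
  next
    case 4
    \<comment> \<open>Eight coordinates 1/2 exhaust the norm 2.\<close>
    have "inspan f r w" using inspan_N[OF on] w(2) sum 4 by simp
    then have iu: "inspan f r (unit_fun u)" unfolding w_def inspan_smul[OF on ep(1)] .
    have "inspan f r (unit_fun v)" if v: "v \<in> I" "\<exists>i<r. B (f i) (unit_fun v) \<noteq> 0" for v
    proof (cases "\<forall>i<r. B (f i) (unit_fun v) \<in> gint")
      case True
      then show ?thesis
        using integral_coset[OF f(1) mx lat_unit_fun N_unit_fun[OF v(1)]] v(2) by blast
    next
      case False
      then obtain j where j: "j < r" "B (f j) (unit_fun v) \<notin> gint" by blast
      obtain \<delta> where de: "\<delta> \<in> gunit"
        "\<And>i. i < r \<Longrightarrow> B (f i) (smul \<delta> (unit_fun v)) = 1/2 \<or> B (f i) (smul \<delta> (unit_fun v)) = -1/2"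
        using half_coset_N2[OF f(1) fr(2) lat_unit_fun N_unit_fun[OF v(1)] j] by blast
      have "(\<Sum>i<r. (cmod (B (f i) (smul \<delta> (unit_fun v))))\<^sup>2) = (\<Sum>i<r. 1/4)"
        by (intro sum.cong half_norm de(2)) auto
      then have "inspan f r (smul \<delta> (unit_fun v))"
        unfolding inspan_N[OF on] using 4 N_unit_fun[OF v(1)] gunit_norm[OF de(1)] by (simp add: N_smul)
      then show ?thesis unfolding inspan_smul[OF on de(1)] .
    qed
    from inspan_dim[OF on conn_span[OF on u iu this]] show False using card 4 by simp
  qed
qed

end

section \<open>Claws, frames of length four, and twins\<close>

lemma less_4_cases: "i < 4 \<Longrightarrow> i = 0 \<or> i = 1 \<or> i = 2 \<or> i = (3::nat)"
  by linarith

lemma sum_nat_two: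
  assumes "finite A" "sum f A = (2::nat)"
  shows "(\<exists>p\<in>A. f p = 2 \<and> (\<forall>i\<in>A. i \<noteq> p \<longrightarrow> f i = 0)) \<or>
    (\<exists>p\<in>A. \<exists>q\<in>A. p \<noteq> q \<and> f p = 1 \<and> f q = 1 \<and> (\<forall>i\<in>A. i \<noteq> p \<longrightarrow> i \<noteq> q \<longrightarrow> f i = 0))"
proof -
  have "\<exists>p\<in>A. f p \<noteq> 0" using assms(2) by (intro ccontr[of "\<exists>p\<in>A. f p \<noteq> 0"]) simp
  then obtain p where p: "p \<in> A" "f p \<noteq> 0" by blast
  have s: "sum f A = f p + sum f (A - {p})" using assms(1) p(1) by (rule sum.remove)
  then consider "f p = 2" "sum f (A - {p}) = 0" | "f p = 1" "sum f (A - {p}) = Suc 0"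
    using assms(2) p(2) by linarith
  then show ?thesis
  proof cases
    case 1
    then have "\<forall>i\<in>A - {p}. f i = 0" using assms(1) by simp
    then show ?thesis using 1 p(1) by blast
  next
    case 2
    then obtain q where "q \<in> A - {p}" "f q = Suc 0" "\<forall>b\<in>A - {p}. q \<noteq> b \<longrightarrow> f b = 0"
      using assms(1) sum_eq_Suc0_iff[of "A - {p}" f] by auto
    then show ?thesis using 2 p(1) by (intro disjI2 bexI[of _ p] bexI[of _ q]) auto
  qed
qed

text \<open>Turns the verification of a frame of length four into ten explicit cases;
  \<open>frameI\<close> supplies the symmetric ones.\<close>

lemma pairs_4: "i \<le> j \<Longrightarrow> j < (4::nat) \<Longrightarrow>
  (i, j) \<in> {(0,0),(0,1),(0,2),(0,3),(1,1),(1,2),(1,3),(2,2),(2,3),(3,3)}"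
  unfolding insert_iff prod.inject empty_iff by presburger

context gram begin

lemma frameI:
  assumes B: "\<And>i j. i \<le> j \<Longrightarrow> j < r \<Longrightarrow> B (e i) (e j) = (if i = j then 1 else 0)"
    and l: "\<And>i j. i \<le> j \<Longrightarrow> j < r \<Longrightarrow> lat (e i + e j)"
  shows "frame e r"
proof -
  have "B (e i) (e j) = (if i = j then 1 else 0)" if "i < r" "j < r" for i j
  proof (cases "i \<le> j")
    case False
    have "B (e i) (e j) = cnj (B (e j) (e i))" by (rule B_sym)
    then show ?thesis using False B[of j i] that by simp
  qed (use B that in blast)
  moreover have "lat (e i + e j)" if "i < r" "j < r" for i j
  proof (cases "i \<le> j")
    case False
    then have "lat (e j + e i)" using that by (intro l) auto
    then show ?thesis by (subst add.commute)
  qed (use l that in blast)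
  ultimately show ?thesis by (simp add: frame_def onb_def)
qed

text \<open>A claw is the Dynkin diagram of D4. In standard coordinates \<open>a = e0 + e1\<close>,
  \<open>b = e0 - e1\<close>, \<open>v = e0 + e2\<close> and \<open>c = e2 + e3\<close>; the
  definitions in the proof solve these equations.\<close>

lemma claw_frame:
  assumes l: "lat v" "lat a" "lat b" "lat c"
    and s: "B v v = 2" "B a a = 2" "B b b = 2" "B c c = 2"
    and o: "B v a = 1" "B v b = 1" "B v c = 1" "B a b = 0" "B a c = 0" "B b c = 0"
  shows "\<exists>e. frame e 4 \<and> inspan e 4 a"
proof -
  have o': "B a v = 1" "B b v = 1" "B c v = 1" "B b a = 0" "B c a = 0" "B c b = 0"
    by (subst B_sym, simp add: o)+
  define e0 where "e0 = smul (1/2) (a + b)"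
  define e1 where "e1 = smul (1/2) (a - b)"
  define e2 where "e2 = v - e0"
  define e3 where "e3 = c - e2"
  note defs = e0_def e1_def e2_def e3_def
  define e where "e i = (if i = 0 then e0 else if i = 1 then e1 else if i = 2 then e2 else e3)" for i :: nat
  have Bee: "B e0 e0 = 1" "B e1 e1 = 1" "B e2 e2 = 1" "B e3 e3 = 1"
    "B e0 e1 = 0" "B e0 e2 = 0" "B e0 e3 = 0" "B e1 e2 = 0" "B e1 e3 = 0" "B e2 e3 = 0"
    unfolding defs B_add_left B_add_right B_diff_left B_diff_right B_smul_left B_smul_right s o o' by simp_all
  have eqs: "e0 + e0 = a + b" "e0 + e1 = a" "e0 + e2 = v" "e0 + e3 = c - v + a + b"
    "e1 + e1 = a - b" "e1 + e2 = v - b" "e1 + e3 = c - v + a" "e2 + e2 = v + v - a - b"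
    "e2 + e3 = c" "e3 + e3 = c + c - v - v + a + b"
    by (auto simp: defs smul_def fun_eq_iff field_simps)
  have ls: "lat (e0 + e0)" "lat (e0 + e1)" "lat (e0 + e2)" "lat (e0 + e3)" "lat (e1 + e1)" "lat (e1 + e2)"
    "lat (e1 + e3)" "lat (e2 + e2)" "lat (e2 + e3)" "lat (e3 + e3)"
    unfolding eqs by (intro lat_add lat_diff l)+
  have es: "e 0 = e0" "e 1 = e1" "e 2 = e2" "e 3 = e3" by (simp_all add: e_def)
  have fr: "frame e 4"
  proof (rule frameI)
    fix i j :: nat assume "i \<le> j" "j < 4"
    from pairs_4[OF this] show "B (e i) (e j) = (if i = j then 1 else 0)" "lat (e i + e j)"
      unfolding insert_iff prod.inject empty_iff by (elim disjE conjE FalseE; simp only: es Bee ls; simp)+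
  qed
  note on = frame_onb[OF fr]
  have "inspan e 4 a"
  proof (rule inspanI[OF on])
    fix u
    have "a u = e0 u + e1 u" using eqs(2) by (metis plus_fun_apply)
    then show "a u = (\<Sum>i<4. (if i \<le> 1 then 1 else 0) * e i u)"
      by (simp add: e_def eval_nat_numeral)
  qed
  then show ?thesis using fr by blast
qed

text \<open>For \<open>r = 4\<close> half-integral coordinates cannot be excluded by counting; instead the triality of \<open>D\<^sub>4\<close>
  turns the half-integral vector into an integral one.\<close>

lemma triality_frame:
  assumes fr: "frame f 4"
  shows "\<exists>h. frame h 4 \<and> h 0 = smul (1/2) (f 0 + f 1 + f 2 + f 3) \<and> h 1 = smul (1/2) (f 0 + f 1 - f 2 - f 3) \<and>
    h 2 = smul (1/2) (f 0 - f 1 + f 2 - f 3) \<and> h 3 = smul (1/2) (f 0 - f 1 - f 2 + f 3)"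
proof -
  define h0 where "h0 = smul (1/2) (f 0 + f 1 + f 2 + f 3)"
  define h1 where "h1 = smul (1/2) (f 0 + f 1 - f 2 - f 3)"
  define h2 where "h2 = smul (1/2) (f 0 - f 1 + f 2 - f 3)"
  define h3 where "h3 = smul (1/2) (f 0 - f 1 - f 2 + f 3)"
  note defs = h0_def h1_def h2_def h3_def
  define h where "h i = (if i = 0 then h0 else if i = 1 then h1 else if i = 2 then h2 else h3)" for i :: nat
  have Bf: "B (f i) (f j) = (if i = j then 1 else 0)" if "i < 4" "j < 4" for i j
    by (rule onbD[OF frame_onb[OF fr] that])
  have Bhh: "B h0 h0 = 1" "B h1 h1 = 1" "B h2 h2 = 1" "B h3 h3 = 1"
    "B h0 h1 = 0" "B h0 h2 = 0" "B h0 h3 = 0" "B h1 h2 = 0" "B h1 h3 = 0" "B h2 h3 = 0"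
    "B h1 h0 = 0" "B h2 h0 = 0" "B h3 h0 = 0" "B h2 h1 = 0" "B h3 h1 = 0" "B h3 h2 = 0"
    by (simp_all add: defs B_add_left B_add_right B_diff_left B_diff_right B_smul_left B_smul_right Bf)
  have eqs: "h0 + h1 = f 0 + f 1" "h0 + h2 = f 0 + f 2" "h0 + h3 = f 0 + f 3" "h1 + h2 = f 0 - f 3"
    "h1 + h3 = f 0 - f 2" "h2 + h3 = f 0 - f 1"
    "h0 + h0 = (f 0 + f 1) + (f 2 + f 3)" "h1 + h1 = (f 0 + f 1) - (f 2 + f 3)"
    "h2 + h2 = (f 0 - f 1) + (f 2 - f 3)" "h3 + h3 = (f 0 - f 1) - (f 2 - f 3)"
    by (auto simp: defs smul_def fun_eq_iff field_simps)
  have lf: "lat (f i + f j)" "lat (f i - f j)" if "i < 4" "j < 4" for i j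
    using frame_add[OF fr that] frame_diff[OF fr that] by auto
  have ls: "lat (h0 + h0)" "lat (h0 + h1)" "lat (h0 + h2)" "lat (h0 + h3)" "lat (h1 + h1)" "lat (h1 + h2)"
    "lat (h1 + h3)" "lat (h2 + h2)" "lat (h2 + h3)" "lat (h3 + h3)"
    unfolding eqs
    by ((rule lat_add[OF lf(1) lf(1)] lat_diff[OF lf(1) lf(1)] lat_add[OF lf(2) lf(2)] lat_diff[OF lf(2) lf(2)] lf; simp)+)
  have hs: "h 0 = h0" "h 1 = h1" "h 2 = h2" "h 3 = h3" by (simp_all add: h_def)
  have "frame h 4"
  proof (rule frameI)
    fix i j :: nat assume "i \<le> j" "j < 4"
    from pairs_4[OF this] show "B (h i) (h j) = (if i = j then 1 else 0)" "lat (h i + h j)"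
      unfolding insert_iff prod.inject empty_iff by (elim disjE conjE FalseE; simp only: hs Bhh ls; simp)+
  qed
  then show ?thesis by (intro exI[of _ h]) (simp add: h_def defs)
qed

text \<open>After triality a half-integral vector has coordinates (1, 0, 0, 0). By
  \<open>integral_coset\<close> it would lie in the span of the new frame, where its norm would be 1
  instead of 2.\<close>

lemma four_step:
  assumes fr: "frame e 4" and mx: "\<And>e'. \<not> frame e' 5"
    and x: "lat x" "N x = 2" "\<exists>i<4. B (e i) x \<noteq> 0"
  shows "inspan e 4 x"
proof (rule ccontr)
  assume ns: "\<not> ?thesis"
  note on = frame_onb[OF fr]
  have mx': "\<not> frame e' (Suc 4)" for e' using mx[of e'] by (simp add: eval_nat_numeral)
  show False
  proof (cases "\<forall>i<4. B (e i) x \<in> gint")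
    case True
    then show ?thesis using integral_coset[OF fr mx' x(1,2)] ns x(3) by blast
  next
    case False
    then obtain j where j: "j < 4" "B (e j) x \<notin> gint" by blast
    \<comment> \<open>For length four both bounds of \<open>half_coset\<close> equal 8, and they
      hold only because a vector outside the span satisfies Bessel's inequality strictly.\<close>
    have lt: "(\<Sum>i<4. (cmod (B (e i) x))\<^sup>2) < 2"
      using bessel[OF on, of x] inspan_N[OF on, of x] ns x(2) by simp
    obtain \<epsilon> where ep: "\<epsilon> \<in> gunit"
      "\<And>i. i < 4 \<Longrightarrow> B (e i) (smul \<epsilon> x) = 1/2 \<or> B (e i) (smul \<epsilon> x) = -1/2"
      by (rule half_coset[OF fr x(1) j]) (use lt in auto)
    define w where "w = smul \<epsilon> x"
    obtain f where f: "frame f 4" "\<And>i. i < 4 \<Longrightarrow> B (f i) w = 1/2"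
      using frame_normalise[OF fr(1), of w] ep(2) by (auto simp: w_def)
    have w: "lat w" "N w = 2" using lat_smul[OF gunit_gint[OF ep(1)] x(1)] gunit_norm[OF ep(1)] x(2)
      by (auto simp: w_def N_smul)
    obtain h where h: "frame h 4" "h 0 = smul (1/2) (f 0 + f 1 + f 2 + f 3)" "h 1 = smul (1/2) (f 0 + f 1 - f 2 - f 3)"
      "h 2 = smul (1/2) (f 0 - f 1 + f 2 - f 3)" "h 3 = smul (1/2) (f 0 - f 1 - f 2 + f 3)"
      using triality_frame[OF f(1)] by blast
    have Bh: "B (h 0) w = 1" "B (h 1) w = 0" "B (h 2) w = 0" "B (h 3) w = 0"
      unfolding h(2-5) by (simp_all add: B_smul_left B_add_left B_diff_left f(2))
    have "B (h i) w \<in> gint" if "i < 4" for i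
      using less_4_cases[OF that] Bh by auto
    from integral_coset[OF h(1) mx' w this] Bh(1) have "inspan h 4 w" by (metis zero_less_numeral zero_neq_one)
    then have "(\<Sum>i<4. (cmod (B (h i) w))\<^sup>2) = 2" using inspan_N[OF frame_onb[OF h(1)]] w(2) by simp
    moreover have "(\<Sum>i<4. (cmod (B (h i) w))\<^sup>2) = 1" using Bh by (simp add: eval_nat_numeral)
    ultimately show False by simp
  qed
qed

definition coeff :: "(nat \<Rightarrow> 'b \<Rightarrow> complex) \<Rightarrow> 'b \<Rightarrow> nat \<Rightarrow> complex" where
  "coeff e u i = B (e i) (unit_fun u)"

text \<open>The squared moduli of the coordinates are natural numbers with sum 2, and a Gaussian
  integer of modulus 1 is a unit.\<close>

lemma coeff_shape:
  assumes on: "onb e r" and u: "u \<in> I" "inspan e r (unit_fun u)" and int: "\<And>i. i < r \<Longrightarrow> coeff e u i \<in> gint"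
  shows "(\<exists>p<r. (cmod (coeff e u p))\<^sup>2 = 2 \<and> (\<forall>i<r. i \<noteq> p \<longrightarrow> coeff e u i = 0)) \<or>
    (\<exists>p<r. \<exists>q<r. p \<noteq> q \<and> coeff e u p \<in> gunit \<and> coeff e u q \<in> gunit \<and>
      (\<forall>i<r. i \<noteq> p \<longrightarrow> i \<noteq> q \<longrightarrow> coeff e u i = 0))"
proof -
  obtain n :: "nat \<Rightarrow> nat" where n: "\<And>i. i < r \<Longrightarrow> (cmod (coeff e u i))\<^sup>2 = n i"
    using gint_norm_square[OF int] by metis
  have "real (\<Sum>i<r. n i) = (\<Sum>i<r. (cmod (coeff e u i))\<^sup>2)"
    unfolding of_nat_sum by (intro sum.cong) (auto simp: n)
  also have "\<dots> = 2" using u inspan_N[OF on, of "unit_fun u"] N_unit_fun by (simp add: coeff_def)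
  finally have s: "(\<Sum>i<r. n i) = 2" by linarith
  have z: "coeff e u i = 0" if "i < r" "n i = 0" for i using n[OF that(1)] that(2) by simp
  have o: "coeff e u i \<in> gunit" if "i < r" "n i = 1" for i
    using n[OF that(1)] that(2) int[OF that(1)] by (intro gint_norm_1) auto
  from sum_nat_two[OF finite_lessThan s] show ?thesis
  proof (elim disjE bexE conjE)
    fix p assume p: "p \<in> {..<r}" "n p = 2" "\<forall>i\<in>{..<r}. i \<noteq> p \<longrightarrow> n i = 0"
    then show ?thesis using n[of p] z by (intro disjI1 exI[of _ p]) auto
  next
    fix p q assume pq: "p \<in> {..<r}" "q \<in> {..<r}" "p \<noteq> q" "n p = 1" "n q = 1"
      "\<forall>i\<in>{..<r}. i \<noteq> p \<longrightarrow> i \<noteq> q \<longrightarrow> n i = 0"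
    then show ?thesis using o[of p] o[of q] z by (intro disjI2 exI[of _ p] conjI exI[of _ q]) auto
  qed
qed

text \<open>Let \<open>v\<close> be supported on \<open>p\<close> and \<open>q\<close>. A neighbour
  supported on both or on neither would have as inner product a sum of two units or 0, never a unit.
  So each of the three neighbours meets exactly one of \<open>p\<close>, \<open>q\<close>, and two
  of them meet the same one. Being orthogonal, these two have equal support, and a suitable unit
  combination of them is twice a unit multiple of one frame vector.\<close>

lemma coeff_twins:
  assumes on: "onb e r"
    and sp: "\<And>u. u \<in> I \<Longrightarrow> inspan e r (unit_fun u)"
    and int: "\<And>u i. u \<in> I \<Longrightarrow> i < r \<Longrightarrow> coeff e u i \<in> gint"
    and I: "v \<in> I" "a \<in> I" "b \<in> I" "c \<in> I" and d: "v \<noteq> a" "v \<noteq> b" "v \<noteq> c" "a \<noteq> b" "a \<noteq> c" "b \<noteq> c"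
    and G: "G v a \<noteq> 0" "G v b \<noteq> 0" "G v c \<noteq> 0" "G a b = 0" "G a c = 0" "G b c = 0"
  shows "\<exists>x\<in>I. \<exists>y\<in>I. x \<noteq> y \<and> G v x \<noteq> 0 \<and> G v y \<noteq> 0 \<and> v \<noteq> x \<and> v \<noteq> y \<and> (\<exists>\<epsilon>\<in>gunit. \<forall>w\<in>I. (G w x + \<epsilon> * G w y) / 2 \<in> gint)"
proof -
  define k where "k = coeff e"
  have Gk: "G u w = (\<Sum>i<r. cnj (k u i) * k w i)" if "u \<in> I" "w \<in> I" for u w
    using B_expand[OF on, of "unit_fun u" "unit_fun w"] sp[OF that(1)] N_zero_B B_unit_fun[OF that]
    by (simp add: inspan_def k_def coeff_def)
  define two where "two u p q \<longleftrightarrow> p < r \<and> q < r \<and> p \<noteq> q \<and> k u p \<in> gunit \<and> k u q \<in> gunit \<and>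
      (\<forall>i<r. i \<noteq> p \<longrightarrow> i \<noteq> q \<longrightarrow> k u i = 0)" for u p q
  have G2: "G w u = cnj (k w p) * k u p + cnj (k w q) * k u q" if "u \<in> I" "w \<in> I" "two u p q" for u w p q
  proof -
    have "G w u = (\<Sum>i\<in>{p, q}. cnj (k w i) * k u i)"
      unfolding Gk[OF that(2,1)] using that(3) by (intro sum.mono_neutral_right) (auto simp: two_def)
    then show ?thesis using that(3) by (simp add: two_def)
  qed
  \<comment> \<open>If the only coordinate had squared modulus 2, the squared modulus of every inner
    product would be even, so the vector would have no neighbours.\<close>
  have nb: "\<exists>p q. two u p q" if uw: "u \<in> I" "w \<in> I" "u \<noteq> w" "G w u \<noteq> 0" for u w
  proof (rule ccontr)
    assume "\<not> ?thesis"
    then obtain p where p: "p < r" "(cmod (k u p))\<^sup>2 = 2" "\<forall>i<r. i \<noteq> p \<longrightarrow> k u i = 0"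
      using coeff_shape[OF on uw(1) sp[OF uw(1)] int[OF uw(1)]] unfolding two_def k_def by blast
    have "G w u = (\<Sum>i\<in>{p}. cnj (k w i) * k u i)"
      unfolding Gk[OF uw(2,1)] using p by (intro sum.mono_neutral_right) auto
    then have "(cmod (G w u))\<^sup>2 = (cmod (k w p))\<^sup>2 * 2" using p(2) by (simp add: norm_mult power_mult_distrib)
    moreover obtain m :: nat where "(cmod (k w p))\<^sup>2 = m"
      using gint_norm_square int[OF uw(2) p(1)] by (auto simp: k_def)
    moreover have "cmod (G w u) = 1" using entry[OF uw(2,1)] uw(3,4) gunit_norm by blast
    ultimately have "real (m * 2) = real 1" by simp
    then have "m * 2 = 1" by (simp only: of_nat_eq_iff)
    then show False by presburger
  qed
  have Gsym: "G w u \<noteq> 0" if "G u w \<noteq> 0" "u \<in> I" "w \<in> I" for u w using herm[OF that(2,3)] that(1) by simp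
  obtain p q where pq: "two v p q" using nb[OF I(1,2) d(1) Gsym[OF G(1) I(1,2)]] by blast
  have one: "(k x p \<noteq> 0) \<noteq> (k x q \<noteq> 0)" if x: "x \<in> I" "x \<noteq> v" "G v x \<noteq> 0" for x
  proof -
    have e: "G x v = cnj (k x p) * k v p + cnj (k x q) * k v q" by (rule G2[OF I(1) x(1) pq])
    have un: "G x v \<in> gunit" using entry[OF x(1) I(1) x(2)] Gsym[OF x(3) I(1) x(1)] by blast
    obtain s t where st: "two x s t" using nb[OF x(1) I(1) x(2,3)] by blast
    have vp: "k v p \<in> gunit" "k v q \<in> gunit" "p < r" "q < r" "p \<noteq> q" using pq by (auto simp: two_def)
    show ?thesis
    proof
      assume eq: "(k x p \<noteq> 0) = (k x q \<noteq> 0)"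
      show False
      proof (cases "k x p = 0")
        case True
        then show False using eq e un by (auto simp: gunit_def)
      next
        case False
        then have "k x p \<in> gunit" "k x q \<in> gunit" using st eq vp by (auto simp: two_def)
        then have "cnj (k x p) * k v p \<in> gunit" "cnj (k x q) * k v q \<in> gunit" using vp by auto
        then show False using un unfolding e by (auto simp: gunit_def complex_eq_iff)
      qed
    qed
  qed
  have pair: "\<exists>\<epsilon>\<in>gunit. \<forall>w\<in>I. (G w x + \<epsilon> * G w y) / 2 \<in> gint"
    if x: "x \<in> I" "x \<noteq> v" "G v x \<noteq> 0" and y: "y \<in> I" "y \<noteq> v" "G v y \<noteq> 0" and xy: "G x y = 0"
      and l: "l < r" "k x l \<noteq> 0" "k y l \<noteq> 0" for x y l
  proof -
    obtain s t where st: "two x s t" using nb[OF x(1) I(1) x(2,3)] by blast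
    then obtain s where s: "two x l s"
      using l by (cases "l = s") (auto simp: two_def)
    obtain s' t' where "two y s' t'" using nb[OF y(1) I(1) y(2,3)] by blast
    then obtain t where t: "two y l t"
      using l by (cases "l = s'") (auto simp: two_def)
    have e0: "0 = cnj (k x l) * k y l + cnj (k x t) * k y t" using G2[OF y(1) x(1) t] xy by simp
    have "s = t"
    proof (rule ccontr)
      assume "s \<noteq> t"
      then have "k x t = 0" using s t by (auto simp: two_def)
      then show False using e0 l by simp
    qed
    note t = t[folded \<open>s = t\<close>]
    have u: "k x l \<in> gunit" "k x s \<in> gunit" "k y l \<in> gunit" "k y s \<in> gunit" "s < r"
      using s t by (auto simp: two_def)
    \<comment> \<open>Chosen to cancel the shared coordinate \<open>l\<close>; orthogonality then
      forces the other coordinate to double.\<close>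
    define \<epsilon> where "\<epsilon> = - (k x l * cnj (k y l))"
    have "\<epsilon> \<in> gunit" using u by (auto simp: \<epsilon>_def)
    have 1: "k x l + \<epsilon> * k y l = 0"
      using gunit_mult_cnj(2)[OF u(3)] by (simp add: \<epsilon>_def mult.assoc)
    have 2: "k x s + \<epsilon> * k y s = 2 * k x s"
    proof -
      have "cnj (k x s) * k y s = - (cnj (k x l) * k y l)"
        using e0 \<open>s = t\<close> by (simp add: eq_neg_iff_add_eq_0 add.commute)
      then have "k x s * (cnj (k x s) * k y s) = k x s * (- (cnj (k x l) * k y l))" by simp
      then have ys: "k y s = - (k x s * cnj (k x l) * k y l)"
        using gunit_mult_cnj(1)[OF u(2)] by (simp flip: mult.assoc)
      have "\<epsilon> * k y s = (k x l * cnj (k x l)) * (cnj (k y l) * k y l) * k x s"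
        unfolding ys \<epsilon>_def by (simp add: mult_ac)
      then show ?thesis using gunit_mult_cnj[OF u(1)] gunit_mult_cnj[OF u(3)] by simp
    qed
    have "(G w x + \<epsilon> * G w y) / 2 \<in> gint" if w: "w \<in> I" for w
    proof -
      have "G w x + \<epsilon> * G w y = cnj (k w l) * (k x l + \<epsilon> * k y l) + cnj (k w s) * (k x s + \<epsilon> * k y s)"
        unfolding G2[OF x(1) w s] G2[OF y(1) w t] by (simp add: algebra_simps)
      then have "(G w x + \<epsilon> * G w y) / 2 = cnj (k w s) * k x s" by (simp add: 1 2)
      also have "\<dots> \<in> gint" using int[OF w u(5)] u(2) by (auto simp: k_def)
      finally show ?thesis .
    qed
    then show ?thesis using \<open>\<epsilon> \<in> gunit\<close> by blast
  qed
  have pr: "p < r" "q < r" using pq by (auto simp: two_def)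
  have oa: "(k a p \<noteq> 0) \<noteq> (k a q \<noteq> 0)" and ob: "(k b p \<noteq> 0) \<noteq> (k b q \<noteq> 0)" and oc: "(k c p \<noteq> 0) \<noteq> (k c q \<noteq> 0)"
    using one[OF I(2) d(1)[symmetric] G(1)] one[OF I(3) d(2)[symmetric] G(2)] one[OF I(4) d(3)[symmetric] G(3)] by auto
  then have "(\<exists>l<r. k a l \<noteq> 0 \<and> k b l \<noteq> 0) \<or> (\<exists>l<r. k a l \<noteq> 0 \<and> k c l \<noteq> 0) \<or> (\<exists>l<r. k b l \<noteq> 0 \<and> k c l \<noteq> 0)"
    using pr by metis
  then show ?thesis
  proof (elim disjE exE conjE)
    fix l assume "l < r" "k a l \<noteq> 0" "k b l \<noteq> 0"
    from pair[OF I(2) d(1)[symmetric] G(1) I(3) d(2)[symmetric] G(2) G(4) this]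
    show ?thesis using I d G by blast
  next
    fix l assume "l < r" "k a l \<noteq> 0" "k c l \<noteq> 0"
    from pair[OF I(2) d(1)[symmetric] G(1) I(4) d(3)[symmetric] G(3) G(5) this]
    show ?thesis using I d G by blast
  next
    fix l assume "l < r" "k b l \<noteq> 0" "k c l \<noteq> 0"
    from pair[OF I(3) d(2)[symmetric] G(2) I(4) d(3)[symmetric] G(3) G(6) this]
    show ?thesis using I d G by blast
  qed
qed

end

text \<open>If the frame of length 4 coming from the claw were maximal, \<open>four_step\<close>
  would confine nine independent generators to four dimensions. So a longest frame has length at
  least 5. By integrality it spans everything, which puts the generators into the form that
  \<open>coeff_twins\<close> treats.\<close>

theorem (in conn_gram) claw_twins:
  assumes card: "9 \<le> card I"
    and I: "v \<in> I" "a \<in> I" "b \<in> I" "c \<in> I" and d: "v \<noteq> a" "v \<noteq> b" "v \<noteq> c" "a \<noteq> b" "a \<noteq> c" "b \<noteq> c"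
    and G: "G v a \<noteq> 0" "G v b \<noteq> 0" "G v c \<noteq> 0" "G a b = 0" "G a c = 0" "G b c = 0"
  shows "\<exists>x\<in>I. \<exists>y\<in>I. x \<noteq> y \<and> G v x \<noteq> 0 \<and> G v y \<noteq> 0 \<and> v \<noteq> x \<and> v \<noteq> y \<and> (\<exists>\<epsilon>\<in>gunit. \<forall>w\<in>I. (G w x + \<epsilon> * G w y) / 2 \<in> gint)"
proof -
  \<comment> \<open>Unit factors make the inner products of the neighbours with \<open>v\<close>
    equal to 1, as \<open>claw_frame\<close> expects.\<close>
  define s where "s x = smul (cnj (G v x)) (unit_fun x)" for x
  have un: "G v x \<in> gunit" if "x = a \<or> x = b \<or> x = c" for x
    using that entry[of v x] I d G by auto
  have ls: "lat (s x)" if "x = a \<or> x = b \<or> x = c" for x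
    unfolding s_def by (rule lat_smul) (use un[OF that] in auto)
  have Bs1: "B (s x) (s x) = 2" "B (unit_fun v) (s x) = 1" if "x = a \<or> x = b \<or> x = c" for x
  proof -
    have xI: "x \<in> I" using that I by auto
    show "B (s x) (s x) = 2" "B (unit_fun v) (s x) = 1"
      using gunit_mult_cnj[OF un[OF that]] xI I(1)
      by (simp_all add: s_def B_smul_left B_smul_right B_unit_fun diag flip: mult.assoc)
  qed
  have Bs0: "B (s a) (s b) = 0" "B (s a) (s c) = 0" "B (s b) (s c) = 0"
    using I G by (simp_all add: s_def B_smul_left B_smul_right B_unit_fun)
  obtain e where e: "frame e 4" "inspan e 4 (s a)"
    using claw_frame[OF lat_unit_fun ls ls ls _ Bs1(1) Bs1(1) Bs1(1) Bs1(2) Bs1(2) Bs1(2) Bs0] I(1)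
    by (auto simp: B_unit_fun diag)
  have ia: "inspan e 4 (unit_fun a)"
    using e(2) inspan_smul[OF frame_onb[OF e(1)] gunit_cnj[OF un]] by (simp add: s_def)
  have "\<exists>e'. frame e' 5"
  proof (rule ccontr)
    assume "\<not> ?thesis"
    then have "inspan e 4 (unit_fun u)" if "u \<in> I" "\<exists>i<4. B (e i) (unit_fun u) \<noteq> 0" for u
      using four_step[OF e(1) _ lat_unit_fun N_unit_fun[OF that(1)] that(2)] by blast
    from inspan_dim[OF frame_onb[OF e(1)] conn_span[OF frame_onb[OF e(1)] I(2) ia this]]
    show False using card by simp
  qed
  then obtain r where r: "\<exists>e. frame e r" "\<And>r'. \<exists>e. frame e r' \<Longrightarrow> r' \<le> r"
    using GreatestI_ex_nat[of "\<lambda>r. \<exists>e. frame e r" "8 * card I"]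
      Greatest_le_nat[of "\<lambda>r. \<exists>e. frame e r" _ "8 * card I"] frame_bound by blast
  then have r5: "5 \<le> r" using \<open>\<exists>e'. frame e' 5\<close> by blast
  have mx: "\<not> frame e' (Suc r)" for e' using r(2)[of "Suc r"] by auto
  obtain e where e: "frame e r" using r(1) by blast
  have int: "B (e i) (unit_fun u) \<in> gint" if "u \<in> I" "i < r" for u i
    by (rule maximal_frame_integral[OF card e r5 mx that])
  have step: "inspan e r (unit_fun u)" if "u \<in> I" "\<exists>i<r. B (e i) (unit_fun u) \<noteq> 0" for u
    using integral_coset[OF e mx lat_unit_fun N_unit_fun[OF that(1)] int[OF that(1)]] that(2) by blast
  obtain u where u: "u \<in> I" "B (e 0) (unit_fun u) \<noteq> 0" using frame_hits[OF e, of 0] r5 by auto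
  have iu: "inspan e r (unit_fun u)" by (rule step[OF u(1)]) (use u(2) r5 in \<open>auto intro!: exI[of _ 0]\<close>)
  show ?thesis
    by (rule coeff_twins[OF frame_onb[OF e] conn_span[OF frame_onb[OF e] u(1) iu step] _ I d G])
      (use int in \<open>auto simp: coeff_def\<close>)
qed

subsection \<open>Spectra of Hermitian matrices over the Gaussian integers\<close>

text \<open>Formulated for functions on a set, so that one \<open>h\<close> can be restricted to
  various vertex sets without renumbering matrices.\<close>

definition ev :: "('a \<Rightarrow> 'a \<Rightarrow> complex) \<Rightarrow> 'a set \<Rightarrow> complex \<Rightarrow> bool" where
  "ev h S \<mu> \<longleftrightarrow> (\<exists>x. (\<exists>u\<in>S. x u \<noteq> 0) \<and> (\<forall>u\<in>S. (\<Sum>v\<in>S. h u v * x v) = \<mu> * x u))"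

definition mat_of :: "('a \<Rightarrow> 'a \<Rightarrow> complex) \<Rightarrow> 'a list \<Rightarrow> complex mat" where
  "mat_of h vs = mat (length vs) (length vs) (\<lambda>(i, j). h (vs ! i) (vs ! j))"

lemma mat_of_carrier [simp]: "mat_of h vs \<in> carrier_mat (length vs) (length vs)"
  by (simp add: mat_of_def)

lemma sum_nth: "distinct vs \<Longrightarrow> (\<Sum>v\<in>set vs. f v) = (\<Sum>i<length vs. f (vs ! i))"
  by (rule sum.reindex_bij_betw[symmetric]) (rule bij_betw_nth; simp)

lemma ev_eigenvalue:
  assumes "distinct vs"
  shows "ev h (set vs) \<mu> \<longleftrightarrow> eigenvalue (mat_of h vs) \<mu>"
proof
  assume "ev h (set vs) \<mu>"
  then obtain x where x: "\<exists>u\<in>set vs. x u \<noteq> 0" "\<And>u. u \<in> set vs \<Longrightarrow> (\<Sum>v\<in>set vs. h u v * x v) = \<mu> * x u"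
    by (auto simp: ev_def)
  define y where "y = vec (length vs) (\<lambda>i. x (vs ! i))"
  have "y \<noteq> 0\<^sub>v (length vs)"
  proof
    assume "y = 0\<^sub>v (length vs)"
    then have "x (vs ! i) = 0" if "i < length vs" for i using that by (auto simp: y_def dest: arg_cong[of _ _ "\<lambda>y. y $ i"])
    then show False using x(1) by (auto simp: in_set_conv_nth)
  qed
  moreover have "mat_of h vs *\<^sub>v y = \<mu> \<cdot>\<^sub>v y"
  proof (rule eq_vecI)
    fix i assume "i < dim_vec (\<mu> \<cdot>\<^sub>v y)"
    then have i: "i < length vs" by (simp add: y_def)
    show "(mat_of h vs *\<^sub>v y) $ i = (\<mu> \<cdot>\<^sub>v y) $ i"
      using x(2)[of "vs ! i"] i sum_nth[OF assms, of "\<lambda>v. h (vs ! i) v * x v"]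
      by (simp add: mat_of_def y_def scalar_prod_def atLeast0LessThan)
  qed (simp add: mat_of_def y_def)
  moreover have "y \<in> carrier_vec (length vs)" by (simp add: y_def)
  ultimately show "eigenvalue (mat_of h vs) \<mu>"
    unfolding eigenvalue_def eigenvector_def by (intro exI[of _ y]) (simp add: mat_of_def)
next
  assume "eigenvalue (mat_of h vs) \<mu>"
  then obtain y where y: "y \<in> carrier_vec (length vs)" "y \<noteq> 0\<^sub>v (length vs)" "mat_of h vs *\<^sub>v y = \<mu> \<cdot>\<^sub>v y"
    unfolding eigenvalue_def eigenvector_def by (auto simp: mat_of_def)
  define x where "x u = y $ (THE i. i < length vs \<and> vs ! i = u)" for u
  have xi: "x (vs ! i) = y $ i" if "i < length vs" for i
  proof -
    have "(THE j. j < length vs \<and> vs ! j = vs ! i) = i"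
      using that assms by (intro the_equality) (auto simp: nth_eq_iff_index_eq)
    then show ?thesis by (simp add: x_def)
  qed
  have "\<exists>u\<in>set vs. x u \<noteq> 0"
  proof (rule ccontr)
    assume "\<not> ?thesis"
    then have "y $ i = 0" if "i < length vs" for i using xi[OF that] that by auto
    then have "y = 0\<^sub>v (length vs)" using y(1) by (intro eq_vecI) auto
    then show False using y(2) by simp
  qed
  moreover have "(\<Sum>v\<in>set vs. h u v * x v) = \<mu> * x u" if "u \<in> set vs" for u
  proof -
    obtain i where i: "i < length vs" "u = vs ! i" using \<open>u \<in> set vs\<close> by (auto simp: in_set_conv_nth)
    have "(\<Sum>v\<in>set vs. h u v * x v) = (\<Sum>j<length vs. h u (vs ! j) * y $ j)"
      unfolding sum_nth[OF assms] by (intro sum.cong) (auto simp: xi)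
    also have "\<dots> = (mat_of h vs *\<^sub>v y) $ i"
      using i y(1) by (simp add: mat_of_def scalar_prod_def atLeast0LessThan)
    also have "\<dots> = \<mu> * x u" using y i xi by simp
    finally show ?thesis .
  qed
  ultimately show "ev h (set vs) \<mu>" by (auto simp: ev_def)
qed

lemma ev_root:
  assumes "distinct vs"
  shows "ev h (set vs) \<mu> \<longleftrightarrow> poly (char_poly (mat_of h vs)) \<mu> = 0"
  using ev_eigenvalue[OF assms] eigenvalue_root_char_poly[OF mat_of_carrier] by metis

lemma ev_card:
  assumes "finite S" and M: "\<And>\<mu>. \<mu> \<in> M \<Longrightarrow> ev h S \<mu>"
  shows "finite M \<and> card M \<le> card S"
proof -
  obtain vs where vs: "set vs = S" "distinct vs" using finite_distinct_list[OF assms(1)] by blast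
  define p where "p = char_poly (mat_of h vs)"
  have dp: "degree p = length vs" "poly.coeff p (length vs) = 1"
    using degree_monic_char_poly[OF mat_of_carrier[of h vs]] by (simp_all add: p_def)
  then have p0: "p \<noteq> 0" by auto
  have sub: "M \<subseteq> {x. poly p x = 0}" using M ev_root[OF vs(2)] vs(1) by (auto simp: p_def)
  have fin: "finite {x. poly p x = 0}" by (rule poly_roots_finite[OF p0])
  have "card M \<le> card {x. poly p x = 0}" by (rule card_mono[OF fin sub])
  also have "\<dots> \<le> degree p" by (rule card_poly_roots_bound[OF p0])
  also have "\<dots> = card S" using dp(1) vs distinct_card by metis
  finally show ?thesis using finite_subset[OF sub fin] by blast
qed

lemma monic_prod_roots:
  fixes p :: "complex poly"
  assumes "degree p = n" "poly.coeff p n = 1" "finite M" "card M = n" "\<And>\<mu>. \<mu> \<in> M \<Longrightarrow> poly p \<mu> = 0"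
  shows "p = (\<Prod>\<mu>\<in>M. [:-\<mu>, 1:])"
proof (rule poly_eqI_degree_lead_coeff)
  have d: "degree (\<Prod>\<mu>\<in>M. [:-\<mu>, 1:]) = n"
    by (subst degree_prod_eq_sum_degree) (use assms(4) in auto)
  have "lead_coeff (\<Prod>\<mu>\<in>M. [:-\<mu>, 1:]) = 1"
    by (simp add: lead_coeff_prod)
  then show "poly.coeff p n = poly.coeff (\<Prod>\<mu>\<in>M. [:-\<mu>, 1:]) n" using assms(2) d by simp
  show "degree p \<le> n" "degree (\<Prod>\<mu>\<in>M. [:-\<mu>, 1:]) \<le> n" using d assms(1) by simp_all
  show "n \<le> card M" using assms(4) by simp
  show "poly p z = poly (\<Prod>\<mu>\<in>M. [:-\<mu>, 1:]) z" if "z \<in> M" for z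
    using assms(3,5) that by (auto simp: poly_prod)
qed

lemma char_poly_prod:
  assumes "distinct vs" "finite M" "card M = length vs" "\<And>\<mu>. \<mu> \<in> M \<Longrightarrow> ev h (set vs) \<mu>"
  shows "char_poly (mat_of h vs) = (\<Prod>\<mu>\<in>M. [:-\<mu>, 1:])"
  using degree_monic_char_poly[OF mat_of_carrier[of h vs]] assms ev_root[OF assms(1)]
  by (intro monic_prod_roots) auto

section \<open>Integrality of characteristic polynomials and determinants\<close>

definition gpoly :: "complex poly \<Rightarrow> bool" where
  "gpoly p \<longleftrightarrow> (\<forall>i. poly.coeff p i \<in> gint)"

lemma gpoly_sum: "(\<And>x. x \<in> A \<Longrightarrow> gpoly (f x)) \<Longrightarrow> gpoly (sum f A)"
  by (auto simp: gpoly_def Polynomial.coeff_sum intro: gint_sum)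

lemma gpoly_mult: "gpoly p \<Longrightarrow> gpoly q \<Longrightarrow> gpoly (p * q)"
  by (auto simp: gpoly_def coeff_mult intro: gint_sum)

lemma gpoly_prod: "(\<And>x. x \<in> A \<Longrightarrow> gpoly (f x)) \<Longrightarrow> gpoly (prod f A)"
proof (induction A rule: infinite_finite_induct)
  case (insert x F)
  then show ?case by (simp add: gpoly_mult)
qed (simp_all add: gpoly_def)

lemma gpoly_char_poly:
  assumes "A \<in> carrier_mat n n" "\<And>i j. i < n \<Longrightarrow> j < n \<Longrightarrow> A $$ (i, j) \<in> gint"
  shows "gpoly (char_poly A)"
proof -
  have m: "char_poly_matrix A \<in> carrier_mat n n" using assms(1) by simp
  have e: "gpoly (char_poly_matrix A $$ (i, j))" if "i < n" "j < n" for i j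
    using assms(1) assms(2)[OF that] that
    by (auto simp: char_poly_matrix_def gpoly_def coeff_pCons split: nat.split)
  have s: "gpoly (signof p)" for p :: "nat \<Rightarrow> nat"
    by (simp add: sign_def gpoly_def coeff_1)
  show ?thesis
    unfolding char_poly_def det_def'[OF m]
    by (intro gpoly_sum gpoly_mult gpoly_prod s e) (auto dest: permutes_in_image)
qed

lemma gint_det:
  assumes "A \<in> carrier_mat n n" "\<And>i j. i < n \<Longrightarrow> j < n \<Longrightarrow> A $$ (i, j) \<in> gint"
  shows "det A \<in> gint"
proof -
  have s: "(signof p :: complex) \<in> gint" for p :: "nat \<Rightarrow> nat"
    by (simp add: sign_def)
  show ?thesis
    unfolding det_def'[OF assms(1)]
    by (intro gint_sum gint_mult gint_prod s assms(2)) (auto dest: permutes_in_image)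
qed

text \<open>Real coefficients that are also Gaussian integers are integers; this is how the
  characteristic polynomials become integral although the matrices contain \<i>.\<close>

lemma prod_real_coeff:
  assumes "\<And>\<mu>. \<mu> \<in> M \<Longrightarrow> \<mu> \<in> \<real>"
  shows "poly.coeff (\<Prod>\<mu>\<in>M. [:-\<mu>, 1:]) i \<in> (\<real> :: complex set)"
proof -
  have "(\<forall>\<mu>\<in>M. \<mu> \<in> \<real>) \<Longrightarrow> \<forall>i. poly.coeff (\<Prod>\<mu>\<in>M. [:-\<mu>, 1:]) i \<in> (\<real> :: complex set)"
  proof (induction M rule: infinite_finite_induct)
    case (insert x F)
    have "poly.coeff [:-x, 1:] i \<in> (\<real> :: complex set)" for i
      using insert.prems by (auto simp: coeff_pCons split: nat.split)
    then show ?case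
      using insert by (auto simp del: mult_pCons_left simp: coeff_mult intro!: sum_in_Reals Reals_mult)
  qed (auto simp: coeff_1)
  then show ?thesis using assms by blast
qed

lemma gint_real_int: "z \<in> gint \<Longrightarrow> z \<in> \<real> \<Longrightarrow> z \<in> \<int>"
  by (auto simp: gint_def complex_is_Real_iff elim!: Ints_cases) (metis Ints_of_int complex_eq_iff complex_Re_of_int complex_Im_of_int)

text \<open>A congruence of determinant 1 adds \<epsilon> times column \<open>b\<close> to column
  \<open>a\<close> and does the conjugate operation on the rows. Off the diagonal, row and column
  \<open>a\<close> become even, and their common entry is 4. A factor 2 comes out of the row and
  another out of the column, leaving \<open>K\<close> with diagonal entry 1 at
  \<open>a\<close>.\<close>

lemma det_twins:
  fixes A :: "complex mat"
  assumes A: "A \<in> carrier_mat n n" and int: "\<And>i j. i < n \<Longrightarrow> j < n \<Longrightarrow> A $$ (i, j) \<in> gint"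
    and herm: "\<And>i j. i < n \<Longrightarrow> j < n \<Longrightarrow> A $$ (j, i) = cnj (A $$ (i, j))"
    and ab: "a < n" "b < n" "a \<noteq> b" and e: "\<epsilon> \<in> gint"
    and tw: "\<And>w. w < n \<Longrightarrow> (A $$ (w, a) + \<epsilon> * A $$ (w, b)) / 2 \<in> gint"
    and four: "(A $$ (a, a) + \<epsilon> * A $$ (a, b)) + cnj \<epsilon> * (A $$ (b, a) + \<epsilon> * A $$ (b, b)) = 4"
  shows "det A / 4 \<in> gint"
proof -
  define A1 where "A1 = addcol \<epsilon> a b A"
  define A2 where "A2 = addrow (cnj \<epsilon>) a b A1"
  have c: "A1 \<in> carrier_mat n n" "A2 \<in> carrier_mat n n" using A by (auto simp: A1_def A2_def)
  have d: "det A2 = det A"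
    unfolding A2_def det_addrow[OF ab(2,3) c(1)] unfolding A1_def by (rule det_addcol[OF ab(2,3) A])
  have A1: "A1 $$ (i, j) = (if j = a then A $$ (i, a) + \<epsilon> * A $$ (i, b) else A $$ (i, j))" if "i < n" "j < n" for i j
    using that A by (auto simp: A1_def mat_addcol_def)
  have A2: "A2 $$ (i, j) = (if i = a then A1 $$ (a, j) + cnj \<epsilon> * A1 $$ (b, j) else A1 $$ (i, j))" if "i < n" "j < n" for i j
    using that c by (auto simp: A2_def mat_addrow_def)
  define K where "K = mat n n (\<lambda>(i, j). if i = a \<and> j = a then 1 else if i = a \<or> j = a then A2 $$ (i, j) / 2 else A2 $$ (i, j))"
  have K: "K \<in> carrier_mat n n" by (simp add: K_def)
  have "A2 = multrow a 2 (transpose_mat (multrow a 2 (transpose_mat K)))"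
  proof (rule eq_matI)
    fix i j assume "i < dim_row (multrow a 2 (transpose_mat (multrow a 2 (transpose_mat K))))"
      "j < dim_col (multrow a 2 (transpose_mat (multrow a 2 (transpose_mat K))))"
    then have ij: "i < n" "j < n" using K by auto
    have "A2 $$ (a, a) = 4" using A2[OF ab(1,1)] A1[OF ab(1,1)] A1[OF ab(2,1)] four by simp
    then show "A2 $$ (i, j) = multrow a 2 (transpose_mat (multrow a 2 (transpose_mat K))) $$ (i, j)"
      using ij K by (auto simp: K_def)
  qed (use K c in auto)
  then have "det A2 = 2 * (2 * det K)"
    using K ab(1) by (simp add: det_multrow[of _ n] det_transpose[of _ n])
  moreover have "det K \<in> gint"
  proof (rule gint_det[OF K])
    fix i j assume ij: "i < n" "j < n"
    have row: "A2 $$ (a, j) / 2 \<in> gint" if "j \<noteq> a" "j < n" for j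
    proof -
      have "A2 $$ (a, j) = cnj (A $$ (j, a) + \<epsilon> * A $$ (j, b))"
        using A2[OF ab(1) that(2)] A1[OF ab(1) that(2)] A1[OF ab(2) that(2)] that herm[OF that(2) ab(1)] herm[OF that(2) ab(2)] by simp
      then have "A2 $$ (a, j) / 2 = cnj ((A $$ (j, a) + \<epsilon> * A $$ (j, b)) / 2)" by simp
      then show ?thesis using tw[OF that(2)] gint_cnj by metis
    qed
    have col: "A2 $$ (i, a) / 2 \<in> gint" if "i \<noteq> a" "i < n" for i
      using A2[OF that(2) ab(1)] A1[OF that(2) ab(1)] tw[OF that(2)] that by simp
    have "A2 $$ (i, j) \<in> gint" if "i \<noteq> a" "j \<noteq> a"
      using A2[OF ij] A1[OF ij] int[OF ij] that by simp
    then show "K $$ (i, j) \<in> gint" using ij row col by (auto simp: K_def)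
  qed
  ultimately show ?thesis using d by simp
qed

text \<open>For \<open>1 \<le> j \<le> n\<close> these are the eigenvalues of the path on
  \<open>n\<close> vertices in decreasing order; the indices 0 and \<open>n + 1\<close> give 2 and
  -2.\<close>

definition ch :: "nat \<Rightarrow> nat \<Rightarrow> real" where
  "ch n j = 2 * cos (pi * real j / real (n + 1))"

section \<open>Hermitian gain graphs with simple spectrum\<close>

locale gain_graph =
  fixes V :: "'a set" and h :: "'a \<Rightarrow> 'a \<Rightarrow> complex"
  assumes finV: "finite V"
    and entry: "h u v \<in> insert 0 gunit"
    and herm: "h v u = cnj (h u v)"
    and loopless: "h u u = 0"
begin

lemma h_gint: "h u v \<in> gint"
  using entry[of u v] by auto

lemma h_nz_sym: "h u v \<noteq> 0 \<longleftrightarrow> h v u \<noteq> 0"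
  using herm[of u v] by auto

definition ip :: "('a \<Rightarrow> complex) \<Rightarrow> ('a \<Rightarrow> complex) \<Rightarrow> complex" where
  "ip x y = (\<Sum>u\<in>V. cnj (x u) * y u)"

lemma ip_self: "ip x x = of_real (\<Sum>u\<in>V. (cmod (x u))\<^sup>2)"
  unfolding ip_def of_real_sum complex_norm_square by (simp add: mult.commute)

lemma ip_sym: "ip y x = cnj (ip x y)"
  by (simp add: ip_def mult.commute)

lemma eigen_orth:
  assumes x: "\<And>u. u \<in> V \<Longrightarrow> (\<Sum>v\<in>V. h u v * x v) = lam * x u"
    and y: "\<And>u. u \<in> V \<Longrightarrow> (\<Sum>v\<in>V. h u v * y v) = \<mu> * y u"
    and r: "lam \<in> \<real>" and ne: "lam \<noteq> \<mu>"
  shows "ip x y = 0"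
proof -
  have "\<mu> * ip x y = (\<Sum>u\<in>V. cnj (x u) * (\<Sum>v\<in>V. h u v * y v))"
    using y by (simp add: ip_def sum_distrib_left mult_ac)
  also have "\<dots> = (\<Sum>u\<in>V. \<Sum>v\<in>V. cnj (x u) * h u v * y v)" by (simp add: sum_distrib_left mult_ac)
  also have "\<dots> = (\<Sum>v\<in>V. \<Sum>u\<in>V. cnj (x u) * h u v * y v)" by (rule sum.swap)
  also have "\<dots> = (\<Sum>v\<in>V. cnj (\<Sum>u\<in>V. h v u * x u) * y v)"
  proof (intro sum.cong refl)
    fix v
    have "cnj (h v u) = h u v" for u using herm[of u v] by simp
    then show "(\<Sum>u\<in>V. cnj (x u) * h u v * y v) = cnj (\<Sum>u\<in>V. h v u * x u) * y v"
      by (simp add: sum_distrib_left sum_distrib_right mult_ac)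
  qed
  also have "\<dots> = cnj lam * ip x y"
    using x by (simp add: ip_def sum_distrib_left mult_ac)
  also have "cnj lam = lam" using r by (simp add: Reals_cnj_iff)
  finally show ?thesis using ne by simp
qed

text \<open>The matrix with columns \<open>y j\<close> has its conjugate transpose as left inverse;
  for a square matrix that is also a right inverse.\<close>

lemma orthonormal_complete:
  fixes y :: "nat \<Rightarrow> 'a \<Rightarrow> complex"
  assumes on: "\<And>i j. i < card V \<Longrightarrow> j < card V \<Longrightarrow> ip (y i) (y j) = (if i = j then 1 else 0)"
    and uw: "u \<in> V" "w \<in> V"
  shows "(\<Sum>j<card V. y j u * cnj (y j w)) = (if u = w then 1 else 0)"
proof -
  obtain vs where vs: "set vs = V" "distinct vs" using finite_distinct_list[OF finV] by blast
  have n: "card V = length vs" using vs distinct_card by metis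
  let ?n = "length vs"
  define P where "P = mat ?n ?n (\<lambda>(i, j). cnj (y i (vs ! j)))"
  define Q where "Q = mat ?n ?n (\<lambda>(i, j). y j (vs ! i))"
  have PQ: "P * Q = 1\<^sub>m ?n"
  proof (rule eq_matI)
    fix i j assume "i < dim_row (1\<^sub>m ?n)" "j < dim_col (1\<^sub>m ?n)"
    then have ij: "i < ?n" "j < ?n" by auto
    have "(P * Q) $$ (i, j) = (\<Sum>k<?n. cnj (y i (vs ! k)) * y j (vs ! k))"
      using ij by (simp add: P_def Q_def scalar_prod_def atLeast0LessThan)
    also have "\<dots> = (\<Sum>v\<in>set vs. cnj (y i v) * y j v)" by (rule sum_nth[OF vs(2), symmetric])
    also have "\<dots> = ip (y i) (y j)" by (simp add: ip_def vs(1))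
    finally show "(P * Q) $$ (i, j) = 1\<^sub>m ?n $$ (i, j)" using on ij n by simp
  qed (auto simp: P_def Q_def)
  have QP: "Q * P = 1\<^sub>m ?n"
    by (rule mat_mult_left_right_inverse[OF _ _ PQ]) (auto simp: P_def Q_def)
  obtain a b where ab: "a < ?n" "b < ?n" "u = vs ! a" "w = vs ! b"
    using uw vs(1) by (metis in_set_conv_nth)
  have "(Q * P) $$ (a, b) = (\<Sum>k<?n. y k u * cnj (y k w))"
    using ab by (simp add: P_def Q_def scalar_prod_def atLeast0LessThan)
  then show ?thesis using QP ab n vs(2) by (simp add: nth_eq_iff_index_eq)
qed

text \<open>The \<open>ch n j\<close> are distinct and as many as the vertices, so listing them as
  eigenvalues fixes the spectrum with multiplicities.\<close>

definition pathspec :: "nat \<Rightarrow> bool" where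
  "pathspec n \<longleftrightarrow> card V = n \<and> (\<forall>j. 1 \<le> j \<and> j \<le> n \<longrightarrow> ev h V (of_real (ch n j)))"

text \<open>As many distinct real eigenvalues as vertices yield an orthonormal eigenbasis directly,
  since eigenvectors of different eigenvalues are orthogonal. It diagonalises the scalar product and
  the form of \<open>h\<close> simultaneously.\<close>

lemma spectral:
  fixes lam :: "nat \<Rightarrow> real"
  assumes ev: "\<And>j. j < card V \<Longrightarrow> ev h V (of_real (lam j))" and inj: "inj_on lam {..<card V}"
  obtains y where
    "\<And>a b. ip a b = (\<Sum>j<card V. cnj (ip (y j) a) * ip (y j) b)"
    "\<And>a b. (\<Sum>u\<in>V. \<Sum>v\<in>V. cnj (a u) * h u v * b v) = (\<Sum>j<card V. of_real (lam j) * (cnj (ip (y j) a) * ip (y j) b))"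
proof -
  let ?n = "card V"
  have "\<exists>x. (\<exists>u\<in>V. x u \<noteq> 0) \<and> (\<forall>u\<in>V. (\<Sum>v\<in>V. h u v * x v) = of_real (lam j) * x u)" if "j < ?n" for j
    using ev[OF that] by (simp add: ev_def)
  then obtain x where x: "\<And>j. j < ?n \<Longrightarrow> \<exists>u\<in>V. x j u \<noteq> 0"
      "\<And>j u. j < ?n \<Longrightarrow> u \<in> V \<Longrightarrow> (\<Sum>v\<in>V. h u v * x j v) = of_real (lam j) * x j u"
    by metis
  define N where "N j = (\<Sum>u\<in>V. (cmod (x j u))\<^sup>2)" for j
  have N: "N j > 0" if j: "j < ?n" for j
  proof -
    obtain u where "u \<in> V" "x j u \<noteq> 0" using x(1)[OF j] by blast
    then show ?thesis unfolding N_def using finV by (intro sum_pos2[of V u]) auto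
  qed
  define y where "y j u = of_real (1 / sqrt (N j)) * x j u" for j u
  have yy: "ip (y i) (y j) = of_real (1 / sqrt (N i)) * of_real (1 / sqrt (N j)) * ip (x i) (x j)" for i j
    by (simp add: ip_def y_def sum_distrib_left sum_divide_distrib mult_ac)
  have on: "ip (y i) (y j) = (if i = j then 1 else 0)" if ij: "i < ?n" "j < ?n" for i j
  proof (cases "i = j")
    case True
    have "of_real (1 / sqrt (N j)) * of_real (1 / sqrt (N j)) * of_real (N j) = (1 :: complex)"
      using N[OF ij(2)] by (simp flip: of_real_mult)
    then show ?thesis using True unfolding yy by (simp only: ip_self N_def simp_thms if_True)
  next
    case False
    then have "lam i \<noteq> lam j" using inj ij by (auto simp: inj_on_def)
    then have "ip (x i) (x j) = 0"
      by (intro eigen_orth[OF x(2)[OF ij(1)] x(2)[OF ij(2)]]) auto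
    then show ?thesis using False by (simp add: yy)
  qed
  have ye: "(\<Sum>v\<in>V. h u v * y j v) = of_real (lam j) * y j u" if "j < ?n" "u \<in> V" for j u
  proof -
    have "(\<Sum>v\<in>V. h u v * y j v) = of_real (1 / sqrt (N j)) * (\<Sum>v\<in>V. h u v * x j v)"
      by (simp add: y_def sum_distrib_left sum_divide_distrib mult_ac)
    then show ?thesis unfolding x(2)[OF that] by (simp add: y_def)
  qed
  have ex: "b u = (\<Sum>j<?n. y j u * ip (y j) b)" if u: "u \<in> V" for b u
  proof -
    have "(\<Sum>j<?n. y j u * ip (y j) b) = (\<Sum>j<?n. \<Sum>w\<in>V. (y j u * cnj (y j w)) * b w)"
      by (simp add: ip_def sum_distrib_left mult.assoc)
    also have "\<dots> = (\<Sum>w\<in>V. (\<Sum>j<?n. y j u * cnj (y j w)) * b w)"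
      by (subst sum.swap) (simp add: sum_distrib_right)
    also have "\<dots> = (\<Sum>w\<in>V. if u = w then b w else 0)"
      using orthonormal_complete[OF on u] by (intro sum.cong) auto
    also have "\<dots> = b u" using u finV by simp
    finally show ?thesis ..
  qed
  have "ip a b = (\<Sum>j<?n. cnj (ip (y j) a) * ip (y j) b)" for a b
  proof -
    have "ip a b = (\<Sum>u\<in>V. cnj (a u) * (\<Sum>j<?n. y j u * ip (y j) b))"
      unfolding ip_def[of a b] by (intro sum.cong refl) (use ex in metis)
    also have "\<dots> = (\<Sum>u\<in>V. \<Sum>j<?n. cnj (a u) * y j u * ip (y j) b)"
      by (simp add: sum_distrib_left mult.assoc)
    also have "\<dots> = (\<Sum>j<?n. \<Sum>u\<in>V. cnj (a u) * y j u * ip (y j) b)" by (rule sum.swap)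
    also have "\<dots> = (\<Sum>j<?n. ip a (y j) * ip (y j) b)" by (simp add: ip_def[of a] sum_distrib_right)
    also have "\<dots> = (\<Sum>j<?n. cnj (ip (y j) a) * ip (y j) b)" by (intro sum.cong refl) (simp add: ip_sym[of a])
    finally show ?thesis .
  qed
  moreover have "(\<Sum>u\<in>V. \<Sum>v\<in>V. cnj (a u) * h u v * b v) = (\<Sum>j<?n. of_real (lam j) * (cnj (ip (y j) a) * ip (y j) b))" for a b
  proof -
    have *: "(\<Sum>v\<in>V. h u v * b v) = (\<Sum>j<?n. of_real (lam j) * y j u * ip (y j) b)" if u: "u \<in> V" for u
    proof -
      have "(\<Sum>v\<in>V. h u v * b v) = (\<Sum>v\<in>V. h u v * (\<Sum>j<?n. y j v * ip (y j) b))"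
        by (intro sum.cong refl) (use ex in metis)
      also have "\<dots> = (\<Sum>v\<in>V. \<Sum>j<?n. h u v * y j v * ip (y j) b)"
        by (simp add: sum_distrib_left mult.assoc)
      also have "\<dots> = (\<Sum>j<?n. \<Sum>v\<in>V. h u v * y j v * ip (y j) b)" by (rule sum.swap)
      also have "\<dots> = (\<Sum>j<?n. (\<Sum>v\<in>V. h u v * y j v) * ip (y j) b)" by (simp add: sum_distrib_right)
      also have "\<dots> = (\<Sum>j<?n. of_real (lam j) * y j u * ip (y j) b)" using ye[OF _ u] by (intro sum.cong) auto
      finally show ?thesis .
    qed
    have "(\<Sum>u\<in>V. \<Sum>v\<in>V. cnj (a u) * h u v * b v) = (\<Sum>u\<in>V. \<Sum>j<?n. of_real (lam j) * (cnj (a u) * y j u) * ip (y j) b)"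
    proof (intro sum.cong refl)
      fix u assume u: "u \<in> V"
      have "(\<Sum>v\<in>V. cnj (a u) * h u v * b v) = cnj (a u) * (\<Sum>v\<in>V. h u v * b v)"
        by (simp add: sum_distrib_left mult.assoc)
      then show "(\<Sum>v\<in>V. cnj (a u) * h u v * b v) = (\<Sum>j<?n. of_real (lam j) * (cnj (a u) * y j u) * ip (y j) b)"
        unfolding *[OF u] by (simp add: sum_distrib_left mult_ac)
    qed
    also have "\<dots> = (\<Sum>j<?n. \<Sum>u\<in>V. of_real (lam j) * (cnj (a u) * y j u) * ip (y j) b)" by (rule sum.swap)
    also have "\<dots> = (\<Sum>j<?n. of_real (lam j) * (ip a (y j) * ip (y j) b))"
      by (simp add: ip_def[of a] sum_distrib_right sum_distrib_left mult.assoc)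
    also have "\<dots> = (\<Sum>j<?n. of_real (lam j) * (cnj (ip (y j) a) * ip (y j) b))"
      by (intro sum.cong refl) (simp add: ip_sym[of a])
    finally show ?thesis .
  qed
  ultimately show thesis by (rule that)
qed

text \<open>Definiteness of the Gram matrix of the double cover, with \<open>a\<close> and
  \<open>b\<close> the parts of a vector on the two sheets. In an eigenbasis it is the inequality of
  the means, made strict by \<open>\<bar>lam j\<bar> < 2\<close>.\<close>

lemma cover_pd:
  fixes lam :: "nat \<Rightarrow> real"
  assumes ev: "\<And>j. j < card V \<Longrightarrow> ev h V (of_real (lam j))" and inj: "inj_on lam {..<card V}"
    and bound: "\<And>j. j < card V \<Longrightarrow> \<bar>lam j\<bar> < 2"
    and nz: "\<exists>u\<in>V. a u \<noteq> 0 \<or> b u \<noteq> 0"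
  shows "\<bar>Re (\<Sum>u\<in>V. \<Sum>v\<in>V. cnj (a u) * h u v * b v)\<bar> < (\<Sum>u\<in>V. (cmod (a u))\<^sup>2) + (\<Sum>u\<in>V. (cmod (b u))\<^sup>2)"
proof -
  let ?n = "card V"
  obtain y where y: "\<And>a b. ip a b = (\<Sum>j<?n. cnj (ip (y j) a) * ip (y j) b)"
    "\<And>a b. (\<Sum>u\<in>V. \<Sum>v\<in>V. cnj (a u) * h u v * b v) = (\<Sum>j<?n. of_real (lam j) * (cnj (ip (y j) a) * ip (y j) b))"
    using spectral[OF ev inj] by blast
  define A where "A j = ip (y j) a" for j
  define C where "C j = ip (y j) b" for j
  have sa: "(\<Sum>u\<in>V. (cmod (c u))\<^sup>2) = (\<Sum>j<?n. (cmod (ip (y j) c))\<^sup>2)" for c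
  proof -
    have "complex_of_real (\<Sum>u\<in>V. (cmod (c u))\<^sup>2) = ip c c" by (simp only: ip_self)
    also have "\<dots> = (\<Sum>j<?n. cnj (ip (y j) c) * ip (y j) c)" by (rule y(1))
    also have "\<dots> = of_real (\<Sum>j<?n. (cmod (ip (y j) c))\<^sup>2)"
      unfolding of_real_sum complex_norm_square by (simp add: mult.commute)
    finally show ?thesis by (simp only: of_real_eq_iff)
  qed
  have ex: "\<exists>j<?n. A j \<noteq> 0 \<or> C j \<noteq> 0"
  proof (rule ccontr)
    assume "\<not> ?thesis"
    then have "(\<Sum>u\<in>V. (cmod (a u))\<^sup>2) = 0" "(\<Sum>u\<in>V. (cmod (b u))\<^sup>2) = 0"
      unfolding sa by (auto simp: A_def C_def)
    then show False using nz finV by (auto simp: sum_nonneg_eq_0_iff)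
  qed
  have am: "2 * (cmod (A j) * cmod (C j)) \<le> (cmod (A j))\<^sup>2 + (cmod (C j))\<^sup>2" for j
    using sum_squares_bound[of "cmod (A j)" "cmod (C j)"] by (simp add: mult.assoc)
  have "\<bar>Re (\<Sum>u\<in>V. \<Sum>v\<in>V. cnj (a u) * h u v * b v)\<bar> \<le> cmod (\<Sum>j<?n. of_real (lam j) * (cnj (A j) * C j))"
    unfolding y(2) A_def C_def by (rule abs_Re_le_cmod)
  also have "\<dots> \<le> (\<Sum>j<?n. cmod (of_real (lam j) * (cnj (A j) * C j)))" by (rule norm_sum)
  also have "\<dots> = (\<Sum>j<?n. \<bar>lam j\<bar> * (cmod (A j) * cmod (C j)))" by (simp add: norm_mult)
  also have "\<dots> < (\<Sum>j<?n. (cmod (A j))\<^sup>2 + (cmod (C j))\<^sup>2)"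
  proof (rule sum_strict_mono_ex1)
    show "\<forall>j\<in>{..<?n}. \<bar>lam j\<bar> * (cmod (A j) * cmod (C j)) \<le> (cmod (A j))\<^sup>2 + (cmod (C j))\<^sup>2"
    proof
      fix j assume j: "j \<in> {..<?n}"
      have "\<bar>lam j\<bar> * (cmod (A j) * cmod (C j)) \<le> 2 * (cmod (A j) * cmod (C j))"
        using bound[of j] j by (intro mult_right_mono) auto
      then show "\<bar>lam j\<bar> * (cmod (A j) * cmod (C j)) \<le> (cmod (A j))\<^sup>2 + (cmod (C j))\<^sup>2" using am[of j] by linarith
    qed
    obtain j where j: "j < ?n" "A j \<noteq> 0 \<or> C j \<noteq> 0" using ex by blast
    have "\<bar>lam j\<bar> * (cmod (A j) * cmod (C j)) < (cmod (A j))\<^sup>2 + (cmod (C j))\<^sup>2"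
    proof (cases "A j = 0 \<or> C j = 0")
      case True
      then show ?thesis using j(2) by (auto intro: add_pos_nonneg add_nonneg_pos)
    next
      case False
      then have "\<bar>lam j\<bar> * (cmod (A j) * cmod (C j)) < 2 * (cmod (A j) * cmod (C j))"
        using bound[OF j(1)] by (intro mult_strict_right_mono) auto
      then show ?thesis using am[of j] by linarith
    qed
    then show "\<exists>j\<in>{..<?n}. \<bar>lam j\<bar> * (cmod (A j) * cmod (C j)) < (cmod (A j))\<^sup>2 + (cmod (C j))\<^sup>2" using j(1) by blast
  qed simp
  also have "\<dots> = (\<Sum>u\<in>V. (cmod (a u))\<^sup>2) + (\<Sum>u\<in>V. (cmod (b u))\<^sup>2)"
    unfolding sa sum.distrib A_def C_def ..
  finally show ?thesis .
qed

end

subsection \<open>Chebyshev polynomials and Galois conjugation\<close>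

definition ieval :: "int poly \<Rightarrow> complex \<Rightarrow> complex" where
  "ieval f z = poly (map_poly of_int f) z"

lemma ieval_simps [simp]:
  "ieval 0 z = 0" "ieval 1 z = 1" "ieval (f + g) z = ieval f z + ieval g z"
  "ieval (f - g) z = ieval f z - ieval g z" "ieval (f * g) z = ieval f z * ieval g z"
  "ieval (pCons a f) z = of_int a + z * ieval f z" "ieval (of_nat k) z = of_nat k"
  "ieval (- f) z = - ieval f z" "ieval (f ^ k) z = ieval f z ^ k"
  by (simp_all add: ieval_def of_int_poly_hom.hom_add of_int_poly_hom.hom_mult of_int_poly_hom.hom_minus
      of_int_poly_hom.hom_uminus of_int_hom.map_poly_pCons_hom of_int_poly_hom.hom_of_nat of_int_poly_hom.hom_power)

lemma ieval_numeral [simp]: "ieval (numeral k) z = numeral k"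
  by (metis ieval_simps(7) of_nat_numeral)

text \<open>The Chebyshev polynomial of the second kind at x / 2, which is monic and integral; it is
  the characteristic polynomial of a path.\<close>

fun cheb :: "nat \<Rightarrow> int poly" where
  "cheb 0 = 1"
| "cheb (Suc 0) = [:0, 1:]"
| "cheb (Suc (Suc n)) = [:0, 1:] * cheb (Suc n) - cheb n"

lemma cheb_degree: "degree (cheb n) = n \<and> lead_coeff (cheb n) = 1"
proof (induction n rule: cheb.induct)
  case (3 n)
  have d: "degree ([:0, 1:] * cheb (Suc n)) = Suc (Suc n)"
    using 3 by (subst degree_mult_eq) auto
  then have "degree (cheb (Suc (Suc n))) = Suc (Suc n)"
    using 3 by (simp only: cheb.simps(3) diff_conv_add_uminus) (subst degree_add_eq_left, auto)
  moreover have "poly.coeff (cheb n) (Suc (Suc n)) = 0" using 3 by (intro coeff_eq_0) auto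
  moreover have "poly.coeff (cheb (Suc n)) (Suc n) = 1" using 3 by auto
  ultimately show ?case by (simp add: coeff_pCons)
qed auto

lemma cheb_sin: "ieval (cheb n) (of_real (2 * cos t)) * of_real (sin t) = of_real (sin ((real n + 1) * t))"
proof (induction n rule: cheb.induct)
  case 2
  have "sin ((real (Suc 0) + 1) * t) = 2 * cos t * sin t" using sin_double[of t] by (simp add: mult_ac)
  then have "complex_of_real (sin ((real (Suc 0) + 1) * t)) = of_real (2 * cos t) * of_real (sin t)"
    by (simp only: of_real_mult)
  then show ?case by simp
next
  case (3 n)
  have "sin ((real n + 3) * t) = 2 * cos t * sin ((real n + 2) * t) - sin ((real n + 1) * t)"
    using sin_add[of "(real n + 2) * t" t] sin_diff[of "(real n + 2) * t" t] by (simp add: algebra_simps)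
  then have e: "complex_of_real (sin ((real n + 3) * t)) =
      of_real (2 * cos t) * of_real (sin ((real n + 2) * t)) - of_real (sin ((real n + 1) * t))"
    by (simp only: of_real_mult of_real_diff)
  have "ieval (cheb (Suc (Suc n))) (of_real (2 * cos t)) * of_real (sin t) =
      of_real (2 * cos t) * (ieval (cheb (Suc n)) (of_real (2 * cos t)) * of_real (sin t)) -
      ieval (cheb n) (of_real (2 * cos t)) * of_real (sin t)"
    by (simp add: algebra_simps)
  also have "\<dots> = of_real (sin ((real n + 3) * t))"
    unfolding 3 e by (simp add: add.commute)
  finally show ?case by (simp add: add.commute)
qed auto

text \<open>Needed at a root of \<open>cheb (Suc n)\<close>, where the square of
  \<open>cheb n\<close> must be 1.\<close>

lemma cheb_square: "(cheb (Suc n))\<^sup>2 - [:0, 1:] * cheb (Suc n) * cheb n + (cheb n)\<^sup>2 = 1"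
proof (induction n)
  case (Suc n)
  define X where "X = [:0, 1 :: int:]"
  have "(X * cheb (Suc n) - cheb n)\<^sup>2 - X * (X * cheb (Suc n) - cheb n) * cheb (Suc n) + (cheb (Suc n))\<^sup>2 =
    (cheb (Suc n))\<^sup>2 - X * cheb (Suc n) * cheb n + (cheb n)\<^sup>2"
    by (simp add: power2_eq_square algebra_simps)
  moreover have "cheb (Suc (Suc n)) = X * cheb (Suc n) - cheb n" by (simp add: X_def)
  ultimately show ?case using Suc unfolding X_def[symmetric] by simp
qed (simp add: power2_eq_square)

text \<open>At a root of \<open>cheb (Suc n)\<close> the first term vanishes, and with
  \<open>cheb_square\<close> the right-hand side is \<plusminus>2 (n + 2). Hence only primes
  dividing \<open>2 * (n + 2)\<close> could spoil the Galois argument.\<close>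

lemma cheb_pderiv:
  "([:4, 0, -1:]) * pderiv (cheb (Suc n)) = - of_nat (n + 1) * [:0, 1:] * cheb (Suc n) + 2 * of_nat (n + 2) * cheb n"
proof (induction n rule: less_induct)
  case (less n)
  define X where "X = [:0, 1 :: int:]"
  have Q: "[:4, 0, -1:] = 4 - X\<^sup>2" by (simp add: X_def power2_eq_square numeral_poly)
  have dX: "pderiv X = 1" by (simp add: X_def pderiv_pCons)
  consider "n = 0" | "n = 1" | m where "n = Suc (Suc m)" by (metis One_nat_def not0_implies_Suc)
  then show ?case
  proof cases
    case 1
    then show ?thesis by (simp add: pderiv_pCons numeral_poly)
  next
    case 2
    then show ?thesis by (simp add: pderiv_pCons pderiv_mult pderiv_diff numeral_poly one_pCons)
  next
    case 3
    define a where "a = cheb (Suc (Suc m))"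
    define b where "b = cheb (Suc m)"
    have c: "cheb (Suc n) = X * a - b" "cheb n = a" using 3 by (simp_all add: X_def a_def b_def)
    have bm: "cheb m = X * b - a" by (simp add: X_def a_def b_def)
    have i1: "(4 - X\<^sup>2) * pderiv a = - of_nat (m + 2) * X * a + 2 * of_nat (m + 3) * b"
      using less.IH[of "Suc m"] 3 unfolding Q X_def[symmetric] a_def b_def by (simp add: add.commute)
    have i2: "(4 - X\<^sup>2) * pderiv b = - of_nat (m + 1) * X * b + 2 * of_nat (m + 2) * cheb m"
      using less.IH[of m] 3 unfolding Q X_def[symmetric] a_def b_def by (simp add: add.commute)
    have "(4 - X\<^sup>2) * pderiv (X * a - b) = (4 - X\<^sup>2) * a + X * ((4 - X\<^sup>2) * pderiv a) - (4 - X\<^sup>2) * pderiv b"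
      by (simp add: pderiv_diff pderiv_mult dX algebra_simps)
    also have "\<dots> = - of_nat (m + 3) * X * (X * a - b) + 2 * of_nat (m + 4) * a"
      unfolding i1 i2 bm by (simp add: algebra_simps power2_eq_square)
    finally show ?thesis unfolding Q c X_def[symmetric] using 3 by (simp add: add.commute)
  qed
qed

text \<open>Multiplication by \<open>ieval s z\<close> maps each power of \<open>z\<close> to an
  integer combination of powers, with exponents read modulo \<open>M\<close>. So the number is an
  eigenvalue of an integer matrix, with the vector of powers as eigenvector.\<close>

lemma ieval_root_unity_algebraic_int:
  assumes z: "z ^ M = 1" "0 < M"
  shows "algebraic_int (ieval s z)"
proof -
  define A :: "int mat" where "A = mat M M (\<lambda>(i, j). \<Sum>k\<le>degree s. if (i + k) mod M = j then poly.coeff s k else 0)"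
  have A: "A \<in> carrier_mat M M" by (simp add: A_def)
  define v where "v = vec M (\<lambda>i. z ^ i)"
  have zm: "z ^ (k mod M) = z ^ k" for k
  proof -
    have "z ^ k = z ^ (M * (k div M) + k mod M)" by simp
    also have "\<dots> = z ^ (k mod M)" unfolding power_add power_mult using z by simp
    finally show ?thesis by simp
  qed
  have "map_mat of_int A *\<^sub>v v = ieval s z \<cdot>\<^sub>v v"
  proof (rule eq_vecI)
    fix i assume "i < dim_vec (ieval s z \<cdot>\<^sub>v v)"
    then have i: "i < M" by (simp add: v_def)
    have "(map_mat of_int A *\<^sub>v v) $ i = (\<Sum>j<M. (\<Sum>k\<le>degree s. if (i + k) mod M = j then of_int (poly.coeff s k) else 0) * z ^ j)"
      using i by (simp add: A_def v_def scalar_prod_def atLeast0LessThan if_distrib cong: if_cong)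
    also have "\<dots> = (\<Sum>j<M. \<Sum>k\<le>degree s. if (i + k) mod M = j then of_int (poly.coeff s k) * z ^ j else 0)"
      unfolding sum_distrib_right by (intro sum.cong) auto
    also have "\<dots> = (\<Sum>k\<le>degree s. \<Sum>j<M. if (i + k) mod M = j then of_int (poly.coeff s k) * z ^ j else 0)"
      by (rule sum.swap)
    also have "\<dots> = (\<Sum>k\<le>degree s. of_int (poly.coeff s k) * z ^ (i + k))"
      using z(2) by (intro sum.cong) (auto simp: zm)
    also have "\<dots> = ieval s z * z ^ i"
      by (simp add: ieval_def poly_altdef sum_distrib_left power_add mult_ac)
    finally show "(map_mat of_int A *\<^sub>v v) $ i = (ieval s z \<cdot>\<^sub>v v) $ i" using i by (simp add: v_def)
  qed (simp add: A_def v_def)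
  moreover have "v \<noteq> 0\<^sub>v M"
  proof
    assume "v = 0\<^sub>v M"
    then have "v $ 0 = 0\<^sub>v M $ 0" by simp
    then show False using z(2) by (simp add: v_def)
  qed
  ultimately have "eigenvalue (map_mat of_int A) (ieval s z)"
    unfolding eigenvalue_def eigenvector_def using A by (intro exI[of _ v]) (auto simp: v_def)
  then have "poly (char_poly (map_mat of_int A)) (ieval s z) = 0"
    using eigenvalue_root_char_poly[of "map_mat of_int A :: complex mat" M] A by simp
  moreover have "char_poly (map_mat of_int A :: complex mat) = map_poly of_int (char_poly A)"
    by (rule of_int_hom.char_poly_hom[OF A])
  moreover have "lead_coeff (char_poly A) = 1" using degree_monic_char_poly[OF A] by simp
  ultimately show ?thesis unfolding algebraic_int_altdef_ipoly by (intro exI[of _ "char_poly A"]) auto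
qed

text \<open>The multiple of \<open>p\<close> is written out because its cofactor must be recognised
  as an element of a subring of the complex numbers.\<close>

lemma freshman_dvd:
  fixes x y :: "'a :: comm_ring_1"
  assumes "prime p"
  shows "(x + y) ^ p = x ^ p + y ^ p + of_nat p * (\<Sum>k\<in>{1..<p}. of_nat ((p choose k) div p) * x ^ k * y ^ (p - k))"
proof -
  have p0: "p > 0" using assms prime_gt_0_nat by blast
  have "(x + y) ^ p = (\<Sum>k\<le>p. of_nat (p choose k) * x ^ k * y ^ (p - k))" by (rule binomial_ring)
  also have "{..p} = insert 0 (insert p {1..<p})" using p0 by auto
  also have "(\<Sum>k\<in>insert 0 (insert p {1..<p}). of_nat (p choose k) * x ^ k * y ^ (p - k)) =
    y ^ p + (x ^ p + (\<Sum>k\<in>{1..<p}. of_nat (p choose k) * x ^ k * y ^ (p - k)))" using p0 by simp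
  also have "(\<Sum>k\<in>{1..<p}. of_nat (p choose k) * x ^ k * y ^ (p - k)) =
    of_nat p * (\<Sum>k\<in>{1..<p}. of_nat ((p choose k) div p) * x ^ k * y ^ (p - k))"
    unfolding sum_distrib_left
  proof (intro sum.cong refl)
    fix k assume k: "k \<in> {1..<p}"
    have "p dvd (p choose k)" using assms k by (intro dvd_choose_prime) auto
    then have "(p choose k) = p * ((p choose k) div p)" by simp
    then have "(of_nat (p choose k) :: 'a) = of_nat p * of_nat ((p choose k) div p)" by (metis of_nat_mult)
    then show "of_nat (p choose k) * x ^ k * y ^ (p - k) = of_nat p * (of_nat ((p choose k) div p) * x ^ k * y ^ (p - k))"
      by (simp add: mult.assoc)
  qed
  finally show ?thesis by (simp add: algebra_simps)
qed

lemma fermat_int: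
  fixes k :: int
  assumes "prime p"
  shows "[k ^ p = k] (mod int p)"
proof (cases "int p dvd k")
  case True
  moreover have "int p dvd k ^ p" using True assms prime_gt_0_nat[of p] by (intro dvd_power_same dvd_trans[OF True]) (auto intro: dvd_power)
  ultimately show ?thesis by (simp add: cong_iff_dvd_diff)
next
  case False
  define m where "m = nat (k mod int p)"
  have p0: "p > 0" using assms prime_gt_0_nat by blast
  have m: "int m = k mod int p" using p0 by (simp add: m_def)
  have km: "[int m = k] (mod int p)" by (simp add: m cong_def)
  have "\<not> p dvd m"
  proof
    assume "p dvd m"
    then have "int p dvd int m" by simp
    then have "int p dvd k" using km cong_dvd_iff by blast
    then show False using False by simp
  qed
  then have "[m ^ (p - 1) = 1] (mod p)" using fermat_theorem[OF assms] by blast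
  then have "[m ^ (p - 1) * m = 1 * m] (mod p)" by (rule cong_scalar_right)
  moreover have "m ^ (p - 1) * m = m ^ p" using p0 by (cases p) (auto simp: mult.commute)
  ultimately have "[m ^ p = m] (mod p)" by simp
  then have "[int m ^ p = int m] (mod int p)" by (metis cong_int_iff of_nat_power)
  then show ?thesis using km cong_pow[OF km] cong_trans cong_sym by meson
qed

text \<open>If \<open>f\<close> vanishes at \<open>2 cos \<theta>\<close> but not at \<open>2 cos (p \<theta>)\<close>, then the cofactor \<open>g\<close> vanishes at
  \<open>2 cos (p \<theta>)\<close>, so \<open>p\<close> divides \<open>g (2 cos \<theta>) ^ p\<close> in \<open>\<int>[\<zeta>]\<close> and hence, via the derivative
  of \<open>f * g\<close>, a power of \<open>2 (n + 2)\<close>.\<close>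

lemma cheb_galois_prime:
  assumes fg: "f * g = cheb (Suc n)" and p: "prime p" "\<not> p dvd 2 * (n + 2)"
    and t: "t = pi * real j / real (n + 2)" "ieval f (of_real (2 * cos t)) = 0"
    and r: "ieval (cheb (Suc n)) (of_real (2 * cos (real p * t))) = 0"
  shows "ieval f (of_real (2 * cos (real p * t))) = 0"
proof (rule ccontr)
  assume nz: "\<not> ?thesis"
  define \<zeta> where "\<zeta> = cis t"
  define M where "M = 2 * (n + 2)"
  \<comment> \<open>The ring generated by \<open>\<zeta>\<close>; it contains the conjugate of
    \<open>\<zeta>\<close>, which is a power of \<open>\<zeta>\<close>, and therefore
    \<open>2 cos t\<close>. The relation \<open>cg\<close> below is congruence modulo
    \<open>p\<close> in it.\<close>
  define R where "R = {z. \<exists>s. z = ieval s \<zeta>}"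
  have RI: "ieval s \<zeta> \<in> R" for s by (auto simp: R_def)
  have zM: "\<zeta> ^ M = 1"
  proof -
    have "real (n + 2) * t = pi * real j" using t(1) by (simp add: nonzero_eq_divide_eq mult.commute)
    then have "real M * t = 2 * pi * real j" unfolding M_def of_nat_mult by (simp add: algebra_simps)
    then have "\<zeta> ^ M = cis (2 * pi * real j)" unfolding \<zeta>_def DeMoivre by simp
    also have "\<dots> = 1" by (rule cis_multiple_2pi) simp
    finally show ?thesis .
  qed
  have M0: "M > 0" by (simp add: M_def)
  have Radd: "x + y \<in> R" and Rmult: "x * y \<in> R" if "x \<in> R" "y \<in> R" for x y
    using that unfolding R_def by (auto simp flip: ieval_simps)
  have Rint: "of_int k \<in> R" for k using RI[of "[:k:]"] by simp
  have Rnat: "of_nat k \<in> R" for k using Rint[of "int k"] by simp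
  have Rpow: "x ^ k \<in> R" if "x \<in> R" for x k
    by (induction k) (use that Rmult Rint[of 1] in auto)
  have Rminus: "- x \<in> R" if "x \<in> R" for x using Rmult[OF Rint[of "-1"] that] by simp
  have Rdiff: "x - y \<in> R" if "x \<in> R" "y \<in> R" for x y using Radd[OF that(1) Rminus[OF that(2)]] by simp
  have Rsum: "sum F A \<in> R" if "\<And>x. x \<in> A \<Longrightarrow> F x \<in> R" for F and A :: "nat set"
    using that by (induction A rule: infinite_finite_induct) (use Radd Rint[of 0] in auto)
  have Riev: "ieval s x \<in> R" if "x \<in> R" for s x
    by (induction s) (use that Radd Rmult Rint Rint[of 0] in auto)
  have zR: "\<zeta> \<in> R" using RI[of "[:0, 1:]"] by simp
  have cz: "cnj \<zeta> = \<zeta> ^ (M - 1)"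
  proof -
    have "\<zeta> * cnj \<zeta> = 1" by (simp add: \<zeta>_def cis_cnj cis_mult)
    moreover have "\<zeta> * \<zeta> ^ (M - 1) = 1" using zM M0 by (cases M) auto
    moreover have "\<zeta> \<noteq> 0" by (simp add: \<zeta>_def)
    ultimately show ?thesis by (metis mult_cancel_left)
  qed
  have czR: "cnj \<zeta> \<in> R" unfolding cz by (rule Rpow[OF zR])
  define a where "a = complex_of_real (2 * cos t)"
  have a: "a = \<zeta> + cnj \<zeta>" by (simp add: a_def \<zeta>_def complex_eq_iff)
  have aR: "a \<in> R" unfolding a by (rule Radd[OF zR czR])
  define a' where "a' = complex_of_real (2 * cos (real p * t))"
  have a': "a' = \<zeta> ^ p + cnj \<zeta> ^ p" by (simp add: a'_def \<zeta>_def DeMoivre cis_cnj complex_eq_iff)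
  define cg where "cg x y \<longleftrightarrow> (\<exists>r\<in>R. x - y = of_nat p * r)" for x y :: complex
  have cg_trans: "cg x z" if xy: "cg x y" "cg y z" for x y z
  proof -
    obtain r s where "r \<in> R" "s \<in> R" "x - y = of_nat p * r" "y - z = of_nat p * s"
      using xy by (auto simp: cg_def)
    then have "x - z = of_nat p * (r + s)" by (simp add: algebra_simps)
    then show ?thesis unfolding cg_def using Radd[OF \<open>r \<in> R\<close> \<open>s \<in> R\<close>] by blast
  qed
  have cg_add: "cg (x + x') (y + y')" if xy: "cg x y" "cg x' y'" for x y x' y'
  proof -
    obtain r s where "r \<in> R" "s \<in> R" "x - y = of_nat p * r" "x' - y' = of_nat p * s"
      using xy by (auto simp: cg_def)
    then have "x + x' - (y + y') = of_nat p * (r + s)" by (simp add: algebra_simps)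
    then show ?thesis unfolding cg_def using Radd[OF \<open>r \<in> R\<close> \<open>s \<in> R\<close>] by blast
  qed
  have cg_mult: "cg (x * x') (y * y')" if xy: "cg x y" "cg x' y'" and xR: "x' \<in> R" "y \<in> R" for x y x' y'
  proof -
    obtain r s where rs: "r \<in> R" "s \<in> R" "x - y = of_nat p * r" "x' - y' = of_nat p * s"
      using xy by (auto simp: cg_def)
    have "x * x' - y * y' = (x - y) * x' + y * (x' - y')" by (simp add: algebra_simps)
    also have "\<dots> = of_nat p * (r * x' + y * s)" unfolding rs by (simp add: algebra_simps)
    finally show ?thesis unfolding cg_def using Radd[OF Rmult[OF rs(1) xR(1)] Rmult[OF xR(2) rs(2)]] by blast
  qed
  have cg_refl: "cg x x" for x unfolding cg_def using Rint[of 0] by (intro bexI[of _ 0]) auto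
  have fresh: "cg ((x + y) ^ p) (x ^ p + y ^ p)" if "x \<in> R" "y \<in> R" for x y
  proof -
    have "(\<Sum>k\<in>{1..<p}. of_nat ((p choose k) div p) * x ^ k * y ^ (p - k)) \<in> R"
      using that by (intro Rsum Rmult Rnat Rpow)
    then show ?thesis unfolding cg_def freshman_dvd[OF p(1), of x y] by (intro bexI) auto
  qed
  have cg_sym: "cg y x" if "cg x y" for x y
  proof -
    obtain r where "r \<in> R" "x - y = of_nat p * r" using \<open>cg x y\<close> by (auto simp: cg_def)
    then have "y - x = of_nat p * (- r)" by (simp add: algebra_simps)
    then show ?thesis unfolding cg_def using Rminus[OF \<open>r \<in> R\<close>] by blast
  qed
  have aa: "cg a' (a ^ p)" unfolding a a' by (rule cg_sym[OF fresh[OF zR czR]])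
  have intp: "cg (of_int k) (of_int k ^ p)" for k
  proof -
    have "[k ^ p = k] (mod int p)"
      using fermat_int[OF p(1)] by simp
    then have "int p dvd k - k ^ p" by (metis cong_iff_dvd_diff cong_sym)
    then obtain l where "k - k ^ p = int p * l" by blast
    then have "of_int k - of_int k ^ p = (of_nat p * of_int l :: complex)"
      by (metis of_int_diff of_int_mult of_int_of_nat_eq of_int_power)
    then show ?thesis unfolding cg_def using Rint by blast
  qed
  have a'R: "a' \<in> R" unfolding a' by (intro Radd Rpow zR czR)
  \<comment> \<open>The Frobenius congruence: Fermat treats the integer coefficients, the binomial
    formula modulo \<open>p\<close> the sums.\<close>
  have frob: "cg (ieval s a') (ieval s a ^ p)" for s
  proof (induction s)
    case 0
    then show ?case using p(1) prime_gt_0_nat[of p] cg_refl by (simp add: power_0_left)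
  next
    case (pCons k s)
    have "cg (of_int k + a' * ieval s a') (of_int k ^ p + a ^ p * ieval s a ^ p)"
      by (intro cg_add cg_mult intp aa pCons Riev a'R Rpow aR)
    also have "of_int k ^ p + a ^ p * ieval s a ^ p = of_int k ^ p + (a * ieval s a) ^ p"
      by (simp add: power_mult_distrib)
    finally have "cg (of_int k + a' * ieval s a') (of_int k ^ p + (a * ieval s a) ^ p)" .
    from cg_trans[OF this cg_sym[OF fresh[OF Rint Rmult[OF aR Riev[OF aR]]]]] show ?case by simp
  qed
  have "ieval f a' * ieval g a' = 0" using r unfolding fg[symmetric] by (simp add: a'_def)
  then have ga: "ieval g a' = 0" using nz by (simp add: a'_def)
  obtain q where q: "q \<in> R" "ieval g a ^ p = of_nat p * q"
    using cg_sym[OF frob[of g]] unfolding ga cg_def by auto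
  have fa: "ieval f a = 0" using t(2) by (simp add: a_def)
  have S0: "ieval (cheb (Suc n)) a = 0" unfolding fg[symmetric] using fa by simp
  have sq: "(ieval (cheb n) a)\<^sup>2 = 1"
    using arg_cong[OF cheb_square[of n], of "\<lambda>f. ieval f a"] S0 by simp
  \<comment> \<open>Since \<open>f\<close> vanishes at \<open>a\<close>, the product rule leaves
    only the derivative of \<open>f\<close> times \<open>g\<close>, so \<open>ieval g a\<close>
    divides the value computed by \<open>cheb_pderiv\<close>.\<close>
  define d where "d = ieval ([:4, 0, -1:] * pderiv f) a"
  have "d * ieval g a = ieval ([:4, 0, -1:] * pderiv (cheb (Suc n))) a"
    unfolding d_def fg[symmetric] pderiv_mult ieval_simps(3,5) fa by (simp only: mult_zero_left add_0 mult_ac)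
  also have "\<dots> = 2 * of_nat (n + 2) * ieval (cheb n) a"
    unfolding cheb_pderiv ieval_simps(3,5,7) ieval_numeral S0 by simp
  finally have "(d * ieval g a)\<^sup>2 = (2 * of_nat (n + 2))\<^sup>2" by (simp add: power_mult_distrib sq)
  then have "((d * ieval g a)\<^sup>2) ^ p = of_nat ((2 * (n + 2))\<^sup>2) ^ p" by simp
  moreover have "((d * ieval g a)\<^sup>2) ^ p = d ^ (2 * p) * (ieval g a ^ p * ieval g a ^ p)"
    by (simp add: power_mult_distrib power_mult power2_eq_square mult_ac)
  ultimately have "of_nat ((2 * (n + 2))\<^sup>2) ^ p = d ^ (2 * p) * (ieval g a ^ p * (of_nat p * q))"
    by (simp only: q(2))
  then have c: "of_nat (((2 * (n + 2))\<^sup>2) ^ p) = of_nat p * (d ^ (2 * p) * q * (ieval g a ^ p))"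
    unfolding of_nat_power by (simp only: mult_ac)
  \<comment> \<open>An algebraic integer, being in \<open>R\<close>, and rational by
    \<open>c\<close>; hence an integer, so that \<open>p\<close> divides a power of
    \<open>2 * (n + 2)\<close>.\<close>
  define r where "r = d ^ (2 * p) * q * (ieval g a ^ p)"
  have "d \<in> R" unfolding d_def by (rule Riev[OF aR])
  then have "r \<in> R" unfolding r_def by (intro Rmult Rpow Riev aR q(1))
  then have "algebraic_int r" using ieval_root_unity_algebraic_int[OF zM M0] by (auto simp: R_def)
  moreover have p0: "(of_nat p :: complex) \<noteq> 0" using p(1) prime_gt_0_nat[of p] by simp
  have "r = of_nat (((2 * (n + 2))\<^sup>2) ^ p) / of_nat p"
    unfolding c r_def using p0 by simp
  then have "r \<in> \<rat>" by simp
  ultimately have "r \<in> \<int>" by (rule rational_algebraic_int_is_int)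
  then obtain k where "r = of_int k" by (auto elim: Ints_cases)
  then have "complex_of_int (int (((2 * (n + 2))\<^sup>2) ^ p)) = of_int (int p * k)"
    using c unfolding r_def[symmetric] by simp
  then have "int p dvd int (((2 * (n + 2))\<^sup>2) ^ p)" by (simp only: of_int_eq_iff) simp
  then have "p dvd ((2 * (n + 2))\<^sup>2) ^ p" by (simp only: int_dvd_int_iff)
  then have "p dvd 2 * (n + 2)" using prime_dvd_power[OF p(1)] by blast
  then show False using p(2) by simp
qed

text \<open>The index is not limited to \<open>n\<close>, because the Galois argument multiplies
  indices by primes; only multiples of \<open>n + 1\<close> have to be avoided.\<close>

lemma cheb_root:
  assumes "\<not> (n + 1) dvd j"
  shows "ieval (cheb n) (of_real (ch n j)) = 0"
proof -
  define t where "t = pi * real j / real (n + 1)"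
  have nt: "real (n + 1) * t = pi * real j"
    unfolding t_def times_divide_eq_right by (rule nonzero_mult_div_cancel_left) simp
  have "sin t \<noteq> 0"
  proof
    assume "sin t = 0"
    then obtain i where "t = of_int i * pi" unfolding sin_zero_iff_int2 by blast
    then have "pi * (real (n + 1) * of_int i) = pi * real j" using nt by (simp only: mult_ac)
    then have "real (n + 1) * of_int i = real j" by simp
    then have "real_of_int (int (n + 1) * i) = of_int (int j)" by (simp only: of_int_mult of_int_of_nat_eq)
    then have "int j = int (n + 1) * i" by (simp only: of_int_eq_iff)
    then have "int (n + 1) dvd int j" by (rule dvdI)
    then show False using assms by (simp only: int_dvd_int_iff)
  qed
  moreover have "sin ((real n + 1) * t) = 0"
  proof -
    have "(real n + 1) * t = real j * pi" using nt by (simp only: of_nat_add of_nat_1 mult.commute)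
    then show ?thesis by (simp only: sin_npi)
  qed
  ultimately show ?thesis using cheb_sin[of n t] unfolding ch_def t_def[symmetric] by simp
qed

lemma ch_strict:
  assumes "i < j" "j \<le> n + 1"
  shows "ch n j < ch n i"
proof -
  have "pi * real i / real (n + 1) < pi * real j / real (n + 1)"
    using assms(1) by (intro divide_strict_right_mono mult_strict_left_mono) auto
  moreover have "pi * real j / real (n + 1) \<le> pi"
  proof -
    have "pi * real j \<le> pi * real (n + 1)" using assms(2) by (intro mult_left_mono) auto
    then show ?thesis by (subst pos_divide_le_eq) simp_all
  qed
  ultimately have "cos (pi * real j / real (n + 1)) < cos (pi * real i / real (n + 1))"
    by (intro cos_monotone_0_pi) auto
  then show ?thesis by (simp add: ch_def)
qed

lemma ch_inj: "inj_on (ch n) {..n + 1}"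
  by (rule inj_onI) (metis ch_strict atMost_iff linorder_neqE_nat less_irrefl)

lemma ch_inj_complex: "A \<subseteq> {..n + 1} \<Longrightarrow> inj_on (\<lambda>j. complex_of_real (ch n j)) A"
  using inj_on_subset[OF ch_inj[of n], of A] unfolding inj_on_def of_real_eq_iff .

lemma ch_bound: "1 \<le> j \<Longrightarrow> j \<le> n \<Longrightarrow> \<bar>ch n j\<bar> < 2"
  using ch_strict[of 0 j n] ch_strict[of j "n + 1" n] by (simp add: ch_def)

lemma ch_neg: "j \<le> n + 1 \<Longrightarrow> ch n (n + 1 - j) = - ch n j"
proof -
  assume j: "j \<le> n + 1"
  have "pi * real (n + 1 - j) / real (n + 1) = pi - pi * real j / real (n + 1)"
    using j by (simp add: of_nat_diff field_simps)
  then show ?thesis by (simp add: ch_def)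
qed

lemma cheb_prod: "map_poly of_int (cheb n) = (\<Prod>\<mu>\<in>(\<lambda>j. complex_of_real (ch n j)) ` {1..n}. [:-\<mu>, 1:])"
proof (rule monic_prod_roots)
  show "degree (map_poly complex_of_int (cheb n)) = n" "poly.coeff (map_poly complex_of_int (cheb n)) n = 1"
    using cheb_degree[of n] by (auto simp: coeff_map_poly)
  have "inj_on (\<lambda>j. complex_of_real (ch n j)) {1..n}"
    by (rule ch_inj_complex) auto
  then show "card ((\<lambda>j. complex_of_real (ch n j)) ` {1..n}) = n" by (simp add: card_image)
  show "poly (map_poly of_int (cheb n)) \<mu> = 0" if m: "\<mu> \<in> (\<lambda>j. complex_of_real (ch n j)) ` {1..n}" for \<mu>
  proof -
    obtain j where j: "j \<in> {1..n}" "\<mu> = of_real (ch n j)" using m by blast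
    have "\<not> (n + 1) dvd j" using j(1) by (auto dest: dvd_imp_le)
    then show ?thesis using cheb_root j(2) by (simp add: ieval_def)
  qed
qed simp

lemma cheb_at_2: "ieval (cheb n) 2 = of_nat (n + 1)"
  by (induction n rule: cheb.induct) (simp_all add: algebra_simps)

lemma int_poly_ex:
  fixes p :: "complex poly"
  assumes "\<forall>i. poly.coeff p i \<in> \<int>"
  shows "\<exists>f. p = map_poly of_int f"
proof -
  have "p = map_poly complex_of_int (map_poly (\<lambda>x. \<lfloor>Re x\<rfloor>) p)"
  proof (rule poly_eqI)
    fix i
    obtain k where "poly.coeff p i = of_int k" using assms by (meson Ints_cases)
    then show "poly.coeff p i = poly.coeff (map_poly complex_of_int (map_poly (\<lambda>x. \<lfloor>Re x\<rfloor>) p)) i"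
      by (simp add: coeff_map_poly)
  qed
  then show ?thesis by blast
qed

section \<open>How the eigenvalues are shared between unions of components\<close>

context gain_graph begin

definition closed :: "'a set \<Rightarrow> bool" where
  "closed C \<longleftrightarrow> C \<subseteq> V \<and> (\<forall>u\<in>C. \<forall>v\<in>V - C. h u v = 0)"

lemma closed_compl: "closed C \<Longrightarrow> closed (V - C)"
  using h_nz_sym by (fastforce simp: closed_def)

lemma closed_sum:
  assumes "closed C" "u \<in> C"
  shows "(\<Sum>v\<in>V. h u v * x v) = (\<Sum>v\<in>C. h u v * x v)"
  using assms finV by (intro sum.mono_neutral_right) (auto simp: closed_def)

lemma ev_split:
  assumes "closed C" "ev h V \<mu>"
  shows "ev h C \<mu> \<or> ev h (V - C) \<mu>"
proof -
  obtain x u where x: "u \<in> V" "x u \<noteq> 0" "\<And>u. u \<in> V \<Longrightarrow> (\<Sum>v\<in>V. h u v * x v) = \<mu> * x u"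
    using assms(2) by (auto simp: ev_def)
  have CV: "C \<subseteq> V" using assms(1) by (simp add: closed_def)
  have C: "\<forall>u\<in>C. (\<Sum>v\<in>C. h u v * x v) = \<mu> * x u"
    using closed_sum[OF assms(1)] x(3) CV by (metis subsetD)
  have D: "\<forall>u\<in>V - C. (\<Sum>v\<in>V - C. h u v * x v) = \<mu> * x u"
    using closed_sum[OF closed_compl[OF assms(1)]] x(3) by (metis DiffD1)
  show ?thesis
  proof (cases "u \<in> C")
    case True
    then have "ev h C \<mu>" unfolding ev_def by (intro exI[of _ x] conjI C bexI[of _ u]) (use x(2) in auto)
    then show ?thesis ..
  next
    case False
    then have "ev h (V - C) \<mu>" unfolding ev_def by (intro exI[of _ x] conjI D bexI[of _ u]) (use x(1,2) in auto)
    then show ?thesis ..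
  qed
qed

lemma ev_mono:
  assumes "closed C" "ev h C \<mu>"
  shows "ev h V \<mu>"
proof -
  obtain x u where x: "u \<in> C" "x u \<noteq> 0" "\<And>u. u \<in> C \<Longrightarrow> (\<Sum>v\<in>C. h u v * x v) = \<mu> * x u"
    using assms(2) by (auto simp: ev_def)
  have CV: "C \<subseteq> V" using assms(1) by (simp add: closed_def)
  define y where "y v = (if v \<in> C then x v else 0)" for v
  have "(\<Sum>v\<in>V. h u v * y v) = \<mu> * y u" if u: "u \<in> V" for u
  proof -
    have "(\<Sum>v\<in>V. h u v * y v) = (\<Sum>v\<in>C. h u v * x v)"
      using CV finV by (intro sum.mono_neutral_cong_right) (auto simp: y_def)
    also have "\<dots> = \<mu> * y u"
    proof (cases "u \<in> C")
      case False
      then have "\<forall>v\<in>C. h u v = 0" using closed_compl[OF assms(1)] u CV by (auto simp: closed_def)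
      then show ?thesis using False by (simp add: y_def)
    qed (simp add: x(3) y_def)
    finally show ?thesis .
  qed
  moreover have "\<exists>u\<in>V. y u \<noteq> 0" using x CV by (auto simp: y_def)
  ultimately show ?thesis by (auto simp: ev_def)
qed

definition idx :: "nat \<Rightarrow> 'a set \<Rightarrow> nat set" where
  "idx n C = {j \<in> {1..n}. ev h C (of_real (ch n j))}"

lemma idx_card_le:
  assumes "C \<subseteq> V"
  shows "card (idx n C) \<le> card C"
proof -
  have "inj_on (\<lambda>j. complex_of_real (ch n j)) (idx n C)"
    by (rule ch_inj_complex) (auto simp: idx_def)
  then have "card (idx n C) = card ((\<lambda>j. complex_of_real (ch n j)) ` idx n C)" by (simp add: card_image)
  also have "\<dots> \<le> card C"
  proof -
    have "ev h C \<mu>" if m: "\<mu> \<in> (\<lambda>j. complex_of_real (ch n j)) ` idx n C" for \<mu>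
      using m unfolding idx_def by blast
    then show ?thesis using ev_card[OF finite_subset[OF assms finV]] by blast
  qed
  finally show ?thesis .
qed

text \<open>A closed set and its complement each carry at most as many distinct eigenvalues as they
  have vertices. Together they carry all \<open>n\<close>, so both bounds are attained and no
  eigenvalue is shared.\<close>

lemma idx_partition:
  assumes ps: "pathspec n" and C: "closed C"
  shows "idx n C \<union> idx n (V - C) = {1..n}" "idx n C \<inter> idx n (V - C) = {}" "card (idx n C) = card C"
proof -
  have CV: "C \<subseteq> V" using C by (simp add: closed_def)
  have n: "card C + card (V - C) = n"
    using ps card_mono[OF finV CV] card_Diff_subset[OF finite_subset[OF CV finV] CV] by (simp add: pathspec_def)
  show un: "idx n C \<union> idx n (V - C) = {1..n}"
  proof (intro equalityI subsetI)
    fix j assume j: "j \<in> {1..n}"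
    then have "ev h V (of_real (ch n j))" using ps by (auto simp: pathspec_def)
    from ev_split[OF C this] j show "j \<in> idx n C \<union> idx n (V - C)" by (auto simp: idx_def)
  qed (auto simp: idx_def)
  have fin: "finite (idx n C)" "finite (idx n (V - C))" by (auto simp: idx_def)
  have "card (idx n C \<union> idx n (V - C)) + card (idx n C \<inter> idx n (V - C)) = card (idx n C) + card (idx n (V - C))"
    using card_Un_Int[OF fin] by simp
  then have "card (idx n C \<inter> idx n (V - C)) = 0 \<and> card (idx n C) = card C"
    using un n idx_card_le[OF CV, of n] idx_card_le[of "V - C" n] by simp
  then show "idx n C \<inter> idx n (V - C) = {}" "card (idx n C) = card C" using fin by auto
qed

text \<open>The characteristic polynomial of the part: its coefficients are Gaussian integers since
  the entries are, and real since the roots are.\<close>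

lemma component_poly:
  assumes ps: "pathspec n" and C: "closed C"
  obtains f where "map_poly of_int f = (\<Prod>j\<in>idx n C. [:- complex_of_real (ch n j), 1:])"
    "\<And>z. ieval f z = 0 \<longleftrightarrow> ev h C z"
proof -
  have CV: "C \<subseteq> V" using C by (simp add: closed_def)
  obtain vs where vs: "set vs = C" "distinct vs" using finite_distinct_list[OF finite_subset[OF CV finV]] by blast
  have inj: "inj_on (\<lambda>j. complex_of_real (ch n j)) (idx n C)"
    by (rule ch_inj_complex) (auto simp: idx_def)
  let ?M = "(\<lambda>j. complex_of_real (ch n j)) ` idx n C"
  have len: "length vs = card C" using vs distinct_card by metis
  have cM: "card ?M = length vs" unfolding card_image[OF inj] len by (rule idx_partition(3)[OF ps C])
  have cp: "char_poly (mat_of h vs) = (\<Prod>\<mu>\<in>?M. [:-\<mu>, 1:])"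
    by (rule char_poly_prod[OF vs(2) _ cM]) (auto simp: vs(1) idx_def)
  also have "\<dots> = (\<Prod>j\<in>idx n C. [:- complex_of_real (ch n j), 1:])"
    by (subst prod.reindex[OF inj]) simp
  finally have cp': "char_poly (mat_of h vs) = (\<Prod>j\<in>idx n C. [:- complex_of_real (ch n j), 1:])" .
  have "gpoly (char_poly (mat_of h vs))"
    by (rule gpoly_char_poly[OF mat_of_carrier]) (simp add: mat_of_def h_gint)
  moreover have "poly.coeff (char_poly (mat_of h vs)) i \<in> \<real>" for i
    unfolding cp by (rule prod_real_coeff) auto
  ultimately have "\<forall>i. poly.coeff (char_poly (mat_of h vs)) i \<in> \<int>"
    by (auto simp: gpoly_def intro: gint_real_int)
  then obtain f where f: "char_poly (mat_of h vs) = map_poly of_int f" using int_poly_ex by metis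
  show thesis
  proof (rule that)
    show "map_poly of_int f = (\<Prod>j\<in>idx n C. [:- complex_of_real (ch n j), 1:])" using f cp' by simp
    show "ieval f z = 0 \<longleftrightarrow> ev h C z" for z
      using ev_root[OF vs(2), of h z] f vs(1) by (simp add: ieval_def)
  qed
qed

text \<open>The integer polynomials of \<open>C\<close> and of its complement multiply to
  \<open>cheb n\<close>. Starting from the index 1, \<open>cheb_galois_prime\<close> is applied once
  for every prime factor of \<open>j\<close> and never leaves the roots of the factor of
  \<open>C\<close>.\<close>

lemma component_galois:
  assumes ps: "pathspec n" and C: "closed C" and n: "0 < n" and one: "ev h C (of_real (ch n 1))"
    and cop: "coprime j (2 * (n + 1))"
  shows "ev h C (of_real (ch n j))"
proof -
  obtain f where f: "map_poly of_int f = (\<Prod>j\<in>idx n C. [:- complex_of_real (ch n j), 1:])"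
    "\<And>z. ieval f z = 0 \<longleftrightarrow> ev h C z" by (rule component_poly[OF ps C]) blast
  obtain g where g: "map_poly of_int g = (\<Prod>j\<in>idx n (V - C). [:- complex_of_real (ch n j), 1:])"
    by (rule component_poly[OF ps closed_compl[OF C]]) blast
  have inj: "inj_on (\<lambda>j. complex_of_real (ch n j)) {1..n}"
    by (rule ch_inj_complex) auto
  have "map_poly complex_of_int (f * g) = (\<Prod>j\<in>idx n C \<union> idx n (V - C). [:- complex_of_real (ch n j), 1:])"
    using idx_partition(2)[OF ps C]
    by (subst prod.union_disjoint) (auto simp: f(1) g of_int_poly_hom.hom_mult idx_def)
  also have "\<dots> = map_poly complex_of_int (cheb n)"
    unfolding idx_partition(1)[OF ps C] cheb_prod by (subst prod.reindex[OF inj]) simp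
  finally have eq: "map_poly complex_of_int (f * g) = map_poly complex_of_int (cheb n)" .
  have fg: "f * g = cheb n"
  proof (rule poly_eqI)
    fix i
    have "complex_of_int (poly.coeff (f * g) i) = of_int (poly.coeff (cheb n) i)"
      using arg_cong[OF eq, of "\<lambda>p. poly.coeff p i"] by (simp only: coeff_map_poly of_int_0)
    then show "poly.coeff (f * g) i = poly.coeff (cheb n) i" by (simp only: of_int_eq_iff)
  qed
  obtain m where m: "n = Suc m" using n by (cases n) auto
  from cop show ?thesis
  proof (induction j rule: prime_divisors_induct)
    case zero
    then show ?case by simp
  next
    case (unit x)
    then show ?case using one by simp
  next
    case (factor p x)
    have cx: "coprime x (2 * (n + 1))" "coprime p (2 * (n + 1))" using factor.prems by simp_all
    have pn: "\<not> p dvd 2 * (m + 2)"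
      using cx(2) factor.hyps(1) unfolding m by (metis Suc_eq_plus1 add_2_eq_Suc' coprime_absorb_left not_prime_unit)
    have "\<not> (n + 1) dvd p * x"
    proof
      assume "(n + 1) dvd p * x"
      then have "coprime (n + 1) (2 * (n + 1))" using factor.prems by (metis coprime_divisors dvd_refl)
      then have "n + 1 = 1" by (metis coprime_absorb_left dvd_triv_right nat_dvd_1_iff_1)
      then show False using n by simp
    qed
    then have rt: "ieval (cheb n) (of_real (ch n (p * x))) = 0" by (rule cheb_root)
    have eq: "ch n (p * x) = 2 * cos (real p * (pi * real x / real (m + 2)))" by (simp add: ch_def m mult_ac)
    have "ieval f (of_real (2 * cos (real p * (pi * real x / real (m + 2))))) = 0"
    proof (rule cheb_galois_prime[OF fg[unfolded m] factor.hyps(1) pn refl])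
      show "ieval f (complex_of_real (2 * cos (pi * real x / real (m + 2)))) = 0"
        using factor.IH[OF cx(1)] f(2) by (simp add: ch_def m)
      show "ieval (cheb (Suc m)) (complex_of_real (2 * cos (real p * (pi * real x / real (m + 2))))) = 0"
        using rt[unfolded eq] unfolding m .
    qed
    then show ?case unfolding eq f(2) .
  qed
qed

end

subsection \<open>The bipartite double cover\<close>

text \<open>A common divisor of \<open>m\<close> and \<open>m - 2 ^ a\<close> divides
  \<open>2 ^ a\<close> and is odd. For \<open>m = 17\<close> the number \<open>m - 16\<close>
  coincides with 1, hence the separate list. Odd members are wanted because they must be coprime to
  \<open>2 * (n + 1)\<close>, which is \<open>2 m\<close> or \<open>4 m\<close>.\<close>

lemma odd_units:
  fixes m :: nat
  assumes "17 \<le> m" "odd m"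
  shows "\<exists>J. finite J \<and> card J = 5 \<and> (\<forall>j\<in>J. odd j \<and> j < m \<and> coprime j m)"
proof (cases "m = 17")
  case True
  have "prime (17 :: nat)" by simp
  then have "coprime j 17" if "0 < j" "j < 17" for j :: nat
    using that prime_imp_coprime[of 17 j] by (metis \<open>prime 17\<close> coprime_commute nat_dvd_not_less)
  then show ?thesis using True by (intro exI[of _ "{1, 3, 5, 7, 9}"]) auto
next
  case False
  then have m: "19 \<le> m" using assms by presburger
  have c: "odd (m - 2 ^ a) \<and> coprime (m - 2 ^ a) m" if "1 \<le> a" "a \<le> 4" for a
  proof -
    have "(2::nat) ^ a \<le> 2 ^ 4" using that by (intro power_increasing) auto
    then have le: "2 ^ a \<le> m" using m by simp
    obtain d where d: "m = d + 2 ^ a" using le by (metis add.commute le_Suc_ex)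
    have "odd d" using assms(2) that unfolding d by simp
    then have "coprime d (2 ^ a)" by simp
    then have "coprime d (d + 2 ^ a)" unfolding coprime_iff_gcd_eq_1 by (simp only: gcd_add2)
    then show ?thesis using \<open>odd d\<close> d by simp
  qed
  have "\<forall>j\<in>{1, m - 2, m - 4, m - 8, m - 16}. odd j \<and> j < m \<and> coprime j m"
    using c[of 1] c[of 2] c[of 3] c[of 4] m by simp
  moreover have "card {1, m - 2, m - 4, m - 8, m - 16} = 5"
  proof -
    obtain k where "m = k + 19" using m by (metis add.commute le_Suc_ex)
    then show ?thesis by (simp add: card_insert_if)
  qed
  ultimately show ?thesis by (intro exI[of _ "{1, m - 2, m - 4, m - 8, m - 16}"]) auto
qed

section \<open>Components and their double covers\<close>

context gain_graph begin

definition adj :: "('a \<times> 'a) set" where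
  "adj = {(u, v). u \<in> V \<and> v \<in> V \<and> h u v \<noteq> 0}"

definition component :: "'a \<Rightarrow> 'a set" where
  "component u = adj\<^sup>* `` {u}"

lemma sym_adj: "sym adj"
  using h_nz_sym by (auto simp: adj_def sym_def)

lemma component_closed:
  assumes "u \<in> V"
  shows "closed (component u)"
  unfolding closed_def
proof (intro conjI ballI)
  show "component u \<subseteq> V"
  proof
    fix v assume "v \<in> component u"
    then have "(u, v) \<in> adj\<^sup>*" by (simp add: component_def)
    then show "v \<in> V" using assms by (induction rule: rtrancl_induct) (auto simp: adj_def)
  qed
  fix a b assume a: "a \<in> component u" and b: "b \<in> V - component u"
  show "h a b = 0"
  proof (rule ccontr)
    assume "h a b \<noteq> 0"
    then have "(a, b) \<in> adj" using a b \<open>component u \<subseteq> V\<close> by (auto simp: adj_def)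
    then show False using a b by (auto simp: component_def intro: rtrancl_into_rtrancl)
  qed
qed

lemma component_ev:
  assumes "ev h V \<mu>"
  shows "\<exists>u\<in>V. ev h (component u) \<mu>"
proof -
  obtain x u where x: "u \<in> V" "x u \<noteq> 0" "\<And>u. u \<in> V \<Longrightarrow> (\<Sum>v\<in>V. h u v * x v) = \<mu> * x u"
    using assms by (auto simp: ev_def)
  have C: "closed (component u)" by (rule component_closed[OF x(1)])
  have "\<forall>w\<in>component u. (\<Sum>v\<in>component u. h w v * x v) = \<mu> * x w"
    using closed_sum[OF C] x(3) C unfolding closed_def by (metis subsetD)
  moreover have "u \<in> component u" by (simp add: component_def)
  ultimately have "ev h (component u) \<mu>" unfolding ev_def using x(2) by blast
  then show ?thesis using x(1) by blast
qed

definition cover_adj :: "(('a \<times> bool) \<times> ('a \<times> bool)) set" where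
  "cover_adj = {(p, q). (fst p, fst q) \<in> adj \<and> snd p \<noteq> snd q}"

text \<open>One component of the double cover. It lies over \<open>component u\<close> and meets
  each fibre in one or two points, depending on whether the component is bipartite.\<close>

definition cover :: "'a \<Rightarrow> ('a \<times> bool) set" where
  "cover u = cover_adj\<^sup>* `` {(u, True)}"

text \<open>Negating one sheet changes the sign of all off-diagonal entries, so this single matrix
  accounts for both 2 + H and 2 - H.\<close>

definition cover_gram :: "'a \<times> bool \<Rightarrow> 'a \<times> bool \<Rightarrow> complex" where
  "cover_gram p q = (if p = q then 2 else if snd p \<noteq> snd q then h (fst p) (fst q) else 0)"

lemma cover_step:
  assumes "p \<in> cover u" "(fst p, v) \<in> adj"
  shows "(v, \<not> snd p) \<in> cover u"
proof -
  have "(p, (v, \<not> snd p)) \<in> cover_adj" using assms(2) by (simp add: cover_adj_def)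
  then show ?thesis using assms(1) by (auto simp: cover_def intro: rtrancl_into_rtrancl)
qed

lemma cover_component:
  assumes "p \<in> cover u"
  shows "fst p \<in> component u"
proof -
  have "((u, True), p) \<in> cover_adj\<^sup>*" using assms by (simp add: cover_def)
  then show ?thesis
    by (induction rule: rtrancl_induct) (auto simp: component_def cover_adj_def intro: rtrancl_into_rtrancl)
qed

lemma component_cover:
  assumes "v \<in> component u"
  shows "\<exists>s. (v, s) \<in> cover u"
proof -
  have "(u, v) \<in> adj\<^sup>*" using assms by (simp add: component_def)
  then show ?thesis
  proof (induction rule: rtrancl_induct)
    case base
    then show ?case by (auto simp: cover_def)
  next
    case (step y z)
    then show ?case using cover_step by fastforce
  qed
qed

lemma sym_cover_adj: "sym cover_adj"
  using sym_adj by (auto simp: cover_adj_def sym_def)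

lemma cover_finite:
  assumes "u \<in> V"
  shows "finite (cover u)" "cover u \<subseteq> V \<times> UNIV"
proof -
  show "cover u \<subseteq> V \<times> UNIV"
  proof
    fix p assume "p \<in> cover u"
    then have "fst p \<in> V" using cover_component component_closed[OF assms] unfolding closed_def by blast
    then show "p \<in> V \<times> UNIV" by (cases p) simp
  qed
  then show "finite (cover u)" by (rule finite_subset) (simp add: finV)
qed

lemma cover_conn:
  assumes A: "A \<subseteq> cover u" "A \<noteq> {}" "A \<noteq> cover u"
  shows "\<exists>p\<in>A. \<exists>q\<in>cover u - A. cover_gram p q \<noteq> 0"
proof (rule ccontr)
  assume neg: "\<not> ?thesis"
  obtain a b where ab: "a \<in> A" "b \<in> cover u" "b \<notin> A" using A by blast
  have ua: "((u, True), a) \<in> cover_adj\<^sup>*" using A(1) ab(1) unfolding cover_def by blast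
  have ub: "((u, True), b) \<in> cover_adj\<^sup>*" using ab(2) unfolding cover_def by blast
  have "(a, b) \<in> cover_adj\<^sup>*"
    by (rule rtrancl_trans[OF symD[OF sym_rtrancl[OF sym_cover_adj] ua] ub])
  then have "b \<in> A"
  proof (induction rule: rtrancl_induct)
    case base
    then show ?case by (rule ab(1))
  next
    case (step y z)
    have y: "(fst y, fst z) \<in> adj" "snd z = (\<not> snd y)" using step.hyps(2) by (auto simp: cover_adj_def)
    have "y \<in> cover u" using step.IH A(1) by (rule subsetD[rotated])
    from cover_step[OF this y(1)] have zc: "z \<in> cover u" unfolding y(2)[symmetric] prod.collapse .
    have "h (fst y) (fst z) \<noteq> 0" using y(1) unfolding adj_def by blast
    moreover have "y \<noteq> z" using y(2) by auto
    ultimately have "cover_gram y z \<noteq> 0" using y(2) by (simp add: cover_gram_def)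
    show ?case
    proof (rule ccontr)
      assume "z \<notin> A"
      with zc have "z \<in> cover u - A" by simp
      then show False using neg step.IH \<open>cover_gram y z \<noteq> 0\<close> by blast
    qed
  qed
  then show False using ab by simp
qed

text \<open>Extended by zero to the full cover, a vector splits into sheets \<open>a\<close> and
  \<open>b\<close>. The form equals twice the sum of their norms plus twice the real part of
  \<open>S\<close>, to which \<open>cover_pd\<close> applies.\<close>

lemma cover_gram_pd:
  assumes ps: "pathspec n" and u: "u \<in> V" and nz: "\<exists>p\<in>cover u. x p \<noteq> 0"
  shows "0 < Re (\<Sum>p\<in>cover u. \<Sum>q\<in>cover u. cnj (x p) * cover_gram p q * x q)"
proof -
  define a where "a v = (if (v, False) \<in> cover u then x (v, False) else 0)" for v
  define b where "b v = (if (v, True) \<in> cover u then x (v, True) else 0)" for v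
  define y where "y p = (if p \<in> cover u then x p else 0)" for p
  have yab: "y (v, False) = a v" "y (v, True) = b v" for v by (simp_all add: y_def a_def b_def)
  define T where "T p q = cnj (y p) * cover_gram p q * y q" for p q
  define S where "S = (\<Sum>u\<in>V. \<Sum>v\<in>V. cnj (a u) * h u v * b v)"
  note cf = cover_finite[OF u]
  have fin: "finite (V \<times> (UNIV :: bool set))" using finV by simp
  have sumVV: "(\<Sum>p\<in>V \<times> UNIV. F p) = (\<Sum>v\<in>V. F (v, False) + F (v, True))" for F :: "'a \<times> bool \<Rightarrow> complex"
  proof -
    have "(\<Sum>p\<in>V \<times> UNIV. F p) = (\<Sum>v\<in>V. \<Sum>s\<in>UNIV. F (v, s))" by (simp add: sum.cartesian_product)
    then show ?thesis by (simp add: UNIV_bool)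
  qed
  have "(\<Sum>p\<in>cover u. \<Sum>q\<in>cover u. cnj (x p) * cover_gram p q * x q) =
    (\<Sum>p\<in>cover u. \<Sum>q\<in>V \<times> UNIV. cnj (x p) * cover_gram p q * y q)"
    using cf fin by (intro sum.cong refl sum.mono_neutral_cong_left) (auto simp: y_def)
  also have "\<dots> = (\<Sum>p\<in>V \<times> UNIV. \<Sum>q\<in>V \<times> UNIV. cnj (y p) * cover_gram p q * y q)"
    using cf fin by (intro sum.mono_neutral_cong_left) (auto simp: y_def)
  also have "\<dots> = (\<Sum>v\<in>V. \<Sum>w\<in>V. (T (v, False) (w, False) + T (v, False) (w, True)) +
      (T (v, True) (w, False) + T (v, True) (w, True)))"
    unfolding T_def[symmetric] sumVV sum.distrib[symmetric] ..
  also have "\<dots> = (\<Sum>v\<in>V. \<Sum>w\<in>V. (if v = w then 2 * (cnj (a v) * a v) + 2 * (cnj (b v) * b v) else 0) +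
      cnj (a v) * h v w * b w + cnj (b v) * h v w * a w)"
  proof (intro sum.cong refl)
    fix v w
    have "T (v, False) (w, False) = (if v = w then 2 * (cnj (a v) * a v) else 0)"
      "T (v, True) (w, True) = (if v = w then 2 * (cnj (b v) * b v) else 0)"
      "T (v, False) (w, True) = cnj (a v) * h v w * b w" "T (v, True) (w, False) = cnj (b v) * h v w * a w"
      by (simp_all add: T_def cover_gram_def yab)
    then show "(T (v, False) (w, False) + T (v, False) (w, True)) + (T (v, True) (w, False) + T (v, True) (w, True)) =
      (if v = w then 2 * (cnj (a v) * a v) + 2 * (cnj (b v) * b v) else 0) +
      cnj (a v) * h v w * b w + cnj (b v) * h v w * a w"
      by simp
  qed
  also have "\<dots> = (\<Sum>v\<in>V. 2 * (cnj (a v) * a v) + 2 * (cnj (b v) * b v)) + S +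
      (\<Sum>v\<in>V. \<Sum>w\<in>V. cnj (b v) * h v w * a w)"
    using finV by (simp add: sum.distrib S_def)
  also have "(\<Sum>v\<in>V. \<Sum>w\<in>V. cnj (b v) * h v w * a w) = cnj S"
  proof -
    have "cnj S = (\<Sum>u\<in>V. \<Sum>v\<in>V. cnj (b v) * h v u * a u)"
      unfolding S_def cnj_sum by (intro sum.cong refl) (simp add: herm[symmetric] mult_ac)
    also have "\<dots> = (\<Sum>v\<in>V. \<Sum>u\<in>V. cnj (b v) * h v u * a u)" by (rule sum.swap)
    finally show ?thesis ..
  qed
  finally have total: "(\<Sum>p\<in>cover u. \<Sum>q\<in>cover u. cnj (x p) * cover_gram p q * x q) =
    (\<Sum>v\<in>V. 2 * (cnj (a v) * a v) + 2 * (cnj (b v) * b v)) + S + cnj S" .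
  have eq: "Re (\<Sum>p\<in>cover u. \<Sum>q\<in>cover u. cnj (x p) * cover_gram p q * x q) =
    2 * ((\<Sum>v\<in>V. (cmod (a v))\<^sup>2) + (\<Sum>v\<in>V. (cmod (b v))\<^sup>2)) + 2 * Re S"
  proof -
    have nrm: "cnj z * z = complex_of_real ((cmod z)\<^sup>2)" for z
      by (simp only: complex_norm_square mult.commute)
    show ?thesis unfolding total nrm by (simp add: sum.distrib sum_distrib_left del: of_real_power)
  qed
  have cV: "card V = n" using ps by (simp add: pathspec_def)
  have "\<bar>Re S\<bar> < (\<Sum>v\<in>V. (cmod (a v))\<^sup>2) + (\<Sum>v\<in>V. (cmod (b v))\<^sup>2)"
    unfolding S_def
  proof (rule cover_pd[where lam = "\<lambda>j. ch n (Suc j)"])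
    show "ev h V (complex_of_real (ch n (Suc j)))" if "j < card V" for j
      using ps that by (auto simp: pathspec_def)
    show "inj_on (\<lambda>j. ch n (Suc j)) {..<card V}"
    proof (rule inj_onI)
      fix i j assume ij: "i \<in> {..<card V}" "j \<in> {..<card V}" "ch n (Suc i) = ch n (Suc j)"
      then have "Suc i = Suc j" by (intro inj_onD[OF ch_inj[of n] ij(3)]) (simp_all add: cV)
      then show "i = j" by simp
    qed
    show "\<bar>ch n (Suc j)\<bar> < 2" if "j < card V" for j using ch_bound[of "Suc j" n] that cV by simp
    obtain p where p: "p \<in> cover u" "x p \<noteq> 0" using nz by blast
    obtain v s where vs: "p = (v, s)" by (cases p)
    have "v \<in> V" using p(1) cf(2) vs by blast
    then show "\<exists>u\<in>V. a u \<noteq> 0 \<or> b u \<noteq> 0" using p vs by (cases s) (auto simp: a_def b_def)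
  qed
  moreover have "0 < 2 * (A + B) + 2 * r" if "\<bar>r\<bar> < A + B" for A B r :: real
  proof -
    have "- r < A + B" using that unfolding abs_less_iff by blast
    then show ?thesis by simp
  qed
  ultimately show ?thesis unfolding eq by blast
qed

text \<open>An eigenvector is copied to both sheets and multiplied by \<sigma> on one of them, so
  the cover carries each eigenvalue of the component with both signs.\<close>

lemma cover_ev:
  assumes u: "u \<in> V" and e: "ev h (component u) \<mu>" and s: "\<sigma> = 1 \<or> \<sigma> = - 1"
  shows "ev (\<lambda>p q. if snd p \<noteq> snd q then h (fst p) (fst q) else 0) (cover u) (\<sigma> * \<mu>)"
proof -
  obtain x w where x: "w \<in> component u" "x w \<noteq> 0" "\<And>w. w \<in> component u \<Longrightarrow> (\<Sum>v\<in>component u. h w v * x v) = \<mu> * x w"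
    using e by (auto simp: ev_def)
  define y where "y p = (if snd p then \<sigma> else 1) * x (fst p)" for p :: "'a \<times> bool"
  obtain t where t: "(w, t) \<in> cover u" using component_cover[OF x(1)] by blast
  have CV: "component u \<subseteq> V" using component_closed[OF u] by (simp add: closed_def)
  have "y (w, t) \<noteq> 0" using x(2) s by (auto simp: y_def)
  moreover have "(\<Sum>q\<in>cover u. (if snd p \<noteq> snd q then h (fst p) (fst q) else 0) * y q) = \<sigma> * \<mu> * y p" if p: "p \<in> cover u" for p
  proof -
    have inj: "inj_on (\<lambda>v. (v, \<not> snd p)) (component u)" by (auto simp: inj_on_def)
    have "(\<Sum>v\<in>component u. h (fst p) v * y (v, \<not> snd p)) =
        (\<Sum>q\<in>(\<lambda>v. (v, \<not> snd p)) ` component u. h (fst p) (fst q) * y q)"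
      by (subst sum.reindex[OF inj]) simp
    also have "\<dots> = (\<Sum>q\<in>cover u. (if snd p \<noteq> snd q then h (fst p) (fst q) else 0) * y q)"
    proof (rule sum.mono_neutral_cong)
      show "finite (cover u)" by (rule cover_finite[OF u])
      show "finite ((\<lambda>v. (v, \<not> snd p)) ` component u)" using CV finV finite_subset by blast
      show "(if snd p \<noteq> snd q then h (fst p) (fst q) else 0) * y q = 0"
        if "q \<in> cover u - (\<lambda>v. (v, \<not> snd p)) ` component u" for q
        using that cover_component[of q u] by (cases q) (auto simp: image_iff)
      show "h (fst p) (fst q) * y q = 0" if q: "q \<in> (\<lambda>v. (v, \<not> snd p)) ` component u - cover u" for q
      proof -
        have "(fst p, fst q) \<notin> adj" using cover_step[OF p, of "fst q"] q by auto
        then have "h (fst p) (fst q) = 0" using cover_component[OF p] q CV by (auto simp: adj_def)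
        then show ?thesis by simp
      qed
    qed auto
    finally have eq: "(\<Sum>q\<in>cover u. (if snd p \<noteq> snd q then h (fst p) (fst q) else 0) * y q) =
      (\<Sum>v\<in>component u. h (fst p) v * y (v, \<not> snd p))" ..
    have "(\<Sum>v\<in>component u. h (fst p) v * y (v, \<not> snd p)) =
      (if snd p then 1 else \<sigma>) * (\<Sum>v\<in>component u. h (fst p) v * x v)"
      unfolding sum_distrib_left by (intro sum.cong refl) (simp add: y_def)
    also have "\<dots> = (if snd p then 1 else \<sigma>) * (\<mu> * x (fst p))" unfolding x(3)[OF cover_component[OF p]] ..
    also have "\<dots> = \<sigma> * \<mu> * y p" using s by (auto simp: y_def)
    finally show ?thesis unfolding eq .
  qed
  ultimately show ?thesis unfolding ev_def by (intro exI[of _ y] conjI bexI[of _ "(w, t)"] ballI t)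
qed

text \<open>The trace of the determinant condition that is kept: in contrast to a determinant of the
  whole graph it passes to complements of closed sets.\<close>

definition twin_free :: bool where
  "twin_free \<longleftrightarrow> (\<forall>a\<in>V. \<forall>b\<in>V. \<forall>\<epsilon>\<in>gunit. a \<noteq> b \<longrightarrow> (\<exists>w\<in>V. (h w a + \<epsilon> * h w b) / 2 \<notin> gint))"

text \<open>Five odd indices give five eigenvalues of the component; their negatives, at the indices
  \<open>n + 1 - j\<close>, occur on the cover too. Ten distinct eigenvalues need ten
  vertices.\<close>

lemma cover_card:
  assumes ps: "pathspec n" and m: "17 \<le> m" "odd m" "n + 1 = m \<or> n + 1 = 2 * m"
    and u: "u \<in> V" and one: "ev h (component u) (of_real (ch n 1))"
  shows "9 \<le> card (cover u)"
proof -
  obtain J where J: "finite J" "card J = 5" "\<And>j. j \<in> J \<Longrightarrow> odd j \<and> j < m \<and> coprime j m"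
    using odd_units[OF m(1,2)] by blast
  define K where "K = J \<union> (\<lambda>j. n + 1 - j) ` J"
  have Jn: "1 \<le> j" "j \<le> n" if "j \<in> J" for j using J(3)[OF that] m(3) by (cases "j = 0"; auto)+
  have inj: "inj_on (\<lambda>j. n + 1 - j) J"
  proof (rule inj_onI)
    fix i j assume "i \<in> J" "j \<in> J" "n + 1 - i = n + 1 - j"
    then show "i = j" using Jn[of i] Jn[of j] by linarith
  qed
  \<comment> \<open>Two members of \<open>J\<close> have an even sum below \<open>2 m\<close>, so it
    is neither the odd number \<open>m\<close> nor \<open>2 m\<close>.\<close>
  have "J \<inter> (\<lambda>j. n + 1 - j) ` J = {}"
  proof (rule ccontr)
    assume "\<not> ?thesis"
    then obtain i j where ij: "i \<in> J" "j \<in> J" "i = n + 1 - j" by blast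
    then have "i + j = n + 1" using Jn[OF ij(2)] by linarith
    then show False using J(3)[OF ij(1)] J(3)[OF ij(2)] m(2,3) by auto
  qed
  then have cK: "card K = 10" unfolding K_def using J(1,2) inj by (simp add: card_Un_disjoint card_image)
  have Kn: "K \<subseteq> {..n + 1}" unfolding K_def using Jn by (auto intro: le_SucI)
  let ?h = "\<lambda>p q. if snd p \<noteq> snd q then h (fst p) (fst q) else 0"
  have evC: "ev h (component u) (of_real (ch n j))" if "j \<in> J" for j
  proof -
    have "coprime j 2" "coprime j m" using J(3)[OF that] by simp_all
    then have "coprime j (2 * (n + 1))"
      using m(3) by (elim disjE) (simp_all only: coprime_mult_right_iff simp_thms)
    then show ?thesis using component_galois[OF ps component_closed[OF u] _ one] m by auto
  qed
  have "ev ?h (cover u) \<mu>" if mu: "\<mu> \<in> (\<lambda>j. complex_of_real (ch n j)) ` K" for \<mu>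
  proof -
    obtain k where k: "k \<in> K" "\<mu> = of_real (ch n k)" using mu by blast
    then consider j where "j \<in> J" "k = j" | j where "j \<in> J" "k = n + 1 - j" by (auto simp: K_def)
    then show ?thesis
    proof cases
      case 1
      then show ?thesis using cover_ev[OF u evC[OF 1(1)], of 1] k(2) by simp
    next
      case 2
      then have "ch n k = - ch n j" using ch_neg[of j n] Jn[OF 2(1)] by simp
      then show ?thesis using cover_ev[OF u evC[OF 2(1)], of "-1"] k(2) by simp
    qed
  qed
  then have "card ((\<lambda>j. complex_of_real (ch n j)) ` K) \<le> card (cover u)"
    using ev_card[OF cover_finite(1)[OF u]] by blast
  then show ?thesis using cK card_image[OF ch_inj_complex[OF Kn]] by simp
qed

text \<open>Neighbours of \<open>v\<close> lie on one sheet of the cover and are orthogonal there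
  whether or not they are adjacent in the graph. The twins that this claw forces on the cover
  project to twins of the graph.\<close>

lemma degree_le_two:
  assumes ps: "pathspec n" and m: "17 \<le> m" "odd m" "n + 1 = m \<or> n + 1 = 2 * m" and tf: twin_free
    and u: "u \<in> V" and one: "ev h (component u) (of_real (ch n 1))"
    and v: "v \<in> component u" and abc: "a \<noteq> b" "a \<noteq> c" "b \<noteq> c" "(v, a) \<in> adj" "(v, b) \<in> adj" "(v, c) \<in> adj"
  shows False
proof -
  interpret D: conn_gram "cover u" cover_gram
  proof
    show "finite (cover u)" by (rule cover_finite[OF u])
    show "cover_gram p p = 2" for p by (simp add: cover_gram_def)
    show "cover_gram q p = cnj (cover_gram p q)" for p q
      by (auto simp: cover_gram_def herm[of "fst p" "fst q"])
    show "cover_gram p q \<in> insert 0 gunit" if "p \<noteq> q" for p q using entry that by (auto simp: cover_gram_def)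
    show "0 < Re (\<Sum>p\<in>cover u. \<Sum>q\<in>cover u. cnj (x p) * cover_gram p q * x q)" if "\<exists>p\<in>cover u. x p \<noteq> 0" for x
      by (rule cover_gram_pd[OF ps u that])
    show "\<exists>p\<in>A. \<exists>q\<in>cover u - A. cover_gram p q \<noteq> 0" if "A \<subseteq> cover u" "A \<noteq> {}" "A \<noteq> cover u" for A
      by (rule cover_conn[OF that])
  qed
  obtain s where s: "(v, s) \<in> cover u" using component_cover[OF v] by blast
  have I: "(a, \<not> s) \<in> cover u" "(b, \<not> s) \<in> cover u" "(c, \<not> s) \<in> cover u"
    using cover_step[OF s] abc by auto
  have nz: "cover_gram (v, s) (a, \<not> s) \<noteq> 0" "cover_gram (v, s) (b, \<not> s) \<noteq> 0" "cover_gram (v, s) (c, \<not> s) \<noteq> 0"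
    using abc by (auto simp: cover_gram_def adj_def)
  have z: "cover_gram (a, \<not> s) (b, \<not> s) = 0" "cover_gram (a, \<not> s) (c, \<not> s) = 0" "cover_gram (b, \<not> s) (c, \<not> s) = 0"
    using abc by (auto simp: cover_gram_def)
  have d: "(v, s) \<noteq> (a, \<not> s)" "(v, s) \<noteq> (b, \<not> s)" "(v, s) \<noteq> (c, \<not> s)"
    "(a, \<not> s) \<noteq> (b, \<not> s)" "(a, \<not> s) \<noteq> (c, \<not> s)" "(b, \<not> s) \<noteq> (c, \<not> s)"
    using abc(1-3) by simp_all
  obtain p q \<epsilon> where pq: "p \<in> cover u" "q \<in> cover u" "p \<noteq> q" "cover_gram (v, s) p \<noteq> 0" "cover_gram (v, s) q \<noteq> 0"
    "(v, s) \<noteq> p" "(v, s) \<noteq> q" "\<epsilon> \<in> gunit" "\<forall>w\<in>cover u. (cover_gram w p + \<epsilon> * cover_gram w q) / 2 \<in> gint"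
    using D.claw_twins[OF cover_card[OF ps m u one] s I d nz z] by (elim bexE conjE)
  have sp: "snd p = (\<not> s)" using pq(4,6) by (cases "s = snd p") (simp_all add: cover_gram_def)
  have sq: "snd q = (\<not> s)" using pq(5,7) by (cases "s = snd q") (simp_all add: cover_gram_def)
  have "fst p \<noteq> fst q"
  proof
    assume "fst p = fst q"
    then have "p = q" by (rule prod_eqI) (simp only: sp sq)
    then show False using pq(3) by simp
  qed
  moreover have pV: "fst p \<in> V" "fst q \<in> V" using pq(1,2) cover_finite(2)[OF u] by auto
  ultimately obtain w where w: "w \<in> V" "(h w (fst p) + \<epsilon> * h w (fst q)) / 2 \<notin> gint"
    using tf pq(8) unfolding twin_free_def by blast
  show False
  proof (cases "(w, s) \<in> cover u")
    case True
    have "(w, s) \<noteq> p" "(w, s) \<noteq> q" using sp sq by auto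
    then have "cover_gram (w, s) p = h w (fst p)" "cover_gram (w, s) q = h w (fst q)"
      using sp sq by (simp_all add: cover_gram_def)
    then show False using bspec[OF pq(9) True] w(2) by simp
  next
    \<comment> \<open>A vertex over \<open>w\<close> on this sheet that misses the cover component
      is adjacent to neither twin, so both entries at \<open>w\<close> vanish and cannot witness
      anything.\<close>
    case False
    have "(fst p, w) \<notin> adj" "(fst q, w) \<notin> adj"
      using cover_step[OF pq(1), of w] cover_step[OF pq(2), of w] sp sq False by auto
    then have "h (fst p) w = 0" "h (fst q) w = 0" using pV w(1) by (simp_all add: adj_def)
    then have "h w (fst p) = 0" "h w (fst q) = 0" using h_nz_sym by blast+
    then show False using w(2) by simp
  qed
qed

end

subsection \<open>Components of maximal degree two\<close>

text \<open>Both sides satisfy the same recurrence and vanish at 0; the factor \<open>sin t\<close>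
  makes them agree at 1.\<close>

lemma sine_recurrence:
  fixes y :: "nat \<Rightarrow> complex"
  assumes rec: "\<And>i. i < r \<Longrightarrow> y i + y (Suc (Suc i)) = of_real (2 * cos t) * y (Suc i)" and y0: "y 0 = 0"
  shows "k \<le> Suc r \<Longrightarrow> y k * of_real (sin t) = y 1 * of_real (sin (real k * t))"
proof (induction k rule: induct_nat_012)
  case (ge2 k)
  have "sin (real (Suc (Suc k)) * t) = 2 * cos t * sin (real (Suc k) * t) - sin (real k * t)"
    using sin_add[of "real (Suc k) * t" t] sin_diff[of "real (Suc k) * t" t] by (simp add: algebra_simps)
  then have s: "complex_of_real (sin (real (Suc (Suc k)) * t)) =
      of_real (2 * cos t) * of_real (sin (real (Suc k) * t)) - of_real (sin (real k * t))"
    by (simp only: of_real_mult of_real_diff)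
  have "y (Suc (Suc k)) = of_real (2 * cos t) * y (Suc k) - y k" using rec[of k] ge2.prems by (simp add: algebra_simps)
  then have "y (Suc (Suc k)) * of_real (sin t) = of_real (2 * cos t) * (y (Suc k) * of_real (sin t)) - y k * of_real (sin t)"
    by (simp only: left_diff_distrib mult.assoc)
  also have "\<dots> = of_real (2 * cos t) * (y 1 * of_real (sin (real (Suc k) * t))) - y 1 * of_real (sin (real k * t))"
    using ge2.IH ge2.prems by simp
  finally show ?case unfolding s by (simp only: right_diff_distrib mult.left_commute)
qed (simp_all add: y0)

lemma path_recurrence:
  fixes y :: "nat \<Rightarrow> complex"
  assumes rec: "\<And>i. i < r \<Longrightarrow> y i + y (Suc (Suc i)) = of_real (2 * cos t) * y (Suc i)"
    and y: "y 0 = 0" "y (Suc r) = 0" and s: "sin t \<noteq> 0" and nz: "k \<le> r" "y k \<noteq> 0"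
  shows "sin (real (Suc r) * t) = 0"
proof -
  have "y 1 * of_real (sin (real (Suc r) * t)) = 0" using sine_recurrence[of r y t "Suc r", OF rec y(1)] y(2) by simp
  moreover have "y 1 \<noteq> 0" using sine_recurrence[of r y t k, OF rec y(1)] nz s by auto
  ultimately show ?thesis by simp
qed

text \<open>With \<open>e = cis t\<close> or its conjugate the sequence
  \<open>y (Suc k) - e * y k\<close> is geometric, and one turn multiplies it by \<gamma>. If it
  vanished for both choices, \<open>y\<close> would vanish at 0 and 1 and hence everywhere.\<close>

lemma cycle_recurrence:
  fixes y :: "nat \<Rightarrow> complex"
  assumes rec: "\<And>i. i < r \<Longrightarrow> y i + y (Suc (Suc i)) = of_real (2 * cos t) * y (Suc i)"
    and y: "y r = \<gamma> * y 0" "y (Suc r) = \<gamma> * y 1" and s: "sin t \<noteq> 0" and nz: "k \<le> r" "y k \<noteq> 0"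
  shows "\<gamma> = cis (real r * t) \<or> \<gamma> = cis (- (real r * t))"
proof -
  have main: "y 1 - e * y 0 = 0 \<or> \<gamma> = e' ^ r" if e: "e + e' = of_real (2 * cos t)" "e * e' = 1" for e e' :: complex
  proof -
    have "k \<le> r \<Longrightarrow> y (Suc k) - e * y k = e' ^ k * (y 1 - e * y 0)" for k
    proof (induction k)
      case (Suc k)
      have "y (Suc (Suc k)) - e * y (Suc k) = e' * y (Suc k) - y k"
        using rec[of k] Suc.prems unfolding e(1)[symmetric] by (simp add: algebra_simps)
      also have "\<dots> = e' * (y (Suc k) - e * y k)" using e(2) by (simp add: right_diff_distrib mult.commute mult.left_commute)
      also have "\<dots> = e' * (e' ^ k * (y 1 - e * y 0))" using Suc by simp
      finally show ?case by (simp only: power_Suc mult.assoc)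
    qed simp
    from this[of r] have "(\<gamma> - e' ^ r) * (y 1 - e * y 0) = 0" using y by (simp add: algebra_simps)
    then show ?thesis by auto
  qed
  have c: "cis t + cis (- t) = of_real (2 * cos t)" by (simp add: complex_eq_iff)
  have p: "cis t * cis (- t) = 1" by (simp add: cis_mult)
  have a: "y 1 - cis t * y 0 = 0 \<or> \<gamma> = cis (- (real r * t))"
    using main[OF c p] by (simp add: DeMoivre)
  have b: "y 1 - cis (- t) * y 0 = 0 \<or> \<gamma> = cis (real r * t)"
    using main[of "cis (- t)" "cis t"] c p by (simp add: DeMoivre add.commute mult.commute)
  show ?thesis
  proof (rule ccontr)
    assume "\<not> ?thesis"
    then have z: "y 1 = cis t * y 0" "y 1 = cis (- t) * y 0" using a b by auto
    have "(cis t - cis (- t)) * y 0 = 0" unfolding left_diff_distrib using z by simp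
    moreover have "cis t - cis (- t) \<noteq> 0" using s by (simp add: complex_eq_iff)
    ultimately have y0: "y 0 = 0" by simp
    then have "y 1 = 0" using z(1) by simp
    then show False using sine_recurrence[of r y t k, OF rec y0] nz s by simp
  qed
qed

lemma gunit_cis:
  assumes "cis a \<in> gunit" "0 < a" "a < pi"
  shows "a = pi / 2"
proof -
  have s: "sin a > 0" using assms(2,3) by (rule sin_gt_zero)
  then have "cos a = 0" using assms(1) by (auto simp: gunit_def complex_eq_iff)
  then show ?thesis using assms(2,3) by (metis arccos_0 arccos_cos less_imp_le)
qed

lemma sum_two:
  fixes f :: "nat \<Rightarrow> 'b :: comm_monoid_add"
  assumes "s < r" "p < r" "s \<noteq> p" "\<And>j. j < r \<Longrightarrow> j \<noteq> s \<Longrightarrow> j \<noteq> p \<Longrightarrow> f j = 0"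
  shows "(\<Sum>j<r. f j) = f s + f p"
proof -
  have "(\<Sum>j<r. f j) = (\<Sum>j\<in>{s, p}. f j)"
    using assms by (intro sum.mono_neutral_right) auto
  then show ?thesis using assms(3) by simp
qed

lemma sum_one:
  fixes f :: "nat \<Rightarrow> 'b :: comm_monoid_add"
  assumes "s < r" "\<And>j. j < r \<Longrightarrow> j \<noteq> s \<Longrightarrow> f j = 0"
  shows "(\<Sum>j<r. f j) = f s"
proof -
  have "(\<Sum>j<r. f j) = (\<Sum>j\<in>{s}. f j)"
    using assms by (intro sum.mono_neutral_right) auto
  then show ?thesis by simp
qed

section \<open>Induced paths and cycles and their gains\<close>

context gain_graph begin

definition walk :: "'a list \<Rightarrow> bool" where
  "walk ws \<longleftrightarrow> ws \<noteq> [] \<and> distinct ws \<and> (\<forall>i. Suc i < length ws \<longrightarrow> (ws ! i, ws ! Suc i) \<in> adj)"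

definition induced_path :: "'a list \<Rightarrow> bool" where
  "induced_path ws \<longleftrightarrow> walk ws \<and>
    (\<forall>i<length ws. \<forall>j<length ws. (ws ! i, ws ! j) \<in> adj \<longrightarrow> j = Suc i \<or> i = Suc j)"

definition induced_cycle :: "'a list \<Rightarrow> bool" where
  "induced_cycle ws \<longleftrightarrow> walk ws \<and> 3 \<le> length ws \<and> (ws ! (length ws - 1), ws ! 0) \<in> adj \<and>
    (\<forall>i<length ws. \<forall>j<length ws. (ws ! i, ws ! j) \<in> adj \<longrightarrow>
      j = Suc i \<or> i = Suc j \<or> i = 0 \<and> j = length ws - 1 \<or> i = length ws - 1 \<and> j = 0)"

text \<open>The partial products along a walk; used as a diagonal switching they turn the entries
  between consecutive vertices into 1.\<close>

definition gain :: "'a list \<Rightarrow> nat \<Rightarrow> complex" where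
  "gain ws i = (\<Prod>k<i. h (ws ! k) (ws ! Suc k))"

lemma component_adj: "v \<in> component u \<Longrightarrow> (v, w) \<in> adj \<Longrightarrow> w \<in> component u"
  by (auto simp: component_def intro: rtrancl_into_rtrancl)

lemma adj_sym: "(v, w) \<in> adj \<Longrightarrow> (w, v) \<in> adj"
  using sym_adj by (rule symD)

lemma adj_neq: "(v, w) \<in> adj \<Longrightarrow> v \<noteq> w"
  using loopless by (auto simp: adj_def)

text \<open>Take a longest walk in the component. Its ends have no neighbours outside it by
  maximality, its inner vertices none because two neighbours are on the walk already. So it exhausts
  the component, and at most its two ends can be additionally adjacent.\<close>

lemma path_or_cycle:
  assumes u: "u \<in> V"
    and deg: "\<And>v a b c. v \<in> component u \<Longrightarrow> a \<noteq> b \<Longrightarrow> a \<noteq> c \<Longrightarrow> b \<noteq> c \<Longrightarrow>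
      (v, a) \<in> adj \<Longrightarrow> (v, b) \<in> adj \<Longrightarrow> (v, c) \<in> adj \<Longrightarrow> False"
  shows "\<exists>ws. set ws = component u \<and> (induced_path ws \<or> induced_cycle ws)"
proof -
  define P where "P ws \<longleftrightarrow> walk ws \<and> set ws \<subseteq> component u" for ws
  have CV: "component u \<subseteq> V" using component_closed[OF u] by (simp add: closed_def)
  have bound: "length ws \<le> card V" if "P ws" for ws
  proof -
    have "length ws = card (set ws)" using that by (simp add: P_def walk_def distinct_card)
    also have "\<dots> \<le> card V" using that CV finV by (intro card_mono) (auto simp: P_def)
    finally show ?thesis .
  qed
  have "P [u]" by (simp add: P_def walk_def component_def)
  then obtain ws where ws: "P ws" and mx: "\<And>ws'. P ws' \<Longrightarrow> length ws' \<le> length ws"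
    using ex_has_greatest_nat[of P "[u]" length "Suc (card V)"] bound by (metis le_imp_less_Suc)
  define r where "r = length ws"
  have w: "ws \<noteq> []" "distinct ws" "\<And>i. Suc i < r \<Longrightarrow> (ws ! i, ws ! Suc i) \<in> adj" "set ws \<subseteq> component u"
    using ws by (auto simp: P_def walk_def r_def)
  have r0: "0 < r" using w(1) by (simp add: r_def)
  have inC: "ws ! i \<in> component u" if "i < r" for i using that w(4) by (auto simp: r_def)
  have inj: "ws ! i = ws ! j \<longleftrightarrow> i = j" if "i < r" "j < r" for i j
    using that w(2) by (simp add: nth_eq_iff_index_eq r_def)
  have first: "v \<in> set ws" if a: "(ws ! 0, v) \<in> adj" for v
  proof (rule ccontr)
    assume v: "v \<notin> set ws"
    have "walk (v # ws)" unfolding walk_def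
    proof (intro conjI allI impI)
      show "distinct (v # ws)" using v w(2) by simp
      fix i assume i: "Suc i < length (v # ws)"
      show "((v # ws) ! i, (v # ws) ! Suc i) \<in> adj"
        using i w(3) adj_sym[OF a] by (cases i) (auto simp: r_def)
    qed simp
    moreover have "v \<in> component u" using component_adj[OF inC[OF r0] a] .
    ultimately have "P (v # ws)" using w(4) by (simp add: P_def)
    then show False using mx by fastforce
  qed
  have last: "v \<in> set ws" if a: "(ws ! (r - 1), v) \<in> adj" for v
  proof (rule ccontr)
    assume v: "v \<notin> set ws"
    have "walk (ws @ [v])" unfolding walk_def
    proof (intro conjI allI impI)
      show "distinct (ws @ [v])" using v w(2) by simp
      fix i assume i: "Suc i < length (ws @ [v])"
      show "((ws @ [v]) ! i, (ws @ [v]) ! Suc i) \<in> adj"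
      proof (cases "Suc i < r")
        case True
        then show ?thesis using w(3) by (simp add: nth_append r_def)
      next
        case False
        then have "i = r - 1" "Suc i = r" using i by (auto simp: r_def)
        then show ?thesis using a by (simp add: nth_append r_def)
      qed
    qed simp
    moreover have "v \<in> component u" using component_adj[OF inC a] r0 by simp
    ultimately have "P (ws @ [v])" using w(4) by (simp add: P_def)
    then show False using mx by fastforce
  qed
  have interior: "v = ws ! (i - 1) \<or> v = ws ! Suc i" if i: "0 < i" "Suc i < r" and a: "(ws ! i, v) \<in> adj" for i v
  proof -
    have "(ws ! i, ws ! (i - 1)) \<in> adj" using adj_sym[OF w(3)[of "i - 1"]] i by simp
    moreover have "ws ! (i - 1) \<noteq> ws ! Suc i" using i by (subst inj) auto
    ultimately show ?thesis using deg[OF inC[of i], of "ws ! (i - 1)" "ws ! Suc i" v] w(3)[OF i(2)] a i by auto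
  qed
  have closed: "v \<in> set ws" if "i < r" "(ws ! i, v) \<in> adj" for i v
  proof -
    consider "i = 0" | "i = r - 1" | "0 < i" "Suc i < r" using \<open>i < r\<close> by linarith
    then show ?thesis
    proof cases
      case 3
      then have "v = ws ! (i - 1) \<or> v = ws ! Suc i" using interior \<open>(ws ! i, v) \<in> adj\<close> by blast
      then show ?thesis using 3 by (auto simp: r_def)
    qed (use first last \<open>(ws ! i, v) \<in> adj\<close> in auto)
  qed
  have "component u \<subseteq> set ws"
  proof
    fix v assume "v \<in> component u"
    then have uv: "(u, v) \<in> adj\<^sup>*" by (simp add: component_def)
    have "(u, ws ! 0) \<in> adj\<^sup>*" using inC[OF r0] by (simp add: component_def)
    then have "(ws ! 0, v) \<in> adj\<^sup>*" using rtrancl_trans[OF symD[OF sym_rtrancl[OF sym_adj]] uv] by blast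
    then show "v \<in> set ws"
    proof (induction rule: rtrancl_induct)
      case base
      then show ?case using r0 by (simp add: r_def)
    next
      case (step y z)
      then show ?case using closed by (metis in_set_conv_nth r_def)
    qed
  qed
  then have set: "set ws = component u" using w(4) by blast
  have pairs: "j = Suc i \<or> i = Suc j \<or> i = 0 \<and> j = r - 1 \<or> i = r - 1 \<and> j = 0"
    if ij: "i < r" "j < r" and a: "(ws ! i, ws ! j) \<in> adj" for i j
  proof -
    consider "0 < i" "Suc i < r" | "0 < j" "Suc j < r" | "(i = 0 \<or> i = r - 1)" "(j = 0 \<or> j = r - 1)" using ij by linarith
    then show ?thesis
    proof cases
      case 1
      then show ?thesis using interior[OF 1 a] ij inj[of j "i - 1"] inj[of j "Suc i"] by auto
    next
      case 2
      then show ?thesis using interior[OF 2 adj_sym[OF a]] ij inj[of i "j - 1"] inj[of i "Suc j"] by auto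
    next
      case 3
      moreover have "i \<noteq> j" using adj_neq[OF a] by auto
      ultimately show ?thesis by auto
    qed
  qed
  have wk: "walk ws" using ws by (simp add: P_def)
  show ?thesis
  \<comment> \<open>On two vertices the adjacency of the ends is the edge of the path itself, so
    this case counts as a path.\<close>
  proof (cases "3 \<le> r \<and> (ws ! (r - 1), ws ! 0) \<in> adj")
    case True
    then have "induced_cycle ws" using wk pairs by (simp add: induced_cycle_def r_def)
    then show ?thesis using set by blast
  next
    case False
    have "j = Suc i \<or> i = Suc j" if ij: "i < r" "j < r" and a: "(ws ! i, ws ! j) \<in> adj" for i j
    proof (rule ccontr)
      assume neg: "\<not> ?thesis"
      then consider "i = 0" "j = r - 1" | "i = r - 1" "j = 0" using pairs[OF ij a] by blast
      then have "(ws ! (r - 1), ws ! 0) \<in> adj" using a adj_sym by cases auto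
      then have "r < 3" using False by simp
      moreover have "i \<noteq> j" using adj_neq[OF a] by auto
      ultimately show False using neg ij by linarith
    qed
    then have "induced_path ws" using wk by (simp add: induced_path_def r_def)
    then show ?thesis using set by blast
  qed
qed

lemma adj_gunit: "(v, w) \<in> adj \<Longrightarrow> h v w \<in> gunit"
  using entry[of v w] by (auto simp: adj_def)

lemma gain_gunit: "walk ws \<Longrightarrow> i < length ws \<Longrightarrow> gain ws i \<in> gunit"
proof (induction i)
  case (Suc i)
  then have "h (ws ! i) (ws ! Suc i) \<in> gunit" by (intro adj_gunit) (simp add: walk_def)
  then show ?case using Suc by (auto simp: gain_def)
qed (simp add: gain_def gunit_def)

lemma gain_Suc: "gain ws (Suc i) = gain ws i * h (ws ! i) (ws ! Suc i)"
  by (simp add: gain_def)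

lemma gain_step:
  assumes "walk ws" "Suc i < length ws"
  shows "gain ws i * h (ws ! i) (ws ! Suc i) = gain ws (Suc i)" "gain ws (Suc i) * h (ws ! Suc i) (ws ! i) = gain ws i"
proof -
  show "gain ws i * h (ws ! i) (ws ! Suc i) = gain ws (Suc i)" by (simp add: gain_Suc)
  have "h (ws ! i) (ws ! Suc i) \<in> gunit" using assms by (intro adj_gunit) (simp add: walk_def)
  then have "h (ws ! i) (ws ! Suc i) * h (ws ! Suc i) (ws ! i) = 1"
    using herm[of "ws ! Suc i" "ws ! i"] gunit_mult_cnj by simp
  then show "gain ws (Suc i) * h (ws ! Suc i) (ws ! i) = gain ws i" by (simp add: gain_Suc mult.assoc)
qed

lemma set_walk_V: "walk ws \<Longrightarrow> 2 \<le> length ws \<Longrightarrow> set ws \<subseteq> V"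
proof
  fix v assume w: "walk ws" "2 \<le> length ws" and "v \<in> set ws"
  then obtain i where i: "i < length ws" "v = ws ! i" by (auto simp: in_set_conv_nth)
  show "v \<in> V"
  proof (cases "Suc i < length ws")
    case True
    then show ?thesis using w i by (auto simp: walk_def adj_def)
  next
    case False
    then have "Suc (i - 1) < length ws" "Suc (i - 1) = i" using w(2) i(1) by auto
    then show ?thesis using w(1) i by (auto simp: walk_def adj_def dest!: spec[of _ "i - 1"])
  qed
qed

lemma path_ev:
  assumes p: "induced_path ws" and V: "set ws \<subseteq> V" and e: "ev h (set ws) (of_real (2 * cos t))" and s: "sin t \<noteq> 0"
  shows "sin (real (Suc (length ws)) * t) = 0"
proof -
  let ?r = "length ws"
  obtain x v where x: "v \<in> set ws" "x v \<noteq> 0" "\<And>w. w \<in> set ws \<Longrightarrow> (\<Sum>v\<in>set ws. h w v * x v) = of_real (2 * cos t) * x w"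
    using e by (auto simp: ev_def)
  have wk: "walk ws" and ad: "\<And>i j. i < ?r \<Longrightarrow> j < ?r \<Longrightarrow> (ws ! i, ws ! j) \<in> adj \<Longrightarrow> j = Suc i \<or> i = Suc j"
    using p by (auto simp: induced_path_def)
  have di: "distinct ws" using wk by (simp add: walk_def)
  have h0: "h (ws ! i) (ws ! j) = 0" if "i < ?r" "j < ?r" "j \<noteq> Suc i" "i \<noteq> Suc j" for i j
  proof -
    have "(ws ! i, ws ! j) \<notin> adj" using ad[OF that(1,2)] that(3,4) by blast
    moreover have "ws ! i \<in> V" "ws ! j \<in> V" using V nth_mem that(1,2) by blast+
    ultimately show ?thesis by (simp add: adj_def)
  qed
  \<comment> \<open>The gain removes the entries of \<open>h\<close>; the shift of the index by one
    makes room for the boundary zeros at 0 and \<open>length ws + 1\<close>.\<close>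
  define y where "y k = (if k = 0 \<or> ?r < k then 0 else gain ws (k - 1) * x (ws ! (k - 1)))" for k
  have rec: "y i + y (Suc (Suc i)) = of_real (2 * cos t) * y (Suc i)" if i: "i < ?r" for i
  proof -
    define F where "F j = gain ws i * h (ws ! i) (ws ! j) * x (ws ! j)" for j
    have F0: "F j = 0" if "j < ?r" "j \<noteq> Suc i" "i \<noteq> Suc j" for j
      using h0[OF i that] by (simp add: F_def)
    have FS: "F (Suc i) = y (Suc (Suc i))" if "Suc i < ?r"
      using that gain_step(1)[OF wk that] by (simp add: F_def y_def)
    have FP: "F (i - 1) = y i" if "0 < i"
      using that i gain_step(2)[OF wk, of "i - 1"] by (simp add: F_def y_def)
    have "of_real (2 * cos t) * y (Suc i) = gain ws i * (of_real (2 * cos t) * x (ws ! i))"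
      using i by (simp add: y_def)
    also have "\<dots> = gain ws i * (\<Sum>v\<in>set ws. h (ws ! i) v * x v)" using x(3)[of "ws ! i"] i by simp
    also have "\<dots> = (\<Sum>j<?r. F j)"
      unfolding sum_nth[OF di] sum_distrib_left by (simp add: F_def mult.assoc)
    also have "\<dots> = y i + y (Suc (Suc i))"
    proof (cases "0 < i")
      case True
      note i0 = True
      show ?thesis
      proof (cases "Suc i < ?r")
        case True
        have "(\<Sum>j<?r. F j) = F (i - 1) + F (Suc i)"
          using i i0 True F0 by (intro sum_two) auto
        then show ?thesis using FS[OF True] FP[OF i0] by simp
      next
        case False
        then have "y (Suc (Suc i)) = 0" by (simp add: y_def)
        moreover have "(\<Sum>j<?r. F j) = F (i - 1)"
          using i i0 False F0 by (intro sum_one) auto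
        ultimately show ?thesis using FP[OF i0] by simp
      qed
    next
      case False
      then have i0: "i = 0" "y i = 0" by (auto simp: y_def)
      show ?thesis
      proof (cases "Suc i < ?r")
        case True
        have "(\<Sum>j<?r. F j) = F (Suc i)"
          using i i0 True F0 by (intro sum_one) auto
        then show ?thesis using FS[OF True] i0 by simp
      next
        case False
        then have "y (Suc (Suc i)) = 0" by (simp add: y_def)
        moreover have "(\<Sum>j<?r. F j) = 0"
          using i i0 False F0 by (intro sum.neutral) auto
        ultimately show ?thesis using i0 by simp
      qed
    qed
    finally show ?thesis ..
  qed
  obtain k where k: "k < ?r" "v = ws ! k" using x(1) by (auto simp: in_set_conv_nth)
  have "y (Suc k) \<noteq> 0" using k x(2) gunit_nonzero[OF gain_gunit[OF wk k(1)]] by (simp add: y_def)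
  then show ?thesis using path_recurrence[of ?r y t "Suc k", OF rec _ _ s] k(1) by (simp add: y_def)
qed

text \<open>The product of the entries once around the cycle, which switching leaves
  unchanged.\<close>

definition holonomy :: "'a list \<Rightarrow> complex" where
  "holonomy ws = gain ws (length ws - 1) * h (ws ! (length ws - 1)) (ws ! 0)"

lemma cycle_ev:
  assumes p: "induced_cycle ws" and e: "ev h (set ws) (of_real (2 * cos t))" and s: "sin t \<noteq> 0"
  shows "holonomy ws = cis (real (length ws) * t) \<or> holonomy ws = cis (- (real (length ws) * t))"
proof -
  let ?r = "length ws"
  obtain x v where x: "v \<in> set ws" "x v \<noteq> 0" "\<And>w. w \<in> set ws \<Longrightarrow> (\<Sum>v\<in>set ws. h w v * x v) = of_real (2 * cos t) * x w"
    using e by (auto simp: ev_def)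
  have wk: "walk ws" and r3: "3 \<le> ?r" and cl: "(ws ! (?r - 1), ws ! 0) \<in> adj"
    and ad: "\<And>i j. i < ?r \<Longrightarrow> j < ?r \<Longrightarrow> (ws ! i, ws ! j) \<in> adj \<Longrightarrow>
      j = Suc i \<or> i = Suc j \<or> i = 0 \<and> j = ?r - 1 \<or> i = ?r - 1 \<and> j = 0"
    using p unfolding induced_cycle_def by blast+
  have V: "set ws \<subseteq> V" using set_walk_V[OF wk] r3 by simp
  have di: "distinct ws" using wk by (simp add: walk_def)
  define z where "z i = gain ws i * x (ws ! i)" for i
  define \<gamma> where "\<gamma> = holonomy ws"
  have gu: "gain ws (?r - 1) \<in> gunit" using gain_gunit[OF wk] r3 by simp
  have \<gamma>u: "\<gamma> \<in> gunit" using gu adj_gunit[OF cl] by (auto simp: \<gamma>_def holonomy_def)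
  \<comment> \<open>Continued by one step at each end so that a full turn multiplies by \<gamma>;
    backwards this means multiplication by the conjugate, the inverse of the unit \<gamma>.\<close>
  define y where "y k = (if k = 0 then cnj \<gamma> * z (?r - 1) else if k \<le> ?r then z (k - 1) else \<gamma> * z 0)" for k
  have rec: "y i + y (Suc (Suc i)) = of_real (2 * cos t) * y (Suc i)" if i: "i < ?r" for i
  proof -
    define F where "F j = gain ws i * h (ws ! i) (ws ! j) * x (ws ! j)" for j
    define su where "su = (if Suc i < ?r then Suc i else 0)"
    define pr where "pr = (if 0 < i then i - 1 else ?r - 1)"
    have F0: "F j = 0" if j: "j < ?r" "j \<noteq> su" "j \<noteq> pr" for j
    proof -
      have "\<not> (j = Suc i \<or> i = Suc j \<or> i = 0 \<and> j = ?r - 1 \<or> i = ?r - 1 \<and> j = 0)"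
        using j i by (auto simp: su_def pr_def split: if_splits)
      then have "(ws ! i, ws ! j) \<notin> adj" using ad[OF i j(1)] by blast
      moreover have "ws ! i \<in> V" "ws ! j \<in> V" using V nth_mem i j(1) by blast+
      ultimately have "h (ws ! i) (ws ! j) = 0" by (simp add: adj_def)
      then show ?thesis by (simp add: F_def)
    qed
    have FS: "F su = y (Suc (Suc i))"
    proof (cases "Suc i < ?r")
      case True
      then show ?thesis using gain_step(1)[OF wk True] by (simp add: F_def su_def y_def z_def)
    next
      case False
      then have "i = ?r - 1" "Suc i = ?r" using i by auto
      then show ?thesis by (simp add: F_def su_def y_def z_def \<gamma>_def holonomy_def gain_def mult.assoc)
    qed
    have FP: "F pr = y i"
    proof (cases "0 < i")
      case True
      then show ?thesis using i gain_step(2)[OF wk, of "i - 1"] by (simp add: F_def pr_def y_def z_def)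
    next
      case False
      then have i0: "i = 0" by simp
      have "cnj \<gamma> * z (?r - 1) = cnj (gain ws (?r - 1)) * gain ws (?r - 1) * (cnj (h (ws ! (?r - 1)) (ws ! 0)) * x (ws ! (?r - 1)))"
        by (simp add: \<gamma>_def holonomy_def z_def mult_ac)
      also have "\<dots> = h (ws ! 0) (ws ! (?r - 1)) * x (ws ! (?r - 1))"
        using gunit_mult_cnj(2)[OF gu] herm[of "ws ! (?r - 1)" "ws ! 0"] by simp
      finally show ?thesis using i0 by (simp add: F_def pr_def y_def gain_def)
    qed
    have "of_real (2 * cos t) * y (Suc i) = gain ws i * (of_real (2 * cos t) * x (ws ! i))"
      using i by (simp add: y_def z_def)
    also have "\<dots> = gain ws i * (\<Sum>v\<in>set ws. h (ws ! i) v * x v)" using x(3)[of "ws ! i"] i by simp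
    also have "\<dots> = (\<Sum>j<?r. F j)"
      unfolding sum_nth[OF di] sum_distrib_left by (simp add: F_def mult.assoc)
    also have "\<dots> = F pr + F su"
    proof (rule sum_two)
      show "pr < ?r" "su < ?r" "pr \<noteq> su" using i r3 by (auto simp: pr_def su_def split: if_splits)
    qed (use F0 in auto)
    finally show ?thesis unfolding FS FP ..
  qed
  have y: "y ?r = \<gamma> * y 0" "y (Suc ?r) = \<gamma> * y 1"
    using r3 gunit_mult_cnj(1)[OF \<gamma>u] by (auto simp: y_def simp flip: mult.assoc)
  obtain k where k: "k < ?r" "v = ws ! k" using x(1) by (auto simp: in_set_conv_nth)
  have nz: "y (Suc k) \<noteq> 0" using k x(2) gunit_nonzero[OF gain_gunit[OF wk k(1)]] by (simp add: y_def z_def)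
  show ?thesis using cycle_recurrence[OF rec y s _ nz] k(1) unfolding \<gamma>_def by simp
qed

lemma holonomy_gunit: "induced_cycle ws \<Longrightarrow> holonomy ws \<in> gunit"
  unfolding holonomy_def induced_cycle_def
  using gain_gunit[of ws "length ws - 1"] adj_gunit by auto

text \<open>The largest eigenvalue is \<open>2 cos t\<close> with \<open>t = pi / (n + 1)\<close>.
  On a path of \<open>r \<le> n\<close> vertices \<open>sin ((r + 1) t) = 0\<close> forces
  \<open>r = n\<close>. On a cycle of \<open>r\<close> vertices the holonomy is
  \<open>cis (r t)\<close> or its conjugate with \<open>0 < r t < pi\<close>; having it a Gaussian
  unit forces \<open>r t = pi / 2\<close>.\<close>

lemma top_component:
  assumes ps: "pathspec n" and m: "17 \<le> m" "odd m" "n + 1 = m \<or> n + 1 = 2 * m" and tf: twin_free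
  shows "\<exists>u\<in>V. \<exists>ws. set ws = component u \<and>
    (induced_path ws \<and> length ws = n \<or>
     induced_cycle ws \<and> 2 * length ws = n + 1 \<and> (holonomy ws = \<i> \<or> holonomy ws = - \<i>))"
proof -
  have n: "1 \<le> n" using m by auto
  define t where "t = pi / real (n + 1)"
  have ch: "ch n 1 = 2 * cos t" by (simp add: ch_def t_def)
  have t0: "0 < t" "t < pi" using n by (auto simp: t_def divide_less_eq)
  then have s: "sin t \<noteq> 0" using sin_gt_zero by fastforce
  have "ev h V (of_real (ch n 1))" using ps n by (auto simp: pathspec_def)
  then obtain u where u: "u \<in> V" "ev h (component u) (of_real (ch n 1))" using component_ev by blast
  have "\<exists>ws. set ws = component u \<and> (induced_path ws \<or> induced_cycle ws)"
  proof (rule path_or_cycle[OF u(1)])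
    fix v a b c
    assume "v \<in> component u" "a \<noteq> b" "a \<noteq> c" "b \<noteq> c" "(v, a) \<in> adj" "(v, b) \<in> adj" "(v, c) \<in> adj"
    then show False by (rule degree_le_two[OF ps m tf u])
  qed
  then obtain ws where ws: "set ws = component u" "induced_path ws \<or> induced_cycle ws" by blast
  have CV: "set ws \<subseteq> V" using component_closed[OF u(1)] ws(1) by (simp add: closed_def)
  have e: "ev h (set ws) (of_real (2 * cos t))" using u(2) unfolding ws(1) ch .
  have "distinct ws" using ws(2) by (auto simp: induced_path_def induced_cycle_def walk_def)
  then have "length ws = card (set ws)" by (simp add: distinct_card)
  then have le: "length ws \<le> n" using card_mono[OF finV CV] ps by (simp add: pathspec_def)
  have pos: "0 < length ws" using ws(2) by (auto simp: induced_path_def induced_cycle_def walk_def)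
  have tn: "real (n + 1) * t = pi" unfolding t_def by simp
  show ?thesis
  proof (cases "induced_path ws")
    case True
    have z: "sin (real (Suc (length ws)) * t) = 0" by (rule path_ev[OF True CV e s])
    have "length ws = n"
    proof (rule ccontr)
      assume "length ws \<noteq> n"
      then have "real (Suc (length ws)) < real (n + 1)" using le by simp
      then have "real (Suc (length ws)) * t < real (n + 1) * t" using t0(1) by (rule mult_strict_right_mono)
      then have "real (Suc (length ws)) * t < pi" unfolding tn .
      then have "0 < sin (real (Suc (length ws)) * t)" using t0(1) by (intro sin_gt_zero) auto
      then show False using z by simp
    qed
    then show ?thesis using True ws(1) u(1) by blast
  next
    case False
    then have c: "induced_cycle ws" using ws(2) by blast
    define a where "a = real (length ws) * t"
    have "real (length ws) * t < real (n + 1) * t" using le t0(1) by (intro mult_strict_right_mono) auto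
    then have a: "0 < a" "a < pi" using pos t0(1) unfolding tn a_def by simp_all
    have hol: "holonomy ws = cis a \<or> holonomy ws = cis (- a)" unfolding a_def by (rule cycle_ev[OF c e s])
    then have "cis a \<in> gunit" using holonomy_gunit[OF c] gunit_cnj[of "cis (- a)"] by (auto simp: cis_cnj)
    then have a2: "a = pi / 2" using a by (rule gunit_cis)
    have "real (2 * length ws) * t = real (n + 1) * t" using a2 tn by (simp add: a_def)
    then have "real (2 * length ws) = real (n + 1)" using t0(1) by (simp only: mult_cancel_right) simp
    then have "2 * length ws = n + 1" by (simp only: of_nat_eq_iff)
    moreover have "cis (pi / 2) = \<i>" "cis (- (pi / 2)) = - \<i>" by (auto simp: complex_eq_iff)
    ultimately show ?thesis using hol c ws(1) u(1) unfolding a2 by auto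
  qed
qed

section \<open>Twins and the determinant, and the removal of the cycle\<close>

lemma pathspec_char_poly:
  assumes ps: "pathspec n" and vs: "distinct vs" "set vs = V"
  shows "char_poly (mat_of h vs) = map_poly of_int (cheb n)"
proof -
  let ?M = "(\<lambda>j. complex_of_real (ch n j)) ` {1..n}"
  have len: "length vs = n" using ps distinct_card[OF vs(1)] vs(2) by (simp add: pathspec_def)
  have "card ?M = n" using card_image[OF ch_inj_complex[of "{1..n}" n]] by auto
  then show ?thesis unfolding cheb_prod
    using ps by (intro char_poly_prod[OF vs(1)]) (auto simp: len vs(2) pathspec_def)
qed

lemma twin_freeI:
  assumes ps: "pathspec n" and n: "n + 1 = 4 * k + 2"
  shows twin_free
  unfolding twin_free_def
proof (intro ballI impI, rule ccontr)
  fix a b \<epsilon> assume ab: "a \<in> V" "b \<in> V" "\<epsilon> \<in> gunit" "a \<noteq> b" and "\<not> (\<exists>w\<in>V. (h w a + \<epsilon> * h w b) / 2 \<notin> gint)"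
  then have tw: "(h w a + \<epsilon> * h w b) / 2 \<in> gint" if "w \<in> V" for w using that by blast
  obtain vs where vs: "set vs = V" "distinct vs" using finite_distinct_list[OF finV] by blast
  define A where "A = - char_matrix (mat_of h vs) 2"
  have A: "A \<in> carrier_mat (length vs) (length vs)"
    unfolding A_def using mat_of_carrier[of h vs] by simp
  have Aij: "A $$ (i, j) = (if i = j then 2 else 0) - h (vs ! i) (vs ! j)" if "i < length vs" "j < length vs" for i j
    using that by (simp add: A_def char_matrix_def mat_of_def)
  have "det A = poly (char_poly (mat_of h vs)) 2"
    unfolding A_def by (rule char_poly_matrix[OF mat_of_carrier, symmetric])
  also have "\<dots> = of_nat (n + 1)"
    unfolding pathspec_char_poly[OF ps vs(2,1)] using cheb_at_2[of n] by (simp only: ieval_def)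
  finally have det: "det A = of_nat (4 * k + 2)" using n by simp
  obtain i j where ij: "i < length vs" "j < length vs" "a = vs ! i" "b = vs ! j"
    using ab(1,2) vs(1) by (metis in_set_conv_nth)
  have "i \<noteq> j" using ab(4) ij by auto
  \<comment> \<open>The congruence at \<open>w = a\<close> would make half a unit integral. Thus
    twins are not adjacent, and the diagonal entry required by \<open>det_twins\<close> is 2 + 2 =
    4.\<close>
  have hab: "h a b = 0"
  proof (rule ccontr)
    assume "h a b \<noteq> 0"
    then have "cmod (\<epsilon> * h a b) = 1" using entry[of a b] gunit_norm ab(3) by (auto simp: norm_mult)
    moreover have "\<epsilon> * h a b / 2 \<in> gint" using tw[OF ab(1)] by (simp add: loopless)
    moreover have "(cmod (\<epsilon> * h a b / 2))\<^sup>2 = (cmod (\<epsilon> * h a b))\<^sup>2 / 4" by (simp add: norm_divide power_divide)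
    ultimately have "\<epsilon> * h a b / 2 = 0" by (intro gint_norm_lt_1) simp_all
    then show False using \<open>h a b \<noteq> 0\<close> gunit_nonzero[OF ab(3)] by simp
  qed
  then have hba: "h b a = 0" using h_nz_sym by blast
  have "det A / 4 \<in> gint"
  proof (rule det_twins[OF A _ _ ij(1,2) \<open>i \<noteq> j\<close> gunit_gint[OF ab(3)]])
    show "A $$ (p, q) \<in> gint" if "p < length vs" "q < length vs" for p q
      using h_gint[of "vs ! p" "vs ! q"] by (simp add: Aij[OF that] gint_diff)
    show "A $$ (q, p) = cnj (A $$ (p, q))" if "p < length vs" "q < length vs" for p q
      using herm[of "vs ! q" "vs ! p"] by (simp add: Aij[OF that] Aij[OF that(2,1)])
    show "(A $$ (w, i) + \<epsilon> * A $$ (w, j)) / 2 \<in> gint" if w: "w < length vs" for w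
    proof -
      have "(A $$ (w, i) + \<epsilon> * A $$ (w, j)) / 2 =
          (if w = i then 1 else 0) + \<epsilon> * (if w = j then 1 else 0) - (h (vs ! w) a + \<epsilon> * h (vs ! w) b) / 2"
        unfolding Aij[OF w ij(1)] Aij[OF w ij(2)] ij(3,4) by (simp add: field_simps)
      also have "\<dots> \<in> gint" using tw[of "vs ! w"] w vs(1) ab(3) by (intro gint_diff gint_add gint_mult) auto
      finally show ?thesis .
    qed
    show "A $$ (i, i) + \<epsilon> * A $$ (i, j) + cnj \<epsilon> * (A $$ (j, i) + \<epsilon> * A $$ (j, j)) = 4"
      using \<open>i \<noteq> j\<close> hab hba gunit_mult_cnj(2)[OF ab(3)] ij
      by (simp add: Aij loopless flip: mult.assoc)
  qed
  then obtain l where "Re (det A / 4) = of_int l" unfolding gint_def by (auto elim: Ints_cases)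
  then have "real (4 * k + 2) / 4 = of_int l" unfolding det by simp
  then have "real_of_int (4 * int k + 2) = of_int (4 * l)" by simp
  then have "4 * int k + 2 = 4 * l" by (simp only: of_int_eq_iff)
  then show False by presburger
qed

lemma subgraph: "C \<subseteq> V \<Longrightarrow> gain_graph C h"
  by (rule gain_graph.intro[OF finite_subset[OF _ finV] entry herm loopless])

text \<open>An eigenvalue with even index \<open>2 j\<close> on the cycle would give it the real
  holonomy \<open>cis (pi j)\<close>, but the holonomy is \<plusminus>\<i>. These eigenvalues
  therefore live on the rest, and cancelling 2 in the fraction turns them into those of the path on
  \<open>length cs - 1\<close> vertices.\<close>

lemma remove_cycle:
  assumes ps: "pathspec n" and C: "closed (set cs)" and c: "induced_cycle cs" "2 * length cs = n + 1"
    and hol: "holonomy cs = \<i> \<or> holonomy cs = - \<i>"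
  shows "gain_graph.pathspec (V - set cs) h (length cs - 1)"
proof -
  interpret D: gain_graph "V - set cs" h by (rule subgraph) blast
  have "distinct cs" using c(1) by (simp add: induced_cycle_def walk_def)
  then have "card (V - set cs) = card V - length cs"
    using C finV by (simp add: closed_def card_Diff_subset distinct_card)
  then have card: "card (V - set cs) = length cs - 1" using ps c(2) by (simp add: pathspec_def)
  have "ev h (V - set cs) (of_real (ch (length cs - 1) j))" if j: "1 \<le> j" "j \<le> length cs - 1" for j
  proof -
    define t where "t = pi * real (2 * j) / real (n + 1)"
    have r: "real (length cs) * 2 = real (n + 1)" unfolding c(2)[symmetric] by simp
    have tr: "real (length cs) * t = pi * real j"
    proof -
      have "real (n + 1) * t = pi * real (2 * j)" unfolding t_def by simp
      then have "2 * (real (length cs) * t) = 2 * (pi * real j)"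
        unfolding r[symmetric] of_nat_mult of_nat_numeral by (simp only: mult_ac)
      then show ?thesis by simp
    qed
    have eq: "ch n (2 * j) = ch (length cs - 1) j"
    proof -
      have l: "length cs - 1 + 1 = length cs" using j by simp
      have "pi * real (2 * j) / real (2 * length cs) = pi * real j / real (length cs)" by simp
      then show ?thesis unfolding ch_def l c(2) by simp
    qed
    have jn: "1 \<le> 2 * j" "2 * j \<le> n" using j c(2) by auto
    then have "ev h V (of_real (ch n (2 * j)))" using ps by (auto simp: pathspec_def)
    moreover have "\<not> ev h (set cs) (of_real (ch n (2 * j)))"
    proof
      assume "ev h (set cs) (of_real (ch n (2 * j)))"
      then have e: "ev h (set cs) (of_real (2 * cos t))" by (simp add: ch_def t_def)
      have "0 < t" unfolding t_def using jn by (intro divide_pos_pos mult_pos_pos) auto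
      moreover have "t < pi"
      proof -
        have "pi * real (2 * j) < pi * real (n + 1)" using jn by (intro mult_strict_left_mono) auto
        then show ?thesis unfolding t_def by (simp add: divide_less_eq)
      qed
      ultimately have "sin t \<noteq> 0" using sin_gt_zero[of t] by simp
      from cycle_ev[OF c(1) e this]
      have "holonomy cs = cis (pi * real j) \<or> holonomy cs = cis (- (pi * real j))" unfolding tr .
      moreover have "Im (cis (pi * real j)) = 0" by (simp add: sin_npi2)
      ultimately have "Im (holonomy cs) = 0" by auto
      then show False using hol by auto
    qed
    ultimately show ?thesis using ev_split[OF C] unfolding eq by blast
  qed
  then show ?thesis using card by (simp add: D.pathspec_def)
qed

text \<open>A witness against \<open>a\<close> and \<open>b\<close> being twins has a non-zero entry
  at one of them, so it cannot belong to the closed set \<open>C\<close>.\<close>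

lemma twin_free_closed:
  assumes tf: twin_free and C: "closed C"
  shows "gain_graph.twin_free (V - C) h"
proof -
  interpret D: gain_graph "V - C" h by (rule subgraph) blast
  show ?thesis
    unfolding D.twin_free_def
  proof (intro ballI impI)
    fix a b \<epsilon> assume ab: "a \<in> V - C" "b \<in> V - C" "\<epsilon> \<in> gunit" "a \<noteq> b"
    then obtain w where w: "w \<in> V" "(h w a + \<epsilon> * h w b) / 2 \<notin> gint" using tf unfolding twin_free_def by blast
    have "w \<notin> C"
    proof
      assume "w \<in> C"
      then have "h w a = 0" "h w b = 0" using C ab by (auto simp: closed_def)
      then show False using w(2) by simp
    qed
    then show "\<exists>w\<in>V - C. (h w a + \<epsilon> * h w b) / 2 \<notin> gint" using w by blast
  qed
qed

text \<open>A numbering and a diagonal switching that exhibit a path. Only \<open>h\<close> and the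
  list occur, not \<open>V\<close>, so the statement transfers verbatim from a subgraph to the whole
  graph.\<close>

definition path_gauge :: "'a list \<Rightarrow> bool" where
  "path_gauge ws \<longleftrightarrow> distinct ws \<and> (\<exists>d. (\<forall>i. d i \<in> gunit) \<and> (\<forall>i<length ws. \<forall>j<length ws.
     h (ws ! i) (ws ! j) = cnj (d i) * (if j = Suc i \<or> i = Suc j then 1 else 0) * d j))"

lemma induced_path_gauge:
  assumes p: "induced_path ws" and V: "set ws \<subseteq> V"
  shows "path_gauge ws"
proof -
  have wk: "walk ws" using p by (simp add: induced_path_def)
  define d where "d i = (if i < length ws then gain ws i else 1)" for i
  have du: "d i \<in> gunit" for i using gain_gunit[OF wk] by (simp add: d_def gunit_def)
  have "h (ws ! i) (ws ! j) = cnj (d i) * (if j = Suc i \<or> i = Suc j then 1 else 0) * d j"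
    if ij: "i < length ws" "j < length ws" for i j
  proof -
    have c: "cnj (gain ws i) * gain ws i = 1" using gunit_mult_cnj gain_gunit[OF wk ij(1)] by blast
    consider "j = Suc i" | "i = Suc j" | "\<not> (j = Suc i \<or> i = Suc j)" by blast
    then show ?thesis
    proof cases
      case 1
      then have "cnj (gain ws i) * gain ws j = (cnj (gain ws i) * gain ws i) * h (ws ! i) (ws ! j)"
        by (simp add: gain_Suc)
      then show ?thesis using ij 1 c by (simp add: d_def)
    next
      case 2
      then have "gain ws j = gain ws i * h (ws ! i) (ws ! j)" using ij gain_step(2)[OF wk, of j] by simp
      then have "cnj (gain ws i) * gain ws j = (cnj (gain ws i) * gain ws i) * h (ws ! i) (ws ! j)"
        by (simp only: mult.assoc)
      then have "cnj (gain ws i) * gain ws j = h (ws ! i) (ws ! j)" by (simp only: c mult_1_left)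
      then show ?thesis using ij 2 by (simp add: d_def)
    next
      case 3
      then have "(ws ! i, ws ! j) \<notin> adj" using p ij by (auto simp: induced_path_def)
      moreover have "ws ! i \<in> V" "ws ! j \<in> V" using V nth_mem ij by blast+
      ultimately show ?thesis using 3 by (simp add: adj_def)
    qed
  qed
  then show ?thesis using wk du unfolding path_gauge_def walk_def by blast
qed

text \<open>The switching concentrates the whole holonomy \<gamma> on the closing pair of
  vertices.\<close>

definition cycle_gauge :: "complex \<Rightarrow> 'a list \<Rightarrow> bool" where
  "cycle_gauge \<gamma> ws \<longleftrightarrow> distinct ws \<and> (\<exists>d. (\<forall>i. d i \<in> gunit) \<and> (\<forall>i<length ws. \<forall>j<length ws.
     h (ws ! i) (ws ! j) = cnj (d i) * (if j = Suc i \<or> i = Suc j then 1 else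
       if i = length ws - 1 \<and> j = 0 then \<gamma> else if i = 0 \<and> j = length ws - 1 then cnj \<gamma> else 0) * d j))"

lemma induced_cycle_gauge:
  assumes p: "induced_cycle ws"
  shows "cycle_gauge (holonomy ws) ws"
proof -
  have wk: "walk ws" and r3: "3 \<le> length ws" using p by (auto simp: induced_cycle_def)
  have V: "set ws \<subseteq> V" using set_walk_V[OF wk] r3 by simp
  define d where "d i = (if i < length ws then gain ws i else 1)" for i
  have du: "d i \<in> gunit" for i using gain_gunit[OF wk] by (simp add: d_def gunit_def)
  have g0: "gain ws 0 = 1" by (simp add: gain_def)
  have "h (ws ! i) (ws ! j) = cnj (d i) * (if j = Suc i \<or> i = Suc j then 1 else
       if i = length ws - 1 \<and> j = 0 then holonomy ws else if i = 0 \<and> j = length ws - 1 then cnj (holonomy ws) else 0) * d j"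
    if ij: "i < length ws" "j < length ws" for i j
  proof -
    have c: "cnj (gain ws i) * gain ws i = 1" using gunit_mult_cnj gain_gunit[OF wk ij(1)] by blast
    consider "j = Suc i" | "i = Suc j" | "i = length ws - 1" "j = 0" | "i = 0" "j = length ws - 1"
      | "\<not> (j = Suc i \<or> i = Suc j \<or> i = 0 \<and> j = length ws - 1 \<or> i = length ws - 1 \<and> j = 0)" by blast
    then show ?thesis
    proof cases
      case 1
      then have "cnj (gain ws i) * gain ws j = (cnj (gain ws i) * gain ws i) * h (ws ! i) (ws ! j)"
        by (simp add: gain_Suc)
      then show ?thesis using ij 1 c by (simp add: d_def)
    next
      case 2
      then have "gain ws j = gain ws i * h (ws ! i) (ws ! j)" using ij gain_step(2)[OF wk, of j] by simp
      then have "cnj (gain ws i) * gain ws j = (cnj (gain ws i) * gain ws i) * h (ws ! i) (ws ! j)"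
        by (simp only: mult.assoc)
      then have "cnj (gain ws i) * gain ws j = h (ws ! i) (ws ! j)" by (simp only: c mult_1_left)
      then show ?thesis using ij 2 by (simp add: d_def)
    next
      case 3
      then have "cnj (d i) * holonomy ws * d j = h (ws ! i) (ws ! j)"
        using ij c by (simp add: d_def g0 holonomy_def flip: mult.assoc)
      \<comment> \<open>With at least three vertices the closing pair is not a pair of consecutive
        vertices.\<close>
      moreover have "length ws - 1 \<noteq> Suc 0" using r3 by arith
      ultimately show ?thesis using 3 by simp
    next
      case 4
      have c': "cnj (gain ws j) * gain ws j = 1" using gunit_mult_cnj gain_gunit[OF wk ij(2)] by blast
      have "cnj (d i) * cnj (holonomy ws) * d j = (cnj (gain ws j) * gain ws j) * cnj (h (ws ! j) (ws ! i))"
        using ij 4 by (simp add: d_def g0 holonomy_def mult_ac)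
      then have "cnj (d i) * cnj (holonomy ws) * d j = h (ws ! i) (ws ! j)"
        using c' herm[of "ws ! i" "ws ! j"] by simp
      moreover have "length ws - 1 \<noteq> Suc 0" "length ws - 1 \<noteq> 0" using r3 by arith+
      ultimately show ?thesis using 4 by simp
    next
      case 5
      then have "(ws ! i, ws ! j) \<notin> adj" using p ij unfolding induced_cycle_def by blast
      moreover have "ws ! i \<in> V" "ws ! j \<in> V" using V nth_mem ij by blast+
      ultimately show ?thesis using 5 by (auto simp: adj_def)
    qed
  qed
  then show ?thesis using wk du unfolding cycle_gauge_def walk_def by blast
qed

text \<open>\<open>top_component\<close> is used with \<open>m = 2 k + 1\<close> throughout: on the
  whole graph \<open>n + 1 = 2 m\<close>, and on what a cycle leaves over
  \<open>n + 1 = m\<close>.\<close>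

theorem path_or_cycle_and_path:
  assumes ps: "pathspec (4 * k + 1)" and k: "8 \<le> k"
  shows "(\<exists>ws. set ws = V \<and> length ws = 4 * k + 1 \<and> path_gauge ws) \<or>
    (\<exists>cs ws. set cs \<union> set ws = V \<and> set cs \<inter> set ws = {} \<and> length cs = 2 * k + 1 \<and> length ws = 2 * k \<and>
      (\<forall>u\<in>set cs. \<forall>v\<in>set ws. h u v = 0) \<and> path_gauge ws \<and> (cycle_gauge \<i> cs \<or> cycle_gauge (- \<i>) cs))"
proof -
  let ?m = "2 * k + 1"
  have m: "17 \<le> ?m" "odd ?m" using k by auto
  have tf: twin_free by (rule twin_freeI[OF ps, of k]) simp
  obtain u ws where u: "u \<in> V" "set ws = component u"
    and ws: "induced_path ws \<and> length ws = 4 * k + 1 \<or>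
     induced_cycle ws \<and> 2 * length ws = 4 * k + 1 + 1 \<and> (holonomy ws = \<i> \<or> holonomy ws = - \<i>)"
    using top_component[OF ps m _ tf] by auto
  have C: "closed (set ws)" unfolding u(2) by (rule component_closed[OF u(1)])
  then have CV: "set ws \<subseteq> V" by (simp add: closed_def)
  from ws show ?thesis
  proof (rule disjE)
    assume "induced_path ws \<and> length ws = 4 * k + 1"
    then have p: "induced_path ws" "length ws = 4 * k + 1" by simp_all
    have "distinct ws" using p(1) by (simp add: induced_path_def walk_def)
    then have "card (set ws) = card V" using p(2) ps by (simp add: distinct_card pathspec_def)
    then have "set ws = V" using CV finV by (simp add: card_subset_eq)
    then show ?thesis using p induced_path_gauge by blast
  next
    assume "induced_cycle ws \<and> 2 * length ws = 4 * k + 1 + 1 \<and> (holonomy ws = \<i> \<or> holonomy ws = - \<i>)"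
    then have c: "induced_cycle ws" "2 * length ws = 4 * k + 1 + 1" and hol: "holonomy ws = \<i> \<or> holonomy ws = - \<i>"
      by simp_all
    interpret D: gain_graph "V - set ws" h by (rule subgraph) blast
    have len: "length ws = 2 * k + 1" using c(2) by simp
    have ps': "D.pathspec (2 * k)" using remove_cycle[OF ps C c hol] len by simp
    have tf': D.twin_free by (rule twin_free_closed[OF tf C])
    obtain u' ws' where u': "u' \<in> V - set ws" "set ws' = D.component u'"
      and ws': "D.induced_path ws' \<and> length ws' = 2 * k \<or>
        D.induced_cycle ws' \<and> 2 * length ws' = 2 * k + 1 \<and> (D.holonomy ws' = \<i> \<or> D.holonomy ws' = - \<i>)"
      using D.top_component[OF ps' m _ tf'] by auto
    \<comment> \<open>Parity excludes a second cycle, so the remainder is a single path.\<close>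
    have "2 * length ws' \<noteq> 2 * k + 1" by presburger
    then have pp: "D.induced_path ws' \<and> length ws' = 2 * k" using ws' by blast
    then have p: "D.induced_path ws'" "length ws' = 2 * k" by simp_all
    have sub: "set ws' \<subseteq> V - set ws" using D.component_closed[OF u'(1)] u'(2) by (simp add: D.closed_def)
    have "distinct ws'" using p(1) by (simp add: D.induced_path_def D.walk_def)
    then have "card (set ws') = card (V - set ws)" using p(2) ps' by (simp add: distinct_card D.pathspec_def)
    then have s: "set ws' = V - set ws" using sub finV by (simp add: card_subset_eq)
    have "D.path_gauge ws'" by (rule D.induced_path_gauge[OF p(1) sub])
    then have "path_gauge ws'" unfolding path_gauge_def D.path_gauge_def .
    moreover have "\<forall>u\<in>set ws. \<forall>v\<in>set ws'. h u v = 0" using C s by (simp add: closed_def)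
    moreover have "cycle_gauge \<i> ws \<or> cycle_gauge (- \<i>) ws" using induced_cycle_gauge[OF c(1)] hol by auto
    moreover have "set ws \<union> set ws' = V" "set ws \<inter> set ws' = {}" using s CV by auto
    ultimately show ?thesis using len p(2) by blast
  qed
qed

end

subsection \<open>Mixed graphs, switching and cospectrality\<close>

lemma mixed_graph_uedge: "mixed_graph X \<Longrightarrow> e \<in> uedges X \<Longrightarrow> \<exists>x\<in>verts X. \<exists>y\<in>verts X. x \<noteq> y \<and> e = {x, y}"
  unfolding mixed_graph_def by (elim conjE) (erule (1) bspec)

lemma mixed_graphD:
  assumes "mixed_graph X"
  shows "finite (verts X)"
    and "{x, y} \<in> uedges X \<Longrightarrow> x \<in> verts X \<and> y \<in> verts X \<and> x \<noteq> y"
    and "(x, y) \<in> arcs X \<Longrightarrow> x \<in> verts X \<and> y \<in> verts X \<and> x \<noteq> y \<and> (y, x) \<notin> arcs X \<and> {x, y} \<notin> uedges X"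
proof -
  show "finite (verts X)" using assms by (simp add: mixed_graph_def)
  show "x \<in> verts X \<and> y \<in> verts X \<and> x \<noteq> y" if xy: "{x, y} \<in> uedges X"
  proof -
    obtain a b where ab: "a \<in> verts X" "b \<in> verts X" "a \<noteq> b" "{x, y} = {a, b}"
      using mixed_graph_uedge[OF assms xy] by (elim bexE conjE)
    from ab(4) have "(x = a \<and> y = b) \<or> (x = b \<and> y = a)" by (simp only: doubleton_eq_iff)
    with ab(1-3) show ?thesis by metis
  qed
  have A: "\<forall>(x, y)\<in>arcs X. x \<in> verts X \<and> y \<in> verts X \<and> x \<noteq> y \<and> (y, x) \<notin> arcs X \<and> {x, y} \<notin> uedges X"
    using assms unfolding mixed_graph_def by (elim conjE)
  show "x \<in> verts X \<and> y \<in> verts X \<and> x \<noteq> y \<and> (y, x) \<notin> arcs X \<and> {x, y} \<notin> uedges X" if xy: "(x, y) \<in> arcs X"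
    using bspec[OF A xy, unfolded prod.case] .
qed

lemma herm_entry_gain_graph:
  assumes X: "mixed_graph X"
  shows "gain_graph (verts X) (herm_entry X)"
proof
  show "finite (verts X)" by (rule mixed_graphD(1)[OF X])
  show "herm_entry X u v \<in> insert 0 gunit" for u v by (auto simp: herm_entry_def gunit_def)
  show "herm_entry X v u = cnj (herm_entry X u v)" for u v
  proof -
    have c: "{v, u} = {u, v}" by (rule insert_commute)
    show ?thesis unfolding herm_entry_def c using mixed_graphD(3)[OF X, of u v] by auto
  qed
  show "herm_entry X u u = 0" for u
    using mixed_graphD(2)[OF X, of u u] mixed_graphD(3)[OF X, of u u] by (auto simp: herm_entry_def)
qed

lemma vert_list:
  assumes "finite V"
  shows "distinct (vert_list V)" "set (vert_list V) = V" "length (vert_list V) = card V"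
proof -
  have "\<exists>vs. distinct vs \<and> set vs = V" using finite_distinct_list[OF assms] by blast
  then have "distinct (vert_list V) \<and> set (vert_list V) = V" unfolding vert_list_def by (rule someI_ex)
  then show d: "distinct (vert_list V)" and s: "set (vert_list V) = V" by simp_all
  show "length (vert_list V) = card V" using distinct_card[OF d] unfolding s by simp
qed

lemma herm_mat_mat_of: "finite (verts X) \<Longrightarrow> herm_mat X = mat_of (herm_entry X) (vert_list (verts X))"
  unfolding herm_mat_def mat_of_def by (simp only: vert_list(3))

text \<open>From right to left, the size of the multiset gives the number of vertices and membership
  gives the eigenvalues. From left to right, distinctness of the \<open>ch n j\<close> determines
  the characteristic polynomial.\<close>

lemma pathspec_spec_H:
  assumes X: "mixed_graph X"
  shows "gain_graph.pathspec (verts X) (herm_entry X) n \<longleftrightarrow>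
    spec_H X = proots (map_poly complex_of_int (cheb n))"
proof -
  interpret gain_graph "verts X" "herm_entry X" by (rule herm_entry_gain_graph[OF X])
  note vl = vert_list[OF finV]
  have hm: "herm_mat X = mat_of (herm_entry X) (vert_list (verts X))" by (rule herm_mat_mat_of[OF finV])
  show ?thesis
  proof
    assume "pathspec n"
    from pathspec_char_poly[OF this vl(1,2)] show "spec_H X = proots (map_poly complex_of_int (cheb n))"
      by (simp add: spec_H_def hm)
  next
    assume sp: "spec_H X = proots (map_poly complex_of_int (cheb n))"
    have deg: "degree (map_poly complex_of_int (cheb n)) = n" using cheb_degree by simp
    have "size (spec_H X) = card (verts X)"
      using degree_monic_char_poly[OF mat_of_carrier, of "herm_entry X" "vert_list (verts X)"]
      by (simp add: spec_H_def hm size_proots_complex vl(3))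
    then have card: "card (verts X) = n" using sp deg by (simp add: size_proots_complex)
    have nz: "char_poly (herm_mat X) \<noteq> 0"
      using degree_monic_char_poly[OF mat_of_carrier, of "herm_entry X" "vert_list (verts X)"] by (auto simp: hm)
    have cz: "map_poly complex_of_int (cheb n) \<noteq> 0"
      using cheb_degree[of n] by auto
    have "ev (herm_entry X) (verts X) (of_real (ch n j))" if j: "1 \<le> j" "j \<le> n" for j
    proof -
      have "\<not> (n + 1) dvd j" using j by (auto dest: dvd_imp_le)
      then have "poly (map_poly complex_of_int (cheb n)) (of_real (ch n j)) = 0"
        using cheb_root by (simp add: ieval_def)
      then have "of_real (ch n j) \<in># proots (map_poly complex_of_int (cheb n))" using cz by simp
      then have "of_real (ch n j) \<in># proots (char_poly (herm_mat X))" using sp by (simp add: spec_H_def)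
      then have "poly (char_poly (herm_mat X)) (of_real (ch n j)) = 0" using nz by simp
      then show ?thesis using ev_root[OF vl(1), of "herm_entry X"] unfolding vl(2) hm by simp
    qed
    then show "pathspec n" using card by (simp add: pathspec_def)
  qed
qed

section \<open>The path, the mixed cycle and their disjoint union\<close>

lemma mpath_edge: "{u, v} \<in> uedges (mpath n) \<longleftrightarrow> (v = Suc u \<or> u = Suc v) \<and> u < n \<and> v < n"
  by (auto simp: mpath_def doubleton_eq_iff)

lemma mpath_mixed: "mixed_graph (mpath n)"
  unfolding mixed_graph_def
proof (intro conjI ballI)
  fix e assume "e \<in> uedges (mpath n)"
  then obtain i where i: "e = {i, Suc i}" "Suc i < n" by (auto simp: mpath_def)
  then show "\<exists>x\<in>verts (mpath n). \<exists>y\<in>verts (mpath n). x \<noteq> y \<and> e = {x, y}"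
    by (intro bexI[of _ i] bexI[of _ "Suc i"]) (auto simp: mpath_def)
qed (auto simp: mpath_def)

lemma herm_entry_mpath: "u < n \<Longrightarrow> v < n \<Longrightarrow> herm_entry (mpath n) u v = (if v = Suc u \<or> u = Suc v then 1 else 0)"
  by (simp add: herm_entry_def mpath_edge) (simp add: mpath_def)

lemma mcycle1_edge: "{u, v} \<in> uedges (mcycle1 n) \<longleftrightarrow> (v = Suc u \<or> u = Suc v) \<and> u < n \<and> v < n"
  by (auto simp: mcycle1_def doubleton_eq_iff)

lemma mcycle1_mixed: "3 \<le> n \<Longrightarrow> mixed_graph (mcycle1 n)"
  unfolding mixed_graph_def
proof (intro conjI ballI)
  fix e assume "e \<in> uedges (mcycle1 n)"
  then obtain i where i: "e = {i, Suc i}" "Suc i < n" by (auto simp: mcycle1_def)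
  then show "\<exists>x\<in>verts (mcycle1 n). \<exists>y\<in>verts (mcycle1 n). x \<noteq> y \<and> e = {x, y}"
    by (intro bexI[of _ i] bexI[of _ "Suc i"]) (auto simp: mcycle1_def)
qed (auto simp: mcycle1_def doubleton_eq_iff)

lemma herm_entry_mcycle1:
  "u < n \<Longrightarrow> v < n \<Longrightarrow> herm_entry (mcycle1 n) u v = (if v = Suc u \<or> u = Suc v then 1 else
    if u = n - 1 \<and> v = 0 then \<i> else if u = 0 \<and> v = n - 1 then - \<i> else 0)"
  by (simp add: herm_entry_def mcycle1_edge) (auto simp: mcycle1_def)

lemma disj_union_edge:
  "{Inl a, Inl a'} \<in> uedges (disj_union X Y) \<longleftrightarrow> {a, a'} \<in> uedges X"
  "{Inr b, Inr b'} \<in> uedges (disj_union X Y) \<longleftrightarrow> {b, b'} \<in> uedges Y"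
  "(Inl a, Inl a') \<in> arcs (disj_union X Y) \<longleftrightarrow> (a, a') \<in> arcs X"
  "(Inr b, Inr b') \<in> arcs (disj_union X Y) \<longleftrightarrow> (b, b') \<in> arcs Y"
  "(Inl a, Inr b) \<notin> arcs (disj_union X Y)" "(Inr b, Inl a) \<notin> arcs (disj_union X Y)"
proof -
  have l: "{Inl a, Inl a'} = Inl ` {a, a'}" "{Inr b, Inr b'} = Inr ` {b, b'}" for a a' b b' by auto
  have i: "inj_on (image Inl) A" "inj_on (image Inr) A'" for A A' by (auto intro!: inj_onI simp: inj_image_eq_iff)
  have n: "Inl ` {a, a'} \<noteq> Inr ` e" "Inr ` {b, b'} \<noteq> Inl ` e'" for e e' by auto
  show "{Inl a, Inl a'} \<in> uedges (disj_union X Y) \<longleftrightarrow> {a, a'} \<in> uedges X"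
    "{Inr b, Inr b'} \<in> uedges (disj_union X Y) \<longleftrightarrow> {b, b'} \<in> uedges Y"
    unfolding l using n by (auto simp: disj_union_def inj_image_eq_iff simp del: image_insert)
qed (auto simp: disj_union_def)

lemma disj_union_mixed_edge: "{Inl a, Inr b} \<notin> uedges (disj_union X Y)" "{Inr b, Inl a} \<notin> uedges (disj_union X Y)"
  by (auto simp: disj_union_def)

lemma herm_entry_disj_union:
  "herm_entry (disj_union X Y) (Inl a) (Inl a') = herm_entry X a a'"
  "herm_entry (disj_union X Y) (Inr b) (Inr b') = herm_entry Y b b'"
  "herm_entry (disj_union X Y) (Inl a) (Inr b) = 0" "herm_entry (disj_union X Y) (Inr b) (Inl a) = 0"
  by (simp_all add: herm_entry_def disj_union_edge disj_union_mixed_edge)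

lemma verts_simps: "verts (mpath n) = {..<n}" "verts (mcycle1 n) = {..<n}"
  "verts (disj_union X Y) = Inl ` verts X \<union> Inr ` verts Y"
  by (auto simp: mpath_def mcycle1_def disj_union_def)

lemma disj_union_mixed:
  assumes X: "mixed_graph X" and Y: "mixed_graph Y"
  shows "mixed_graph (disj_union X Y)"
  unfolding mixed_graph_def
proof (intro conjI ballI)
  show "finite (verts (disj_union X Y))"
    using mixed_graphD(1)[OF X] mixed_graphD(1)[OF Y] by (simp add: verts_simps)
next
  fix e assume "e \<in> uedges (disj_union X Y)"
  then consider f where "f \<in> uedges X" "e = Inl ` f" | f where "f \<in> uedges Y" "e = Inr ` f"
    by (auto simp: disj_union_def)
  then show "\<exists>x\<in>verts (disj_union X Y). \<exists>y\<in>verts (disj_union X Y). x \<noteq> y \<and> e = {x, y}"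
  proof cases
    case 1
    then obtain x y where "x \<in> verts X" "y \<in> verts X" "x \<noteq> y" "f = {x, y}"
      using mixed_graph_uedge[OF X] by meson
    then show ?thesis using 1 by (intro bexI[of _ "Inl x"] bexI[of _ "Inl y"]) (auto simp: verts_simps)
  next
    case 2
    then obtain x y where "x \<in> verts Y" "y \<in> verts Y" "x \<noteq> y" "f = {x, y}"
      using mixed_graph_uedge[OF Y] by meson
    then show ?thesis using 2 by (intro bexI[of _ "Inr x"] bexI[of _ "Inr y"]) (auto simp: verts_simps)
  qed
next
  fix p assume p: "p \<in> arcs (disj_union X Y)"
  then consider x y where "(x, y) \<in> arcs X" "p = (Inl x, Inl y)" | x y where "(x, y) \<in> arcs Y" "p = (Inr x, Inr y)"
    by (auto simp: disj_union_def)
  then show "case p of (x, y) \<Rightarrow> x \<in> verts (disj_union X Y) \<and> y \<in> verts (disj_union X Y) \<and> x \<noteq> y \<and>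
      (y, x) \<notin> arcs (disj_union X Y) \<and> {x, y} \<notin> uedges (disj_union X Y)"
  proof cases
    case 1
    then show ?thesis using mixed_graphD(3)[OF X 1(1)] by (simp add: disj_union_edge verts_simps)
  next
    case 2
    then show ?thesis using mixed_graphD(3)[OF Y 2(1)] by (simp add: disj_union_edge verts_simps)
  qed
qed

section \<open>Explicit eigenvectors\<close>

lemma ev_image:
  assumes inj: "inj_on f S" and h: "\<And>u v. u \<in> S \<Longrightarrow> v \<in> S \<Longrightarrow> h' (f u) (f v) = h u v" and e: "ev h S \<mu>"
  shows "ev h' (f ` S) \<mu>"
proof -
  obtain x w where x: "w \<in> S" "x w \<noteq> 0" "\<And>u. u \<in> S \<Longrightarrow> (\<Sum>v\<in>S. h u v * x v) = \<mu> * x u"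
    using e by (auto simp: ev_def)
  define y where "y = x \<circ> inv_into S f"
  have y: "y (f u) = x u" if "u \<in> S" for u using that inj by (simp add: y_def)
  have "(\<Sum>v\<in>f ` S. h' (f u) v * y v) = \<mu> * y (f u)" if u: "u \<in> S" for u
    unfolding sum.reindex[OF inj] using x(3)[OF u] u y h by simp
  then show ?thesis unfolding ev_def using x(1,2) y by (intro exI[of _ y]) auto
qed

lemma mpath_ev:
  assumes s: "sin t \<noteq> 0" "sin (real (Suc n) * t) = 0" and n: "0 < n"
  shows "ev (herm_entry (mpath n)) {..<n} (of_real (2 * cos t))"
proof -
  \<comment> \<open>A standing wave that vanishes at the fictitious neighbours -1 and
    \<open>n\<close> of the path.\<close>
  define x where "x i = complex_of_real (sin (real (Suc i) * t))" for i
  have tri: "sin (real i * t) + sin (real (Suc (Suc i)) * t) = 2 * cos t * sin (real (Suc i) * t)" for i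
    using sin_add[of "real (Suc i) * t" t] sin_diff[of "real (Suc i) * t" t] by (simp add: algebra_simps)
  have "(\<Sum>v<n. herm_entry (mpath n) u v * x v) = of_real (2 * cos t) * x u" if u: "u < n" for u
  proof -
    define F where "F v = (if v = Suc u \<or> u = Suc v then x v else 0)" for v
    have "(\<Sum>v<n. herm_entry (mpath n) u v * x v) = (\<Sum>v<n. F v)"
      using u by (intro sum.cong) (auto simp: herm_entry_mpath F_def)
    also have "\<dots> = of_real (sin (real u * t)) + of_real (sin (real (Suc (Suc u)) * t))"
    proof (cases "Suc u < n")
      case True
      show ?thesis
      proof (cases u)
        case 0
        have "(\<Sum>v<n. F v) = F (Suc u)" using True 0 by (intro sum_one) (auto simp: F_def)
        then show ?thesis using 0 by (simp add: F_def x_def)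
      next
        case (Suc w)
        have "(\<Sum>v<n. F v) = F w + F (Suc u)" using True Suc by (intro sum_two) (auto simp: F_def)
        then show ?thesis using Suc by (simp add: F_def x_def)
      qed
    next
      case False
      then have nu: "n = Suc u" using u by simp
      then have z: "sin (real (Suc (Suc u)) * t) = 0" using s(2) by simp
      show ?thesis
      proof (cases u)
        case 0
        have "(\<Sum>v<n. F v) = 0" using nu 0 by (intro sum.neutral) (auto simp: F_def)
        then show ?thesis using 0 z by simp
      next
        case (Suc w)
        have "(\<Sum>v<n. F v) = F w" using nu Suc by (intro sum_one) (auto simp: F_def)
        then show ?thesis using Suc z by (simp add: F_def x_def)
      qed
    qed
    also have "\<dots> = of_real (2 * cos t) * x u"
      unfolding x_def of_real_mult[symmetric] of_real_add[symmetric] tri ..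
    finally show ?thesis .
  qed
  moreover have "x 0 \<noteq> 0" using s(1) by (simp add: x_def)
  ultimately show ?thesis unfolding ev_def using n by (intro exI[of _ x]) auto
qed

lemma mcycle1_ev:
  assumes c: "cis (real m * t) = \<i>" and m: "3 \<le> m"
  shows "ev (herm_entry (mcycle1 m)) {..<m} (of_real (2 * cos t))"
proof -
  \<comment> \<open>A running wave; after \<open>m\<close> steps it has acquired the factor \<i>
    contributed by the arc from \<open>m - 1\<close> to 0.\<close>
  define x where "x i = cis (real i * t)" for i :: nat
  have tri: "x i + x (Suc (Suc i)) = of_real (2 * cos t) * x (Suc i)" for i
  proof -
    have e: "of_real (2 * cos t) = cis (- t) + cis t" by (simp add: complex_eq_iff)
    show ?thesis unfolding e by (simp add: x_def cis_mult algebra_simps)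
  qed
  have xm: "x m = \<i>" using c by (simp add: x_def)
  have last: "\<i> * cnj (x 1) = x (m - 1)"
  proof -
    have "real (m - 1) * t = real m * t + (- t)" using m by (simp add: of_nat_diff algebra_simps)
    then have "x (m - 1) = cis (real m * t) * cis (- t)" unfolding x_def cis_mult by simp
    then show ?thesis using c by (simp add: x_def cis_cnj)
  qed
  have "(\<Sum>v<m. herm_entry (mcycle1 m) u v * x v) = of_real (2 * cos t) * x u" if u: "u < m" for u
  proof -
    define F where "F v = herm_entry (mcycle1 m) u v * x v" for v
    have F: "F v = (if v = Suc u \<or> u = Suc v then 1 else
      if u = m - 1 \<and> v = 0 then \<i> else if u = 0 \<and> v = m - 1 then - \<i> else 0) * x v" if "v < m" for v
      unfolding F_def herm_entry_mcycle1[OF u that] ..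
    consider "u = 0" | "u = m - 1" | w where "u = Suc w" "Suc u < m" using u by (cases u) (auto, linarith)
    then have "(\<Sum>v<m. F v) = of_real (2 * cos t) * x u"
    proof cases
      case 1
      have "(\<Sum>v<m. F v) = F 1 + F (m - 1)"
        using m 1 by (intro sum_two) (auto simp: F)
      also have "F 1 = x 1" using F[of 1] 1 m by simp
      also have "F (m - 1) = - \<i> * x (m - 1)" using F[of "m - 1"] 1 m by auto
      also have "- \<i> * x (m - 1) = cnj (x 1)" unfolding last[symmetric] by (simp flip: mult.assoc)
      also have "x 1 + cnj (x 1) = of_real (2 * cos t) * x u" using 1 by (simp add: x_def complex_eq_iff)
      finally show ?thesis .
    next
      case 2
      have m2: "m = Suc (Suc (m - 2))" using m by simp
      have "(\<Sum>v<m. F v) = F (m - 2) + F 0"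
        using m 2 by (intro sum_two) (auto simp: F)
      also have "F (m - 2) = x (m - 2)" using F[of "m - 2"] 2 m by auto
      also have "F 0 = \<i>" using F[of 0] 2 m by (auto simp: x_def)
      also have "x (m - 2) + \<i> = of_real (2 * cos t) * x (Suc (m - 2))"
        using tri[of "m - 2"] m2 xm by simp
      also have "Suc (m - 2) = u" using 2 m by simp
      finally show ?thesis .
    next
      case 3
      have "(\<Sum>v<m. F v) = F w + F (Suc u)"
        using m 3 by (intro sum_two) (auto simp: F)
      also have "F w = x w" using F[of w] 3 u by simp
      also have "F (Suc u) = x (Suc u)" using F[of "Suc u"] 3 by simp
      also have "x w + x (Suc u) = of_real (2 * cos t) * x u" using tri[of w] 3 by simp
      finally show ?thesis .
    qed
    then show ?thesis by (simp add: F_def)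
  qed
  moreover have "x 0 \<noteq> 0" by (simp add: x_def)
  ultimately show ?thesis unfolding ev_def using m by (intro exI[of _ x]) auto
qed

section \<open>Switching and its invariants\<close>

lemma mult_mat_index_sum:
  assumes "A \<in> carrier_mat n n" "B \<in> carrier_mat n n" "i < n" "j < n"
  shows "(A * B) $$ (i, j) = (\<Sum>k<n. A $$ (i, k) * B $$ (k, j))"
  using assms by (simp add: scalar_prod_def atLeast0LessThan)

text \<open>The intermediate graph \<open>Z\<close> is the pull-back of \<open>T\<close> along
  \<open>f\<close>: it has the vertices of \<open>Y\<close>, as switching requires, and
  \<open>f\<close> is an isomorphism onto \<open>T\<close>.\<close>

lemma switching_isomorphicI:
  assumes Y: "mixed_graph Y" and T: "mixed_graph T" and f: "bij_betw f (verts Y) (verts T)"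
    and d: "\<And>v. d v \<in> gunit"
    and eq: "\<And>u v. u \<in> verts Y \<Longrightarrow> v \<in> verts Y \<Longrightarrow>
      herm_entry Y u v = cnj (d u) * herm_entry T (f u) (f v) * d v"
  shows "switching_isomorphic Y T"
proof -
  define Z where "Z = \<lparr>verts = verts Y,
    uedges = {{x, y} |x y. x \<in> verts Y \<and> y \<in> verts Y \<and> {f x, f y} \<in> uedges T},
    arcs = {(x, y). x \<in> verts Y \<and> y \<in> verts Y \<and> (f x, f y) \<in> arcs T}\<rparr>"
  have vZ: "verts Z = verts Y" by (simp add: Z_def)
  have eZ: "{x, y} \<in> uedges Z \<longleftrightarrow> {f x, f y} \<in> uedges T" if "x \<in> verts Y" "y \<in> verts Y" for x y
  proof
    assume "{x, y} \<in> uedges Z"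
    then have "\<exists>a b. {x, y} = {a, b} \<and> a \<in> verts Y \<and> b \<in> verts Y \<and> {f a, f b} \<in> uedges T"
      by (simp only: Z_def mgraph.simps mem_Collect_eq)
    then obtain a b where ab: "{x, y} = {a, b}" "{f a, f b} \<in> uedges T" by (elim exE conjE)
    have "{f x, f y} = f ` {x, y}" by simp
    also have "\<dots> = {f a, f b}" unfolding ab(1) by simp
    finally show "{f x, f y} \<in> uedges T" using ab(2) by simp
  next
    assume "{f x, f y} \<in> uedges T"
    then have "\<exists>a b. {x, y} = {a, b} \<and> a \<in> verts Y \<and> b \<in> verts Y \<and> {f a, f b} \<in> uedges T"
      using that by (intro exI[of _ x] exI[of _ y] conjI refl)
    then show "{x, y} \<in> uedges Z" by (simp only: Z_def mgraph.simps mem_Collect_eq)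
  qed
  have aZ: "(x, y) \<in> arcs Z \<longleftrightarrow> (f x, f y) \<in> arcs T" if "x \<in> verts Y" "y \<in> verts Y" for x y
    using that by (simp add: Z_def)
  have hZ: "herm_entry Z x y = herm_entry T (f x) (f y)" if "x \<in> verts Y" "y \<in> verts Y" for x y
    unfolding herm_entry_def eZ[OF that] aZ[OF that] aZ[OF that(2,1)] ..
  have mZ: "mixed_graph Z"
    unfolding mixed_graph_def
  proof (intro conjI ballI)
    show "finite (verts Z)" unfolding vZ by (rule mixed_graphD(1)[OF Y])
  next
    fix e assume "e \<in> uedges Z"
    then obtain x y where xy: "e = {x, y}" "x \<in> verts Y" "y \<in> verts Y" "{f x, f y} \<in> uedges T"
      unfolding Z_def mgraph.simps mem_Collect_eq by (elim exE conjE)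
    have "x \<noteq> y" using mixed_graphD(2)[OF T xy(4)] by metis
    then show "\<exists>x\<in>verts Z. \<exists>y\<in>verts Z. x \<noteq> y \<and> e = {x, y}"
      unfolding vZ using xy(1,2,3) by (intro bexI conjI)
  next
    fix p assume "p \<in> arcs Z"
    then obtain x y where xy: "p = (x, y)" "x \<in> verts Y" "y \<in> verts Y" "(f x, f y) \<in> arcs T" by (auto simp: Z_def)
    then show "case p of (x, y) \<Rightarrow> x \<in> verts Z \<and> y \<in> verts Z \<and> x \<noteq> y \<and> (y, x) \<notin> arcs Z \<and> {x, y} \<notin> uedges Z"
      using mixed_graphD(3)[OF T xy(4)] xy(2,3)
      unfolding xy(1) prod.case vZ eZ[OF xy(2,3)] aZ[OF xy(3,2)] by metis
  qed
  have iso: "mg_isomorphic Z T"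
    unfolding mg_isomorphic_def vZ by (intro exI[of _ f] conjI ballI f eZ aZ)
  define vs where "vs = vert_list (verts Y)"
  define n where "n = card (verts Y)"
  note vl = vert_list[OF mixed_graphD(1)[OF Y]]
  have vsV: "vs ! i \<in> verts Y" if "i < n" for i using nth_mem[of i vs] that vl by (simp add: vs_def n_def)
  define D where "D = mat n n (\<lambda>(i, j). if i = j then d (vs ! i) else 0)"
  define E where "E = mat n n (\<lambda>(i, j). if i = j then cnj (d (vs ! i)) else 0)"
  have DE: "(E * D) = 1\<^sub>m n" "(D * E) = 1\<^sub>m n"
  proof -
    show "E * D = 1\<^sub>m n"
    proof (rule eq_matI)
      fix i j assume ij: "i < dim_row (1\<^sub>m n)" "j < dim_col (1\<^sub>m n)"
      have "(E * D) $$ (i, j) = (\<Sum>k<n. (if i = k then cnj (d (vs ! i)) else 0) * (if k = j then d (vs ! k) else 0))"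
        using ij by (simp add: E_def D_def scalar_prod_def atLeast0LessThan)
      also have "\<dots> = cnj (d (vs ! i)) * (if i = j then d (vs ! i) else 0)"
        using ij by (subst sum_one[of i]) auto
      finally show "(E * D) $$ (i, j) = 1\<^sub>m n $$ (i, j)" using ij gunit_mult_cnj(2)[OF d] by simp
    qed (simp_all add: E_def D_def)
    then show "D * E = 1\<^sub>m n" by (rule mat_mult_left_right_inverse[rotated 2]) (simp_all add: E_def D_def)
  qed
  have hY: "herm_mat Y \<in> carrier_mat n n" "herm_mat Z \<in> carrier_mat n n"
    by (simp_all add: herm_mat_def n_def vZ)
  have "herm_mat Y = E * herm_mat Z * D"
  proof (rule eq_matI)
    fix i j assume "i < dim_row (E * herm_mat Z * D)" "j < dim_col (E * herm_mat Z * D)"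
    then have ij: "i < n" "j < n" by (simp_all add: E_def D_def)
    have EZ: "(E * herm_mat Z) $$ (i, l) = cnj (d (vs ! i)) * herm_mat Z $$ (i, l)" if l: "l < n" for l
    proof -
      have "(E * herm_mat Z) $$ (i, l) = (\<Sum>k<n. (if i = k then cnj (d (vs ! i)) else 0) * herm_mat Z $$ (k, l))"
        using ij l hY(2) by (simp add: E_def scalar_prod_def atLeast0LessThan)
      also have "\<dots> = cnj (d (vs ! i)) * herm_mat Z $$ (i, l)"
        using ij by (subst sum_one[of i]) auto
      finally show ?thesis .
    qed
    have EZc: "E * herm_mat Z \<in> carrier_mat n n"
      by (rule mult_carrier_mat[OF _ hY(2)]) (simp add: E_def)
    have "(E * herm_mat Z * D) $$ (i, j) = (\<Sum>k<n. (E * herm_mat Z) $$ (i, k) * (if k = j then d (vs ! k) else 0))"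
      using ij by (subst mult_mat_index_sum[OF EZc]) (simp_all add: D_def)
    also have "\<dots> = (E * herm_mat Z) $$ (i, j) * d (vs ! j)"
      using ij by (subst sum_one[of j]) auto
    also have "\<dots> = cnj (d (vs ! i)) * herm_entry Z (vs ! i) (vs ! j) * d (vs ! j)"
      unfolding EZ[OF ij(2)] using ij by (simp add: herm_mat_def vZ vs_def n_def)
    also have "\<dots> = herm_entry Y (vs ! i) (vs ! j)"
      unfolding hZ[OF vsV[OF ij(1)] vsV[OF ij(2)]] eq[OF vsV[OF ij(1)] vsV[OF ij(2)]] ..
    also have "\<dots> = herm_mat Y $$ (i, j)" using ij by (simp add: herm_mat_def vs_def n_def)
    finally show "herm_mat Y $$ (i, j) = (E * herm_mat Z * D) $$ (i, j)" ..
  qed (use hY in \<open>simp_all add: E_def D_def\<close>)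
  then have "similar_mat_wit (herm_mat Y) (herm_mat Z) E D"
    unfolding similar_mat_wit_def Let_def using hY DE by (simp add: E_def D_def)
  moreover have "diagonal_mat D" by (simp add: diagonal_mat_def D_def)
  moreover have "\<forall>j<dim_row D. D $$ (j, j) \<in> {1, -1, \<i>, -\<i>}"
    using d by (simp add: D_def gunit_def)
  ultimately have "switching_equivalent Y Z" unfolding switching_equivalent_def vZ by blast
  then show ?thesis unfolding switching_isomorphic_def using mZ iso by blast
qed

text \<open>Switching multiplies entries by non-zero numbers and thus preserves the underlying
  simple graph. This invariant is what distinguishes the union from the path.\<close>

lemma switching_equivalent_support:
  assumes sw: "switching_equivalent X Y" and X: "mixed_graph X" and uv: "u \<in> verts X" "v \<in> verts X"
  shows "herm_entry X u v \<noteq> 0 \<longleftrightarrow> herm_entry Y u v \<noteq> 0"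
proof -
  have V: "verts Y = verts X" using sw by (simp add: switching_equivalent_def)
  define n where "n = card (verts X)"
  obtain D E where D: "diagonal_mat D" "\<forall>j<dim_row D. D $$ (j, j) \<in> {1, -1, \<i>, -\<i>}"
    and w: "similar_mat_wit (herm_mat X) (herm_mat Y) E D"
    using sw by (auto simp: switching_equivalent_def)
  have c: "herm_mat X \<in> carrier_mat n n" "herm_mat Y \<in> carrier_mat n n" "E \<in> carrier_mat n n" "D \<in> carrier_mat n n"
    and ED: "E * D = 1\<^sub>m n" and eq: "herm_mat X = E * herm_mat Y * D"
    using w by (auto simp: similar_mat_wit_def Let_def herm_mat_def n_def)
  have Dk: "D $$ (j, j) \<noteq> 0" if "j < n" for j using D(2) c(4) that by fastforce
  have D0: "D $$ (i, j) = 0" if "i < n" "j < n" "i \<noteq> j" for i j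
    using D(1) c(4) that by (auto simp: diagonal_mat_def)
  have mulD: "(A * D) $$ (i, j) = A $$ (i, j) * D $$ (j, j)" if A: "A \<in> carrier_mat n n" and ij: "i < n" "j < n" for A i j
  proof -
    have "(A * D) $$ (i, j) = (\<Sum>k<n. A $$ (i, k) * D $$ (k, j))"
      by (rule mult_mat_index_sum[OF A c(4) ij])
    also have "\<dots> = A $$ (i, j) * D $$ (j, j)"
      using ij D0 by (intro sum_one) auto
    finally show ?thesis .
  qed
  have Ed: "E $$ (i, j) * D $$ (j, j) = (if i = j then 1 else 0)" if "i < n" "j < n" for i j
    using mulD[OF c(3) that] ED that by simp
  have E0: "E $$ (i, j) = 0" if "i < n" "j < n" "i \<noteq> j" for i j using Ed[OF that(1,2)] Dk[OF that(2)] that(3) by simp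
  have E1: "E $$ (i, i) \<noteq> 0" if "i < n" for i using Ed[OF that that] by auto
  have main: "herm_mat X $$ (i, j) = E $$ (i, i) * herm_mat Y $$ (i, j) * D $$ (j, j)" if ij: "i < n" "j < n" for i j
  proof -
    have "(E * herm_mat Y) $$ (i, j) = (\<Sum>k<n. E $$ (i, k) * herm_mat Y $$ (k, j))"
      by (rule mult_mat_index_sum[OF c(3,2) ij])
    also have "\<dots> = E $$ (i, i) * herm_mat Y $$ (i, j)"
      using ij E0 by (intro sum_one) auto
    finally show ?thesis unfolding eq using mulD[OF mult_carrier_mat[OF c(3,2)] ij] by simp
  qed
  note vl = vert_list[OF mixed_graphD(1)[OF X]]
  obtain i j where ij: "i < n" "j < n" "vert_list (verts X) ! i = u" "vert_list (verts X) ! j = v"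
    using uv vl unfolding n_def by (metis in_set_conv_nth)
  then show ?thesis using main[OF ij(1,2)] E1[OF ij(1)] Dk[OF ij(2)]
    by (simp add: herm_mat_def V n_def)
qed

lemma mpath_pathspec: "1 \<le> n \<Longrightarrow> gain_graph.pathspec (verts (mpath n)) (herm_entry (mpath n)) n"
proof -
  assume n: "1 \<le> n"
  interpret gain_graph "verts (mpath n)" "herm_entry (mpath n)" by (rule herm_entry_gain_graph[OF mpath_mixed])
  have "ev (herm_entry (mpath n)) {..<n} (of_real (ch n j))" if j: "1 \<le> j" "j \<le> n" for j
  proof -
    define t where "t = pi * real j / real (n + 1)"
    have nt: "real (Suc n) * t = pi * real j" by (simp add: t_def)
    have "pi * real j < pi * real (n + 1)" using j by (intro mult_strict_left_mono) auto
    then have "t < pi" by (simp add: t_def divide_less_eq)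
    moreover have "0 < t" unfolding t_def using j by (intro divide_pos_pos mult_pos_pos) auto
    ultimately have "sin t \<noteq> 0" using sin_gt_zero[of t] by simp
    moreover have "sin (real (Suc n) * t) = 0" unfolding nt by (rule sin_npi2)
    ultimately show ?thesis using mpath_ev[of t n] n by (simp add: ch_def t_def)
  qed
  then show ?thesis unfolding pathspec_def by (simp add: verts_simps)
qed

text \<open>Put \<open>t = pi j / (4 k + 2)\<close>. For even \<open>j\<close> the path condition
  \<open>sin ((2 k + 1) t) = 0\<close> holds. For odd \<open>j\<close> the number
  \<open>cis ((2 k + 1) t)\<close> is \<open>\<i> ^ j\<close>, so the cycle carries the eigenvalue
  with the wave number \<open>t\<close> or \<open>-t\<close> according to \<open>j\<close> modulo
  4.\<close>

lemma union_pathspec: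
  assumes k: "1 \<le> k"
  defines "U \<equiv> disj_union (mpath (2 * k)) (mcycle1 (2 * k + 1))"
  shows "gain_graph.pathspec (verts U) (herm_entry U) (4 * k + 1)"
proof -
  have mU: "mixed_graph U" unfolding U_def by (intro disj_union_mixed mpath_mixed mcycle1_mixed) (use k in simp)
  interpret gain_graph "verts U" "herm_entry U" by (rule herm_entry_gain_graph[OF mU])
  have vU: "verts U = Inl ` {..<2 * k} \<union> Inr ` {..<2 * k + 1}" by (simp add: U_def verts_simps)
  have card: "card (verts U) = 4 * k + 1"
    unfolding vU by (subst card_Un_disjoint) (auto simp: card_image)
  have cl: "closed (Inl ` {..<2 * k})" "closed (Inr ` {..<2 * k + 1})"
    unfolding closed_def unfolding vU by (auto simp: U_def herm_entry_disj_union)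
  have e: "ev (herm_entry U) (verts U) (of_real (ch (4 * k + 1) j))" if j: "1 \<le> j" "j \<le> 4 * k + 1" for j
  proof -
    define t where "t = pi * real j / real (4 * k + 1 + 1)"
    have nt: "2 * (real (2 * k + 1) * t) = pi * real j"
    proof -
      have "real (4 * k + 1 + 1) * t = pi * real j" by (simp add: t_def)
      moreover have "real (4 * k + 1 + 1) = 2 * real (2 * k + 1)" by simp
      ultimately show ?thesis by (simp only: mult.assoc)
    qed
    have ch: "ch (4 * k + 1) j = 2 * cos t" by (simp add: ch_def t_def)
    show ?thesis
    proof (cases "even j")
      case True
      then obtain i where i: "j = 2 * i" by blast
      have kt: "real (Suc (2 * k)) * t = pi * real i" using nt unfolding i by simp
      have "pi * real j < pi * real (4 * k + 1 + 1)" using j by (intro mult_strict_left_mono) auto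
      then have "t < pi" by (simp add: t_def divide_less_eq)
      moreover have "0 < t" unfolding t_def using j by (intro divide_pos_pos mult_pos_pos) auto
      ultimately have s: "sin t \<noteq> 0" using sin_gt_zero[of t] by simp
      have "sin (real (Suc (2 * k)) * t) = 0" unfolding kt by (rule sin_npi2)
      then have "ev (herm_entry (mpath (2 * k))) {..<2 * k} (of_real (2 * cos t))"
        using mpath_ev[OF s] k by simp
      then have "ev (herm_entry U) (Inl ` {..<2 * k}) (of_real (2 * cos t))"
        by (rule ev_image[rotated 2]) (simp_all add: U_def herm_entry_disj_union)
      then show ?thesis using ev_mono[OF cl(1)] ch by simp
    next
      case False
      have "\<exists>s. cos s = cos t \<and> cis (real (2 * k + 1) * s) = \<i>"
      proof -
        have i2: "cis (pi / 2) = \<i>" by (simp add: complex_eq_iff)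
        have "j mod 4 = 1 \<or> j mod 4 = 3" using False by presburger
        then show ?thesis
        proof
          assume "j mod 4 = 1"
          then obtain l where l: "j = 4 * l + 1" by (metis mod_mult_div_eq add.commute mult.commute)
          have "real (2 * k + 1) * t = pi / 2 + 2 * pi * real l" using nt unfolding l by (simp add: algebra_simps)
          then have "cis (real (2 * k + 1) * t) = cis (pi / 2) * cis (2 * pi * real l)" by (simp only: cis_mult)
          also have "cis (2 * pi * real l) = 1" by (rule cis_multiple_2pi) simp
          finally show ?thesis using i2 by (intro exI[of _ t]) simp
        next
          assume "j mod 4 = 3"
          then obtain l where l: "j = 4 * l + 3" by (metis mod_mult_div_eq add.commute mult.commute)
          have "real (2 * k + 1) * (- t) = pi / 2 + 2 * pi * (- real (l + 1))" using nt unfolding l by (simp add: algebra_simps)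
          then have "cis (real (2 * k + 1) * (- t)) = cis (pi / 2) * cis (2 * pi * (- real (l + 1)))" by (simp only: cis_mult)
          also have "cis (2 * pi * (- real (l + 1))) = 1" by (rule cis_multiple_2pi) (simp only: Ints_minus Ints_of_nat)
          finally show ?thesis using i2 by (intro exI[of _ "- t"]) simp
        qed
      qed
      then obtain s where s: "cos s = cos t" "cis (real (2 * k + 1) * s) = \<i>" by blast
      have "ev (herm_entry (mcycle1 (2 * k + 1))) {..<2 * k + 1} (of_real (2 * cos s))"
        by (rule mcycle1_ev[OF s(2)]) (use k in simp)
      then have "ev (herm_entry U) (Inr ` {..<2 * k + 1}) (of_real (2 * cos s))"
        by (rule ev_image[rotated 2]) (simp_all add: U_def herm_entry_disj_union)
      then show ?thesis using ev_mono[OF cl(2)] ch s(1) by simp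
    qed
  qed
  show ?thesis unfolding pathspec_def using card e by blast
qed

text \<open>\<open>side\<close> tells from which summand the vertex at a given place of the path
  comes. It is constant along edges, as switching keeps the support, hence constant on the connected
  path, although both summands are non-empty.\<close>

lemma union_not_path:
  assumes k: "1 \<le> k"
  defines "U \<equiv> disj_union (mpath (2 * k)) (mcycle1 (2 * k + 1))"
  shows "\<not> switching_isomorphic U (mpath (4 * k + 1))"
proof
  assume "switching_isomorphic U (mpath (4 * k + 1))"
  then obtain Z where Z: "mixed_graph Z" "switching_equivalent U Z" "mg_isomorphic Z (mpath (4 * k + 1))"
    by (auto simp: switching_isomorphic_def)
  have mU: "mixed_graph U" unfolding U_def by (intro disj_union_mixed mpath_mixed mcycle1_mixed) (use k in simp)
  have V: "verts Z = verts U" using Z(2) by (simp add: switching_equivalent_def)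
  obtain f where f: "bij_betw f (verts U) {..<4 * k + 1}"
    and fe: "\<And>x y. x \<in> verts U \<Longrightarrow> y \<in> verts U \<Longrightarrow> {x, y} \<in> uedges Z \<longleftrightarrow> {f x, f y} \<in> uedges (mpath (4 * k + 1))"
    using Z(3) unfolding mg_isomorphic_def V verts_simps(1) by blast
  have vU: "verts U = Inl ` {..<2 * k} \<union> Inr ` {..<2 * k + 1}" by (simp add: U_def verts_simps)
  define side where "side i \<longleftrightarrow> isl (inv_into (verts U) f i)" for i
  have step: "side i \<longleftrightarrow> side (Suc i)" if i: "Suc i < 4 * k + 1" for i
  proof -
    define x where "x = inv_into (verts U) f i"
    define y where "y = inv_into (verts U) f (Suc i)"
    have im: "f ` verts U = {..<4 * k + 1}" using f by (simp add: bij_betw_def)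
    have xy: "x \<in> verts U" "y \<in> verts U" "f x = i" "f y = Suc i"
      using i im unfolding x_def y_def by (auto intro!: inv_into_into f_inv_into_f)
    have "{f x, f y} \<in> uedges (mpath (4 * k + 1))" unfolding xy(3,4) mpath_edge using i by simp
    then have "{x, y} \<in> uedges Z" using fe[OF xy(1,2)] by blast
    then have "herm_entry Z x y \<noteq> 0" by (simp add: herm_entry_def)
    then have "herm_entry U x y \<noteq> 0" using switching_equivalent_support[OF Z(2) mU xy(1,2)] by blast
    then have "isl x \<longleftrightarrow> isl y" by (cases x; cases y) (simp_all add: U_def herm_entry_disj_union)
    then show ?thesis by (simp add: side_def x_def y_def)
  qed
  have all: "i < 4 * k + 1 \<Longrightarrow> side i \<longleftrightarrow> side 0" for i
  proof (induction i)
    case (Suc i)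
    then show ?case using step[of i] by simp
  qed simp
  have inj: "inj_on f (verts U)" using f by (simp add: bij_betw_def)
  have l: "Inl 0 \<in> verts U" and r: "Inr 0 \<in> verts U" using k by (auto simp: vU)
  have fl: "f (Inl 0) < 4 * k + 1" and fr: "f (Inr 0) < 4 * k + 1" using f l r by (auto simp: bij_betw_def)
  have "side (f (Inl 0))" "\<not> side (f (Inr 0))"
    using inv_into_f_f[OF inj l] inv_into_f_f[OF inj r] by (simp_all add: side_def)
  then show False using all[OF fl] all[OF fr] by blast
qed

section \<open>From gauges to switching isomorphisms\<close>

lemma list_index_bij:
  assumes "distinct ws"
  obtains g where "\<And>i. i < length ws \<Longrightarrow> g (ws ! i) = (i :: nat)"
proof
  fix i assume "i < length ws"
  then show "(\<lambda>v. THE i. i < length ws \<and> ws ! i = v) (ws ! i) = i"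
    using assms by (auto intro!: the_equality simp: nth_eq_iff_index_eq)
qed

lemma path_gauge_switching:
  assumes Y: "mixed_graph Y" and ws: "set ws = verts Y" "length ws = n"
    and g: "gain_graph.path_gauge (herm_entry Y) ws"
  shows "switching_isomorphic Y (mpath n)"
proof -
  interpret gain_graph "verts Y" "herm_entry Y" by (rule herm_entry_gain_graph[OF Y])
  obtain d where d: "distinct ws" "\<And>i. d i \<in> gunit"
    and e: "\<And>i j. i < n \<Longrightarrow> j < n \<Longrightarrow> herm_entry Y (ws ! i) (ws ! j) = cnj (d i) * (if j = Suc i \<or> i = Suc j then 1 else 0) * d j"
    using g unfolding path_gauge_def ws(2) by (elim exE conjE) metis
  obtain f where f: "\<And>i. i < length ws \<Longrightarrow> f (ws ! i) = i" using list_index_bij[OF d(1)] by blast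
  have at: "\<exists>i<n. v = ws ! i" if "v \<in> set ws" for v using that ws(2) by (metis in_set_conv_nth)
  have fi: "f v < n \<and> ws ! f v = v" if v: "v \<in> set ws" for v using at[OF v] f ws(2) by auto
  have bij: "bij_betw f (set ws) {..<n}"
  proof (rule bij_betw_byWitness[where f' = "nth ws"])
    show "\<forall>a'\<in>{..<n}. f (ws ! a') = a'" using f ws(2) by simp
    show "(!) ws ` {..<n} \<subseteq> set ws" using ws(2) by auto
  qed (use fi in auto)
  show ?thesis
  proof (rule switching_isomorphicI[OF Y mpath_mixed, where f = f and d = "\<lambda>v. d (f v)"])
    show "bij_betw f (verts Y) (verts (mpath n))" unfolding verts_simps ws(1)[symmetric] by (rule bij)
  next
    fix u v assume "u \<in> verts Y" "v \<in> verts Y"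
    then have u: "f u < n" "ws ! f u = u" and v: "f v < n" "ws ! f v = v" using fi unfolding ws(1) by simp_all
    show "herm_entry Y u v = cnj (d (f u)) * herm_entry (mpath n) (f u) (f v) * d (f v)"
      using e[OF u(1) v(1)] unfolding u(2) v(2) herm_entry_mpath[OF u(1) v(1)] .
  qed (rule d(2))
qed

text \<open>Both holonomies give the same target: running through the cycle backwards, by
  \<open>i\<close> to \<open>m - 1 - i\<close>, turns -\<i> into \<i>.\<close>

lemma cycle_gauge_mcycle1:
  assumes Y: "mixed_graph Y" and cs: "length cs = m" "3 \<le> m"
    and g: "gain_graph.cycle_gauge (herm_entry Y) \<i> cs \<or> gain_graph.cycle_gauge (herm_entry Y) (-\<i>) cs"
  obtains d f where "bij_betw f (set cs) {..<m}" "\<And>v. d v \<in> gunit"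
    "\<And>u v. u \<in> set cs \<Longrightarrow> v \<in> set cs \<Longrightarrow> herm_entry Y u v = cnj (d u) * herm_entry (mcycle1 m) (f u) (f v) * d v"
proof -
  interpret gain_graph "verts Y" "herm_entry Y" by (rule herm_entry_gain_graph[OF Y])
  have dist: "distinct cs" using g unfolding cycle_gauge_def by (elim disjE conjE)
  obtain x where x: "\<And>i. i < length cs \<Longrightarrow> x (cs ! i) = i" using list_index_bij[OF dist] by blast
  have at: "\<exists>i<m. v = cs ! i" if "v \<in> set cs" for v using that cs by (metis in_set_conv_nth)
  have xi: "x v < m \<and> cs ! x v = v" if v: "v \<in> set cs" for v using at[OF v] x cs(1) by auto
  have bij: "bij_betw x (set cs) {..<m}"
  proof (rule bij_betw_byWitness[where f' = "nth cs"])
    show "\<forall>a'\<in>{..<m}. x (cs ! a') = a'" using x cs(1) by simp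
    show "(!) cs ` {..<m} \<subseteq> set cs" using cs by auto
  qed (use xi in auto)
  show thesis
  proof (cases "cycle_gauge \<i> cs")
    case True
    then obtain d where d: "\<And>i. d i \<in> gunit"
      and e: "\<And>i j. i < m \<Longrightarrow> j < m \<Longrightarrow> herm_entry Y (cs ! i) (cs ! j) = cnj (d i) *
        (if j = Suc i \<or> i = Suc j then 1 else if i = m - 1 \<and> j = 0 then \<i> else if i = 0 \<and> j = m - 1 then cnj \<i> else 0) * d j"
      unfolding cycle_gauge_def cs(1) by (elim exE conjE) metis
    show thesis
    proof (rule that[of x "\<lambda>v. d (x v)", OF bij d])
      fix u v assume "u \<in> set cs" "v \<in> set cs"
      then show "herm_entry Y u v = cnj (d (x u)) * herm_entry (mcycle1 m) (x u) (x v) * d (x v)"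
        using e[of "x u" "x v"] xi[of u] xi[of v] cs(2) by (simp add: herm_entry_mcycle1)
    qed
  next
    case False
    then have "cycle_gauge (- \<i>) cs" using g by blast
    then obtain d where d: "\<And>i. d i \<in> gunit"
      and e: "\<And>i j. i < m \<Longrightarrow> j < m \<Longrightarrow> herm_entry Y (cs ! i) (cs ! j) = cnj (d i) *
        (if j = Suc i \<or> i = Suc j then 1 else if i = m - 1 \<and> j = 0 then - \<i> else if i = 0 \<and> j = m - 1 then cnj (- \<i>) else 0) * d j"
      unfolding cycle_gauge_def cs(1) by (elim exE conjE) metis
    have r: "bij_betw (\<lambda>i. m - 1 - i) {..<m} {..<m}"
      by (rule bij_betw_byWitness[where f' = "\<lambda>i. m - 1 - i"]) auto
    have T: "herm_entry (mcycle1 m) (m - 1 - i) (m - 1 - j) =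
        (if j = Suc i \<or> i = Suc j then 1 else if i = m - 1 \<and> j = 0 then - \<i> else if i = 0 \<and> j = m - 1 then cnj (- \<i>) else 0)"
      if ij: "i < m" "j < m" for i j
    proof -
      have "(m - 1 - j = Suc (m - 1 - i)) = (i = Suc j)" "(m - 1 - i = Suc (m - 1 - j)) = (j = Suc i)"
        "(m - 1 - i = 0) = (i = m - 1)" "(m - 1 - j = 0) = (j = m - 1)"
        "(m - 1 - i = m - 1) = (i = 0)" "(m - 1 - j = m - 1) = (j = 0)"
        "m - 1 - i < m" "m - 1 - j < m"
        using ij by arith+
      then show ?thesis using cs(2) by (subst herm_entry_mcycle1) auto
    qed
    show thesis
    proof (rule that[of "(\<lambda>i. m - 1 - i) \<circ> x" "\<lambda>v. d (x v)", OF bij_betw_trans[OF bij r] d])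
      fix u v assume uv: "u \<in> set cs" "v \<in> set cs"
      then have "x u < m" "x v < m" "cs ! x u = u" "cs ! x v = v" using xi by auto
      then show "herm_entry Y u v = cnj (d (x u)) * herm_entry (mcycle1 m) (((\<lambda>i. m - 1 - i) \<circ> x) u) (((\<lambda>i. m - 1 - i) \<circ> x) v) * d (x v)"
        unfolding o_def using e[of "x u" "x v"] T[of "x u" "x v"] by simp
    qed
  qed
qed

text \<open>There are no entries between \<open>cs\<close> and \<open>ws\<close>, so the switchings
  of the two parts can be chosen independently and glued.\<close>

lemma cycle_path_gauge_switching:
  assumes Y: "mixed_graph Y" and V: "set cs \<union> set ws = verts Y" "set cs \<inter> set ws = {}"
    and len: "length cs = m" "3 \<le> m" "length ws = n"
    and z: "\<forall>u\<in>set cs. \<forall>v\<in>set ws. herm_entry Y u v = 0"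
    and p: "gain_graph.path_gauge (herm_entry Y) ws"
    and c: "gain_graph.cycle_gauge (herm_entry Y) \<i> cs \<or> gain_graph.cycle_gauge (herm_entry Y) (-\<i>) cs"
  shows "switching_isomorphic Y (disj_union (mpath n) (mcycle1 m))"
proof -
  interpret gain_graph "verts Y" "herm_entry Y" by (rule herm_entry_gain_graph[OF Y])
  obtain d where d: "distinct ws" "\<And>i. d i \<in> gunit"
    and e: "\<And>i j. i < n \<Longrightarrow> j < n \<Longrightarrow> herm_entry Y (ws ! i) (ws ! j) = cnj (d i) * (if j = Suc i \<or> i = Suc j then 1 else 0) * d j"
    using p unfolding path_gauge_def len(3) by (elim exE conjE) metis
  obtain x where x: "\<And>i. i < length ws \<Longrightarrow> x (ws ! i) = i" using list_index_bij[OF d(1)] by blast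
  have at: "\<exists>i<n. v = ws ! i" if "v \<in> set ws" for v using that len(3) by (metis in_set_conv_nth)
  have xi: "x v < n \<and> ws ! x v = v" if v: "v \<in> set ws" for v using at[OF v] x len(3) by auto
  have bx: "bij_betw x (set ws) {..<n}"
  proof (rule bij_betw_byWitness[where f' = "nth ws"])
    show "\<forall>a'\<in>{..<n}. x (ws ! a') = a'" using x len(3) by simp
    show "(!) ws ` {..<n} \<subseteq> set ws" using len(3) by auto
  qed (use xi in auto)
  obtain d' y where y: "bij_betw y (set cs) {..<m}" "\<And>v. d' v \<in> gunit"
    "\<And>u v. u \<in> set cs \<Longrightarrow> v \<in> set cs \<Longrightarrow> herm_entry Y u v = cnj (d' u) * herm_entry (mcycle1 m) (y u) (y v) * d' v"
    using cycle_gauge_mcycle1[OF Y len(1,2) c] by metis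
  let ?f = "\<lambda>v. if v \<in> set ws then Inl (x v) else Inr (y v)"
  let ?d = "\<lambda>v. if v \<in> set ws then d (x v) else d' v"
  have z': "herm_entry Y v u = 0" if "u \<in> set cs" "v \<in> set ws" for u v
    using z that by (subst herm) simp
  show ?thesis
  proof (rule switching_isomorphicI[OF Y, where f = ?f and d = ?d])
    show "mixed_graph (disj_union (mpath n) (mcycle1 m))"
      by (intro disj_union_mixed mpath_mixed mcycle1_mixed len(2))
    have "bij_betw ?f (set ws \<union> set cs) (Inl ` {..<n} \<union> Inr ` {..<m})"
    proof (rule bij_betw_combine)
      have "bij_betw (Inl \<circ> x) (set ws) (Inl ` {..<n})"
        by (rule bij_betw_trans[OF bx]) (simp add: bij_betw_def)
      then show "bij_betw ?f (set ws) (Inl ` {..<n})"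
        by (rule bij_betw_cong[THEN iffD1, rotated]) simp
      have "bij_betw (Inr \<circ> y) (set cs) (Inr ` {..<m})"
        by (rule bij_betw_trans[OF y(1)]) (simp add: bij_betw_def)
      then show "bij_betw ?f (set cs) (Inr ` {..<m})"
        by (rule bij_betw_cong[THEN iffD1, rotated]) (use V(2) in auto)
    qed auto
    then show "bij_betw ?f (verts Y) (verts (disj_union (mpath n) (mcycle1 m)))"
      using V(1) by (simp add: verts_simps Un_commute Plus_def)
  next
    fix u v assume uv: "u \<in> verts Y" "v \<in> verts Y"
    have cases: "a \<in> set ws \<and> a \<notin> set cs \<or> a \<notin> set ws \<and> a \<in> set cs" if "a \<in> verts Y" for a using that V by blast
    from cases[OF uv(1)] cases[OF uv(2)]
    show "herm_entry Y u v = cnj (?d u) * herm_entry (disj_union (mpath n) (mcycle1 m)) (?f u) (?f v) * ?d v"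
    proof (elim disjE conjE)
      assume a: "u \<in> set ws" "v \<in> set ws"
      show ?thesis using a e[of "x u" "x v"] xi[OF a(1)] xi[OF a(2)]
        by (simp add: herm_entry_disj_union herm_entry_mpath)
    next
      assume a: "u \<in> set ws" "v \<in> set cs" "v \<notin> set ws"
      then show ?thesis using z'[OF a(2,1)] by (simp add: herm_entry_disj_union)
    next
      assume a: "u \<in> set cs" "u \<notin> set ws" "v \<in> set ws"
      then show ?thesis using z by (simp add: herm_entry_disj_union)
    next
      assume a: "u \<in> set cs" "u \<notin> set ws" "v \<in> set cs" "v \<notin> set ws"
      then show ?thesis using y(3)[OF a(1,3)] by (simp add: herm_entry_disj_union)
    qed
  next
    show "?d v \<in> gunit" for v using d(2) y(2) by simp
  qed
qed

theorem theorem3p17: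
  fixes k :: nat
  assumes "k \<ge> 8"
  shows "cospectral_mate (disj_union (mpath (2 * k)) (mcycle1 (2 * k + 1))) (mpath (4 * k + 1)) \<and>
    \<not> switching_isomorphic (disj_union (mpath (2 * k)) (mcycle1 (2 * k + 1))) (mpath (4 * k + 1)) \<and>
    (\<forall>Y :: 'a mgraph. cospectral_mate Y (mpath (4 * k + 1)) \<longrightarrow>
       switching_isomorphic Y (mpath (4 * k + 1)) \<or>
       switching_isomorphic Y (disj_union (mpath (2 * k)) (mcycle1 (2 * k + 1))))"
proof (intro conjI allI impI)
  have k1: "1 \<le> k" and n1: "1 \<le> 4 * k + 1" and m3: "3 \<le> 2 * k + 1" using assms by simp_all
  have P: "spec_H (mpath (4 * k + 1)) = proots (map_poly complex_of_int (cheb (4 * k + 1)))"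
    by (rule pathspec_spec_H[OF mpath_mixed, THEN iffD1, OF mpath_pathspec[OF n1]])
  have mU: "mixed_graph (disj_union (mpath (2 * k)) (mcycle1 (2 * k + 1)))"
    by (intro disj_union_mixed mpath_mixed mcycle1_mixed m3)
  show "cospectral_mate (disj_union (mpath (2 * k)) (mcycle1 (2 * k + 1))) (mpath (4 * k + 1))"
    unfolding cospectral_mate_def P
    by (rule conjI[OF mU pathspec_spec_H[OF mU, THEN iffD1, OF union_pathspec[OF k1]]])
  show "\<not> switching_isomorphic (disj_union (mpath (2 * k)) (mcycle1 (2 * k + 1))) (mpath (4 * k + 1))"
    by (rule union_not_path[OF k1])
  fix Y :: "'a mgraph"
  assume "cospectral_mate Y (mpath (4 * k + 1))"
  then have c: "mixed_graph Y \<and> spec_H Y = proots (map_poly complex_of_int (cheb (4 * k + 1)))"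
    unfolding cospectral_mate_def P .
  note Y = conjunct1[OF c] and sY = conjunct2[OF c]
  interpret gain_graph "verts Y" "herm_entry Y" by (rule herm_entry_gain_graph[OF Y])
  have ps: "pathspec (4 * k + 1)" by (rule pathspec_spec_H[OF Y, THEN iffD2, OF sY])
  from path_or_cycle_and_path[OF ps assms]
  show "switching_isomorphic Y (mpath (4 * k + 1)) \<or>
       switching_isomorphic Y (disj_union (mpath (2 * k)) (mcycle1 (2 * k + 1)))"
  proof
    assume "\<exists>ws. set ws = verts Y \<and> length ws = 4 * k + 1 \<and> path_gauge ws"
    then obtain ws where a: "set ws = verts Y" "length ws = 4 * k + 1" "path_gauge ws" by (elim exE conjE)
    show ?thesis by (rule disjI1, rule path_gauge_switching[OF Y a])
  next
    assume "\<exists>cs ws. set cs \<union> set ws = verts Y \<and> set cs \<inter> set ws = {} \<and>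
      length cs = 2 * k + 1 \<and> length ws = 2 * k \<and> (\<forall>u\<in>set cs. \<forall>v\<in>set ws. herm_entry Y u v = 0) \<and>
      path_gauge ws \<and> (cycle_gauge \<i> cs \<or> cycle_gauge (- \<i>) cs)"
    then obtain cs ws where a: "set cs \<union> set ws = verts Y" "set cs \<inter> set ws = {}"
      "length cs = 2 * k + 1" "length ws = 2 * k" "\<forall>u\<in>set cs. \<forall>v\<in>set ws. herm_entry Y u v = 0"
      "path_gauge ws" "cycle_gauge \<i> cs \<or> cycle_gauge (- \<i>) cs" by (elim exE conjE)
    show ?thesis
      by (rule disjI2, rule cycle_path_gauge_switching[OF Y a(1,2,3) m3 a(4,5,6,7)])
  qed
qed

end
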